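(* Let $(x_n)_n$ be a (Schauder) basis of a Banach space $X$. (1) Suppose that every block subsequence of $(x_n)_n$ is RUD. Then $(x_n)_n$ is shrinking if and only if $X$ does not contain a subspace isomorphic to $\ell_1$. (2) Suppose that every block subsequence of $(x_n)_n$ is RUC. Then $(x_n)_n$ is boundedly complete if and only if $X$ does not contain a subspace isomorphic to $c_0$.
   Context: A series $\sum_n x_n$ in a Banach space is randomly unconditionally convergent if $\sum_n \varepsilon_n x_n$ converges for almost every $(\varepsilon_n)_n\in\{-1,1\}^{\mathbb N}$ with respect to the Haar probability measure. A (Schauder) basic sequence $(x_n)_n$ is RUC (of random unconditional convergence) if every convergent series $\sum_n a_nx_n$ ($a_n$ scalars) is randomly unconditionally convergent. It is RUD (of random unconditional divergence) if, whenever $\sum_n a_nx_n$ is randomly unconditionally convergent, the series $\sum_n a_nx_n$ converges. A block subsequence of $(x_n)_n$ is a sequence of non-zero vectors of the form $u_k=\sum_{j=p_k}^{q_k}\lambda_jx_j$ with $p_k\le q_k<p_{k+1}$. *)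

theory Defs
  imports "HOL-Probability.Probability"
begin

text \<open>Banach spaces are real, as everywhere in HOL-Analysis, so scalars are real numbers.\<close>

definition schauder_basis_of :: "'a::banach set \<Rightarrow> (nat \<Rightarrow> 'a) \<Rightarrow> bool" where
  "schauder_basis_of Y x \<longleftrightarrow>
     range x \<subseteq> Y \<and> (\<forall>v\<in>Y. \<exists>!a :: nat \<Rightarrow> real. (\<lambda>n. a n *\<^sub>R x n) sums v)"

definition basic_sequence :: "(nat \<Rightarrow> 'a::banach) \<Rightarrow> bool" where
  "basic_sequence x \<longleftrightarrow> schauder_basis_of (closure (span (range x))) x"

text \<open>The Haar probability measure of the compact group \<open>{-1,1}\<^sup>\<nat>\<close> is the product
  of the uniform measures on \<open>{-1,1}\<close>.\<close>

definition sign_measure :: "(nat \<Rightarrow> real) measure" where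
  "sign_measure = (\<Pi>\<^sub>M n\<in>UNIV. uniform_count_measure {-1, 1 :: real})"

definition randomly_unconditionally_convergent :: "(nat \<Rightarrow> 'a::banach) \<Rightarrow> bool" where
  "randomly_unconditionally_convergent x \<longleftrightarrow>
     (AE \<epsilon> in sign_measure. summable (\<lambda>n. \<epsilon> n *\<^sub>R x n))"

definition RUC :: "(nat \<Rightarrow> 'a::banach) \<Rightarrow> bool" where
  "RUC x \<longleftrightarrow> basic_sequence x \<and>
     (\<forall>a :: nat \<Rightarrow> real. summable (\<lambda>n. a n *\<^sub>R x n)
        \<longrightarrow> randomly_unconditionally_convergent (\<lambda>n. a n *\<^sub>R x n))"

definition RUD :: "(nat \<Rightarrow> 'a::banach) \<Rightarrow> bool" where
  "RUD x \<longleftrightarrow> basic_sequence x \<and>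
     (\<forall>a :: nat \<Rightarrow> real. randomly_unconditionally_convergent (\<lambda>n. a n *\<^sub>R x n)
        \<longrightarrow> summable (\<lambda>n. a n *\<^sub>R x n))"

definition block_subsequence :: "(nat \<Rightarrow> 'a::banach) \<Rightarrow> (nat \<Rightarrow> 'a) \<Rightarrow> bool" where
  "block_subsequence x u \<longleftrightarrow>
     (\<exists>(p :: nat \<Rightarrow> nat) q (l :: nat \<Rightarrow> real). \<forall>k.
        p k \<le> q k \<and> q k < p (Suc k) \<and>
        u k = (\<Sum>j = p k..q k. l j *\<^sub>R x j) \<and> u k \<noteq> 0)"

text \<open>Shrinking: the biorthogonal functionals form a Schauder basis of the dual space.
  The sequence \<open>f\<close> is unique when \<open>x\<close> is a basis, because the span of \<open>x\<close> is dense.\<close>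

definition shrinking :: "(nat \<Rightarrow> 'a::banach) \<Rightarrow> bool" where
  "shrinking x \<longleftrightarrow>
     (\<exists>f :: nat \<Rightarrow> ('a \<Rightarrow>\<^sub>L real).
        (\<forall>m n. blinfun_apply (f m) (x n) = (if m = n then 1 else 0)) \<and>
        schauder_basis_of UNIV f)"

definition boundedly_complete :: "(nat \<Rightarrow> 'a::banach) \<Rightarrow> bool" where
  "boundedly_complete x \<longleftrightarrow>
     (\<forall>a :: nat \<Rightarrow> real. bounded (range (\<lambda>N. \<Sum>n<N. a n *\<^sub>R x n))
        \<longrightarrow> summable (\<lambda>n. a n *\<^sub>R x n))"

definition l1_space :: "(nat \<Rightarrow> real) set" where
  "l1_space = {a. summable (\<lambda>n. \<bar>a n\<bar>)}"

definition l1_norm :: "(nat \<Rightarrow> real) \<Rightarrow> real" where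
  "l1_norm a = (\<Sum>n. \<bar>a n\<bar>)"

definition c0_space :: "(nat \<Rightarrow> real) set" where
  "c0_space = {a. a \<longlonglongrightarrow> 0}"

definition c0_norm :: "(nat \<Rightarrow> real) \<Rightarrow> real" where
  "c0_norm a = (SUP n. \<bar>a n\<bar>)"

text \<open>\<open>T\<close> is a linear isomorphism, bounded in both directions, from the space \<open>E\<close> of real
  sequences with norm \<open>N\<close> onto the subspace \<open>Y\<close>. Closedness of \<open>Y\<close> is automatic when \<open>E\<close>
  is complete for \<open>N\<close>.\<close>

definition isomorphism_onto ::
  "(nat \<Rightarrow> real) set \<Rightarrow> ((nat \<Rightarrow> real) \<Rightarrow> real) \<Rightarrow> 'a::banach set \<Rightarrow> ((nat \<Rightarrow> real) \<Rightarrow> 'a) \<Rightarrow> bool" where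
  "isomorphism_onto E N Y T \<longleftrightarrow>
     bij_betw T E Y \<and>
     (\<forall>a\<in>E. \<forall>b\<in>E. T (\<lambda>n. a n + b n) = T a + T b) \<and>
     (\<forall>r. \<forall>a\<in>E. T (\<lambda>n. r * a n) = r *\<^sub>R T a) \<and>
     (\<exists>C. \<forall>a\<in>E. norm (T a) \<le> C * N a) \<and>
     (\<exists>C. \<forall>a\<in>E. N a \<le> C * norm (T a))"

definition contains_isomorphic_subspace ::
  "'a::banach itself \<Rightarrow> (nat \<Rightarrow> real) set \<Rightarrow> ((nat \<Rightarrow> real) \<Rightarrow> real) \<Rightarrow> bool" where
  "contains_isomorphic_subspace X E N \<longleftrightarrow>
     (\<exists>(Y :: 'a set) T. subspace Y \<and> isomorphism_onto E N Y T)"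

end

theory Submission
  imports Defs
begin

text \<open>The argument has two halves of quite different nature.

  The \<open>obstructions\<close> use the basis alone. If the coordinate functionals are a basis of the
  dual, the dual is separable; but a copy of \<open>\<ell>\<^sub>1\<close> carries, by a Hahn-Banach extension, one
  functional for every sequence of signs, and these are uniformly separated
  (\<open>not_shrinking_if_contains_l1\<close>). If \<open>X\<close> contains \<open>c\<^sub>0\<close>, a gliding hump replaces a subsequence of
  its unit vectors by consecutive blocks with a summable error; the blocks have bounded partial
  sums and do not tend to zero (\<open>not_boundedly_complete_if_contains_c0\<close>).

  The converses extract a subspace from averages over random signs.

  For \<open>c\<^sub>0\<close>, a bounded divergent series \<open>\<Sum> a\<^sub>n x\<^sub>n\<close> is cut into blocks \<open>u\<^sub>k\<close> of norm at least
  \<open>\<delta>\<close> with bounded sums. Property RUC, applied to slowly decreasing multiples of \<open>\<Sum> u\<^sub>k\<close>, shows that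
  the random partial sums of \<open>\<Sum> \<epsilon>\<^sub>k u\<^sub>k\<close> stay below some \<open>M\<close> with probability above one half
  (\<open>RUC_signs_bounded\<close>). Kwapien's selection then produces a subsequence on which every
  choice of signs is bounded by \<open>M\<close> (\<open>Kwapien_subsequence\<close>), and such a subsequence spans \<open>c\<^sub>0\<close>.

  For \<open>\<ell>\<^sub>1\<close>, a functional \<open>g\<close> that is not the norm limit of its expansion in the coordinate
  functionals yields bounded blocks with \<open>g(u\<^sub>k) = 1\<close>. Property RUD forces
  \<open>E \<parallel>\<Sum> \<epsilon>\<^sub>k a\<^sub>k u\<^sub>k\<parallel> \<ge> c \<Sum> a\<^sub>k\<close> for nonnegative \<open>a\<^sub>k\<close> supported on some tail
  (\<open>RUD_average_lower_bound\<close>). By the Mazur-Orlicz theorem there is a functional on \<open>X\<close>-valued functions of the signs, bounded by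
  \<open>E \<parallel>\<cdot>\<parallel>\<close>, with value at least \<open>c\<close> at every \<open>\<epsilon>\<^sub>k u\<^sub>k\<close> of the tail (\<open>exists_random_functional\<close>). Testing it
  against the Riesz products \<open>\<Prod> (1 + \<theta>\<^sub>i \<epsilon>\<^bsub>r i\<^esub>)\<close> of a sparse subsequence \<open>r\<close> gives functionals on
  \<open>X\<close>, of norm at most \<open>2\<close>, which separate the vectors \<open>u\<^bsub>r i\<^esub>\<close> with \<open>\<theta>\<^sub>i = 1\<close> from those with
  \<open>\<theta>\<^sub>i = -1\<close> around one common level; this is the lower \<open>\<ell>\<^sub>1\<close> estimate
  (\<open>l1_subsequence_of_random_functional\<close>).

  Both selections rest on one principle (\<open>sign_tree\<close>): finitely many strict inequalities survive
  the adjunction of a further sign \<open>\<epsilon>\<^sub>k\<close> with \<open>k\<close> large, because Bessel's inequality makes every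
  bounded functional nearly blind to \<open>\<epsilon>\<^sub>k\<close> (\<open>test_functional_bessel\<close>).\<close>

section \<open>Linear functionals below a sublinear one\<close>

definition sublinear :: "('v::real_vector \<Rightarrow> real) \<Rightarrow> bool" where
  "sublinear p \<longleftrightarrow> (\<forall>x y. p (x + y) \<le> p x + p y) \<and> (\<forall>c x. 0 \<le> c \<longrightarrow> p (c *\<^sub>R x) = c * p x)"

lemma sublinearD:
  assumes "sublinear p"
  shows sublinear_add: "p (x + y) \<le> p x + p y"
    and sublinear_scale: "0 \<le> c \<Longrightarrow> p (c *\<^sub>R x) = c * p x"
    and sublinear_zero: "p 0 = 0"
    and sublinear_minus: "- p (- x) \<le> p x"
proof -
  show add: "p (x + y) \<le> p x + p y" for x y
    using assms by (simp add: sublinear_def)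
  show scale: "0 \<le> c \<Longrightarrow> p (c *\<^sub>R x) = c * p x" for c x
    using assms by (simp add: sublinear_def)
  show zero: "p 0 = 0"
    using scale[of 0 0] by simp
  show "- p (- x) \<le> p x"
    using add[of x "- x"] zero by simp
qed

text \<open>The infimal convolution of \<open>p\<close> with the cone. It serves twice: for the cone of constraints in the
  Mazur-Orlicz theorem, and for a single ray in the proof that minimal sublinear functionals are
  linear.\<close>

lemma sublinear_below_cone:
  fixes p :: "'v::real_vector \<Rightarrow> real"
  assumes p: "sublinear p" and C: "convex_cone C"
    and below: "\<And>v b. (v, b) \<in> C \<Longrightarrow> b \<le> p v"
  obtains q where "sublinear q" "\<And>x. q x \<le> p x" "\<And>v b. (v, b) \<in> C \<Longrightarrow> q (- v) \<le> - b"
proof -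
  define g where "g x c = p (x + fst c) - snd c" for x :: 'v and c :: "'v \<times> real"
  define q where "q x = (INF c\<in>C. g x c)" for x
  have zero: "(0, 0) \<in> C"
    using C unfolding convex_cone_iff by (metis zero_prod_def)
  have lower: "- p (- x) \<le> g x c" if "c \<in> C" for x c
  proof -
    have "snd c \<le> p (fst c)" using below[of "fst c" "snd c"] that by simp
    also have "p (fst c) \<le> p (x + fst c) + p (- x)"
      using sublinear_add[OF p, of "x + fst c" "- x"] by simp
    finally show ?thesis by (simp add: g_def)
  qed
  have bdd: "bdd_below (g x ` C)" for x
    using lower by (intro bdd_belowI2)
  have q_le: "q x \<le> g x c" if "c \<in> C" for x c
    unfolding q_def by (rule cINF_lower[OF bdd that])
  have q_ge: "m \<le> q x" if "\<And>c. c \<in> C \<Longrightarrow> m \<le> g x c" for m x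
    unfolding q_def using zero that by (intro cINF_greatest) auto
  have add: "q (x + y) \<le> q x + q y" for x y
  proof -
    have "q (x + y) - g x c \<le> q y" if c: "c \<in> C" for c
    proof (rule q_ge)
      fix d assume d: "d \<in> C"
      have "q (x + y) \<le> g (x + y) (c + d)"
        by (rule q_le) (rule convex_cone_add[OF C c d])
      also have "\<dots> \<le> g x c + g y d"
        using sublinear_add[OF p, of "x + fst c" "y + fst d"] by (simp add: g_def algebra_simps)
      finally show "q (x + y) - g x c \<le> g y d" by simp
    qed
    then have "q (x + y) - q y \<le> q x"
      by (intro q_ge) (simp add: algebra_simps)
    then show ?thesis by simp
  qed
  have half: "q (c *\<^sub>R x) \<le> c * q x" if c: "c > 0" for c x
  proof -
    have "q (c *\<^sub>R x) / c \<le> q x"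
    proof (rule q_ge)
      fix d assume d: "d \<in> C"
      have "q (c *\<^sub>R x) \<le> g (c *\<^sub>R x) (c *\<^sub>R d)"
        using c by (intro q_le convex_cone_scaleR[OF C]) (auto simp: d)
      also have "\<dots> = c * g x d"
        using sublinear_scale[OF p, of c "x + fst d"] c by (simp add: g_def algebra_simps)
      finally show "q (c *\<^sub>R x) / c \<le> g x d"
        using c by (simp add: field_simps)
    qed
    then show ?thesis using c by (simp add: field_simps)
  qed
  have "q 0 = 0"
  proof (rule antisym)
    show "q 0 \<le> 0" using q_le[OF zero, of 0] sublinear_zero[OF p] by (simp add: g_def)
    show "0 \<le> q 0" using lower[of _ 0] sublinear_zero[OF p] by (intro q_ge) simp
  qed
  have scale: "q (c *\<^sub>R x) = c * q x" if c: "0 \<le> c" for c x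
  proof (cases "c = 0")
    case False
    then have "c > 0" using c by simp
    have "q x = q ((1/c) *\<^sub>R (c *\<^sub>R x))" using \<open>c > 0\<close> by simp
    also have "\<dots> \<le> (1/c) * q (c *\<^sub>R x)" using half[of "1/c" "c *\<^sub>R x"] \<open>c > 0\<close> by simp
    finally show ?thesis using half[OF \<open>c > 0\<close>, of x] \<open>c > 0\<close> by (simp add: field_simps)
  qed (simp add: \<open>q 0 = 0\<close>)
  show ?thesis
  proof
    show "sublinear q" using add scale by (simp add: sublinear_def)
    show "q x \<le> p x" for x using q_le[OF zero, of x] by (simp add: g_def)
    show "q (- v) \<le> - b" if "(v, b) \<in> C" for v b
      using q_le[OF that, of "- v"] sublinear_zero[OF p] by (simp add: g_def)
  qed
qed

lemma exists_minimal_sublinear: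
  fixes p :: "'v::real_vector \<Rightarrow> real"
  assumes p: "sublinear p"
  obtains q where "sublinear q" "q \<le> p" "\<And>r. sublinear r \<Longrightarrow> r \<le> q \<Longrightarrow> r = q"
proof -
  define A where "A = {q. sublinear q \<and> q \<le> p}"
  have "\<exists>m\<in>A. \<forall>a\<in>A. a \<le> m \<longrightarrow> a = m"
  proof (rule predicate_Zorn)
    show "partial_order_on A (relation_of (\<lambda>a b. b \<le> a) A)"
      by (rule partial_order_on_relation_ofI) auto
    fix C assume C: "C \<in> Chains (relation_of (\<lambda>a b. b \<le> a) A)"
    then have CA: "C \<subseteq> A" and total: "\<And>a b. a \<in> C \<Longrightarrow> b \<in> C \<Longrightarrow> a \<le> b \<or> b \<le> a"
      by (auto simp: Chains_def relation_of_def)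
    show "\<exists>u\<in>A. \<forall>a\<in>C. u \<le> a"
    proof (cases "C = {}")
      case True
      then show ?thesis using p by (auto simp: A_def)
    next
      case False
      have sub: "sublinear a" and le_p: "a x \<le> p x" if "a \<in> C" for a x
        using CA that by (auto simp: A_def le_fun_def)
      define u where "u x = (INF a\<in>C. a x)" for x
      have lower: "- p (- x) \<le> a x" if "a \<in> C" for a x
        using sublinear_minus[OF sub[OF that], of x] le_p[OF that, of "- x"] by simp
      have u_le: "u x \<le> a x" if "a \<in> C" for a x
        unfolding u_def using lower that by (intro cINF_lower bdd_belowI2) auto
      have u_ge: "m \<le> u x" if "\<And>a. a \<in> C \<Longrightarrow> m \<le> a x" for m x
        unfolding u_def using False that by (intro cINF_greatest) auto
      have "sublinear u"
        unfolding sublinear_def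
      proof (intro conjI allI impI)
        fix x y
        have "u (x + y) - b y \<le> u x" if b: "b \<in> C" for b
        proof (rule u_ge)
          fix a assume a: "a \<in> C"
          obtain d where "d \<in> C" "d \<le> a" "d \<le> b"
            using total[OF a b] a b by blast
          then show "u (x + y) - b y \<le> a x"
            using u_le[of d "x + y"] sublinear_add[OF sub, of d x y]
            by (smt (verit) le_fun_def)
        qed
        then have "u (x + y) - u x \<le> u y"
          by (intro u_ge) (simp add: algebra_simps)
        then show "u (x + y) \<le> u x + u y" by simp
      next
        fix c :: real and x assume c: "0 \<le> c"
        have "u (c *\<^sub>R x) = (INF a\<in>C. c * a x)"
          unfolding u_def by (intro INF_cong refl) (simp add: sublinear_scale[OF sub c])
        also have "\<dots> = c * u x"
        proof (cases "c = 0")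
          case False
          with c have "c > 0" by simp
          show ?thesis
          proof (rule antisym)
            have "(INF a\<in>C. c * a x) / c \<le> u x"
            proof (rule u_ge)
              fix a assume a: "a \<in> C"
              have "(INF a\<in>C. c * a x) \<le> c * a x"
                using mult_left_mono[OF lower[of _ x] c] a
                by (intro cINF_lower bdd_belowI2[where m = "c * (- p (- x))"]) auto
              then show "(INF a\<in>C. c * a x) / c \<le> a x" using \<open>c > 0\<close> by (simp add: field_simps)
            qed
            then show "(INF a\<in>C. c * a x) \<le> c * u x" using \<open>c > 0\<close> by (simp add: field_simps)
            show "c * u x \<le> (INF a\<in>C. c * a x)"
              using u_le \<open>C \<noteq> {}\<close> c by (intro cINF_greatest mult_left_mono) auto
          qed
        qed (use \<open>C \<noteq> {}\<close> in simp)
        finally show "u (c *\<^sub>R x) = c * u x" .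
      qed
      moreover have "u \<le> p"
        using False u_le le_p by (meson ex_in_conv le_funI order_trans)
      ultimately show ?thesis
        using u_le by (auto simp: A_def le_fun_def)
    qed
  qed
  then show ?thesis
    using that unfolding A_def by (blast intro: order_trans)
qed

text \<open>Lowering \<open>q\<close> along the ray through \<open>(y, q y)\<close> changes nothing by minimality, which forces
  \<open>q (- y) = - q y\<close>; a sublinear functional that is odd is linear.\<close>

lemma minimal_sublinear_linear:
  fixes q :: "'v::real_vector \<Rightarrow> real"
  assumes q: "sublinear q" and min: "\<And>r. sublinear r \<Longrightarrow> r \<le> q \<Longrightarrow> r = q"
  shows "linear q"
proof -
  have minus: "q (- y) = - q y" for y
  proof -
    define C where "C = (\<lambda>t. (t *\<^sub>R y, t * q y)) ` {0..}"
    have "convex_cone C"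
    proof -
      have "C = (\<lambda>t. t *\<^sub>R (y, q y)) ` {0..}" by (auto simp: C_def)
      moreover have "convex_cone ((\<lambda>t. t *\<^sub>R (y, q y)) ` {0..})"
        unfolding convex_cone_iff
      proof (intro conjI ballI allI impI)
        show "0 \<in> (\<lambda>t. t *\<^sub>R (y, q y)) ` {0..}" by (rule image_eqI[of _ _ 0]) (auto simp: zero_prod_def)
        fix a b assume "a \<in> (\<lambda>t. t *\<^sub>R (y, q y)) ` {0..}" "b \<in> (\<lambda>t. t *\<^sub>R (y, q y)) ` {0..}"
        then obtain s t where st: "a = s *\<^sub>R (y, q y)" "b = t *\<^sub>R (y, q y)" "s \<ge> 0" "t \<ge> 0" by auto
        show "a + b \<in> (\<lambda>t. t *\<^sub>R (y, q y)) ` {0..}"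
          using st by (intro image_eqI[of _ _ "s + t"]) (auto simp: scaleR_left_distrib distrib_right)
      next
        fix a and c :: real assume "a \<in> (\<lambda>t. t *\<^sub>R (y, q y)) ` {0..}" "0 \<le> c"
        then show "c *\<^sub>R a \<in> (\<lambda>t. t *\<^sub>R (y, q y)) ` {0..}"
          by (auto intro!: image_eqI[of _ _ "c * _"])
      qed
      ultimately show ?thesis by simp
    qed
    moreover have "b \<le> q v" if "(v, b) \<in> C" for v b
      using that sublinear_scale[OF q] by (auto simp: C_def)
    ultimately obtain r where r: "sublinear r" "\<And>x. r x \<le> q x" "\<And>v b. (v, b) \<in> C \<Longrightarrow> r (- v) \<le> - b"
      using sublinear_below_cone[OF q, of C] by metis
    have "r = q" using min r by (simp add: le_fun_def)
    moreover have "(y, q y) \<in> C" by (auto simp: C_def intro!: image_eqI[of _ _ 1])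
    ultimately show ?thesis
      using r(3)[of y "q y"] sublinear_minus[OF q, of y] by simp
  qed
  show ?thesis
  proof (rule linearI)
    show "q (x + y) = q x + q y" for x y
      using sublinear_add[OF q, of x y] sublinear_add[OF q, of "- x" "- y"] minus[of x] minus[of y] minus[of "x + y"]
      by simp
    show "q (c *\<^sub>R x) = c *\<^sub>R q x" for c x
    proof (cases "0 \<le> c")
      case False
      have "q (c *\<^sub>R x) = q ((- c) *\<^sub>R (- x))" by simp
      also have "\<dots> = (- c) * q (- x)" using False by (intro sublinear_scale[OF q]) simp
      finally show ?thesis by (simp add: minus)
    qed (simp add: sublinear_scale[OF q])
  qed
qed

text \<open>The constraints \<open>b \<le> G v\<close> are absorbed into the sublinear functional, so that any minimal element
  below it satisfies them. A prescribed value is a pair of opposite constraints, so this contains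
  the extension form of the Hahn-Banach theorem.\<close>

theorem Mazur_Orlicz:
  fixes p :: "'v::real_vector \<Rightarrow> real"
  assumes p: "sublinear p" and C: "convex_cone C"
    and below: "\<And>v b. (v, b) \<in> C \<Longrightarrow> b \<le> p v"
  shows "\<exists>G. linear G \<and> (\<forall>x. G x \<le> p x) \<and> (\<forall>(v, b)\<in>C. b \<le> G v)"
proof -
  obtain q where q: "sublinear q" "\<And>x. q x \<le> p x" "\<And>v b. (v, b) \<in> C \<Longrightarrow> q (- v) \<le> - b"
    using sublinear_below_cone[OF assms] by blast
  obtain G where G: "sublinear G" "G \<le> q" "\<And>r. sublinear r \<Longrightarrow> r \<le> G \<Longrightarrow> r = G"
    using exists_minimal_sublinear[OF q(1)] by blast
  have lin: "linear G"
    by (rule minimal_sublinear_linear[OF G(1,3)])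
  have G_le: "G x \<le> q x" for x using G(2) by (simp add: le_fun_def)
  have "G x \<le> p x" for x using G_le q(2)[of x] by (rule order_trans)
  moreover have "b \<le> G v" if "(v, b) \<in> C" for v b
    using q(3)[OF that] G_le[of "- v"] linear_neg[OF lin, of v] by linarith
  ultimately show ?thesis using lin by blast
qed

section \<open>Schauder bases and their partial sums\<close>

lemma Baire_closed_cover:
  fixes F :: "nat \<Rightarrow> 'a::complete_space set"
  assumes closed: "\<And>n. closed (F n)" and cover: "(\<Union>n. F n) = UNIV"
  obtains n a r where "r > 0" "ball a r \<subseteq> F n"
proof -
  have "\<exists>n. interior (F n) \<noteq> {}"
  proof (rule ccontr)
    assume "\<not> ?thesis"
    then have "Met_TC.mtopology interior_of \<Union>(range F) = {}"
      using closed by (intro Met_TC.metric_Baire_category_alt) (auto simp: complete_UNIV)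
    then show False using cover by simp
  qed
  then obtain n a where "a \<in> interior (F n)" by blast
  then show ?thesis
    using that by (auto simp: mem_interior)
qed

locale schauder_basis =
  fixes x :: "nat \<Rightarrow> 'a::banach"
  assumes basis: "schauder_basis_of UNIV x"
begin

definition coef :: "'a \<Rightarrow> nat \<Rightarrow> real" where
  "coef v = (THE a. (\<lambda>n. a n *\<^sub>R x n) sums v)"

definition proj :: "nat \<Rightarrow> 'a \<Rightarrow> 'a" where
  "proj N v = (\<Sum>n<N. coef v n *\<^sub>R x n)"

lemma ex1_expansion: "\<exists>!a. (\<lambda>n. a n *\<^sub>R x n) sums v"
  using basis by (auto simp: schauder_basis_of_def)

lemma coef_sums: "(\<lambda>n. coef v n *\<^sub>R x n) sums v"
  unfolding coef_def by (rule theI'[OF ex1_expansion])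

lemma coef_eqI: "(\<lambda>n. a n *\<^sub>R x n) sums v \<Longrightarrow> coef v = a"
  using ex1_expansion coef_sums by blast

lemma coef_add: "coef (u + v) n = coef u n + coef v n"
  using coef_eqI[of "\<lambda>n. coef u n + coef v n" "u + v"] sums_add[OF coef_sums[of u] coef_sums[of v]]
  by (simp add: scaleR_left_distrib)

lemma coef_scale: "coef (c *\<^sub>R v) n = c * coef v n"
  using coef_eqI[of "\<lambda>n. c * coef v n" "c *\<^sub>R v"] sums_scaleR_right[OF coef_sums[of v], of c]
  by simp

lemma linear_coef: "linear (\<lambda>v. coef v n)"
  by (rule linearI) (simp_all add: coef_add coef_scale)

lemma coef_sum_basis:
  assumes "finite A"
  shows "coef (\<Sum>j\<in>A. l j *\<^sub>R x j) n = (if n \<in> A then l n else 0)"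
proof -
  have "(\<lambda>n. (if n \<in> A then l n else 0) *\<^sub>R x n) sums (\<Sum>n\<in>A. (if n \<in> A then l n else 0) *\<^sub>R x n)"
    using assms by (intro sums_finite) auto
  also have "(\<Sum>n\<in>A. (if n \<in> A then l n else 0) *\<^sub>R x n) = (\<Sum>j\<in>A. l j *\<^sub>R x j)"
    by (intro sum.cong) auto
  finally show ?thesis by (simp add: coef_eqI)
qed

lemma coef_basis: "coef (x m) n = (if n = m then 1 else 0)"
  using coef_sum_basis[of "{m}" "\<lambda>_. 1" n] by auto

lemma basis_nonzero: "x n \<noteq> 0"
  using coef_basis[of n n] linear_0[OF linear_coef, of n] by auto

lemma linear_proj: "linear (proj N)"
  by (rule linearI)
     (simp_all add: proj_def coef_add coef_scale scaleR_left_distrib sum.distrib scaleR_sum_right)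

lemma proj_tendsto: "(\<lambda>N. proj N v) \<longlonglongrightarrow> v"
  using coef_sums[of v] by (simp add: sums_def proj_def)

lemma proj_sum_basis:
  assumes "finite A"
  shows "proj N (\<Sum>j\<in>A. l j *\<^sub>R x j) = (\<Sum>j\<in>A \<inter> {..<N}. l j *\<^sub>R x j)"
proof -
  have "proj N (\<Sum>j\<in>A. l j *\<^sub>R x j) = (\<Sum>n<N. if n \<in> A then l n *\<^sub>R x n else 0)"
    unfolding proj_def coef_sum_basis[OF assms] by (intro sum.cong) auto
  also have "\<dots> = (\<Sum>j\<in>A \<inter> {..<N}. l j *\<^sub>R x j)"
    by (simp add: sum.inter_restrict[symmetric] Int_commute)
  finally show ?thesis .
qed

text \<open>The open mapping argument. By Baire, the closure of a set of vectors with partial sums bounded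
  by \<open>m\<close> contains a ball, so every \<open>v\<close> can be approximated up to half its norm by some \<open>w\<close> whose
  partial sums are controlled by \<open>norm v\<close>. Iterating on the error writes \<open>v\<close> as a series of such
  vectors, and uniqueness of the coefficients allows the expansions to be added up term by term.\<close>

lemma proj_uniformly_bounded: "\<exists>K>0. \<forall>N v. norm (proj N v) \<le> K * norm v"
proof -
  define A where "A m = {v. \<forall>N. norm (proj N v) \<le> real m}" for m
  have "(\<Union>m. closure (A m)) = UNIV"
  proof -
    have "\<exists>m. v \<in> A m" for v
    proof -
      obtain B where "\<And>N. norm (proj N v) \<le> B"
        using convergent_imp_Bseq[OF convergentI[OF proj_tendsto[of v]]] by (meson BseqE)
      moreover obtain m where "B \<le> real m" using real_arch_simple by blast
      ultimately have "v \<in> A m" unfolding A_def by (auto intro: order_trans)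
      then show ?thesis ..
    qed
    then show ?thesis using closure_subset by fastforce
  qed
  then obtain m a r where r: "r > 0" and ball: "ball a r \<subseteq> closure (A m)"
    using Baire_closed_cover[of "\<lambda>m. closure (A m)"] by (metis closed_closure)
  define C where "C = 4 * real m / r"
  have C0: "C \<ge> 0" using r by (simp add: C_def)
  have step: "\<exists>w. (\<forall>N. norm (proj N w) \<le> C * norm v) \<and> norm (v - w) \<le> norm v / 2" for v
  proof (cases "v = 0")
    case True
    then show ?thesis using linear_0[OF linear_proj] by (intro exI[of _ 0]) simp
  next
    case False
    \<comment> \<open>the scaling that moves \<open>a + t v\<close> into the ball around \<open>a\<close>\<close>
    define t where "t = r / (2 * norm v)"
    have t: "t > 0" using r False by (simp add: t_def)
    have "a + t *\<^sub>R v \<in> closure (A m)" "a \<in> closure (A m)"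
      using ball r False by (auto simp: subset_iff dist_norm t_def)
    moreover have "r / 8 > 0" using r by simp
    ultimately obtain y z where y: "y \<in> A m" "dist y (a + t *\<^sub>R v) < r / 8"
      and z: "z \<in> A m" "dist z a < r / 8"
      unfolding closure_approachable by blast
    define w where "w = (1/t) *\<^sub>R (y - z)"
    have "norm (proj N w) \<le> C * norm v" for N
    proof -
      have "proj N w = (1/t) *\<^sub>R (proj N y - proj N z)"
        unfolding w_def by (simp only: linear_scale[OF linear_proj] linear_diff[OF linear_proj])
      then have "norm (proj N w) = (1/t) * norm (proj N y - proj N z)" using t by simp
      also have "norm (proj N y - proj N z) \<le> m + m"
      proof -
        have "norm (proj N y) \<le> m" "norm (proj N z) \<le> m" using y z by (simp_all add: A_def)
        then show ?thesis using norm_triangle_ineq4[of "proj N y" "proj N z"] by linarith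
      qed
      finally have "norm (proj N w) \<le> (1/t) * (m + m)" using t by (simp add: field_simps)
      also have "\<dots> = C * norm v" using False r by (simp add: t_def C_def field_simps)
      finally show ?thesis .
    qed
    moreover have "norm (v - w) \<le> norm v / 2"
    proof -
      have "v - w = (1/t) *\<^sub>R ((a + t *\<^sub>R v - y) - (a - z))"
        using t by (simp add: w_def algebra_simps)
      then have "norm (v - w) = (1/t) * norm ((a + t *\<^sub>R v - y) - (a - z))" using t by simp
      also have "norm ((a + t *\<^sub>R v - y) - (a - z)) \<le> r / 8 + r / 8"
        using y z norm_triangle_ineq4[of "a + t *\<^sub>R v - y" "a - z"]
        by (simp add: dist_norm norm_minus_commute)
      finally have "norm (v - w) \<le> (1/t) * (r / 8 + r / 8)" using t by (simp add: field_simps)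
      also have "\<dots> = norm v / 2" using False r by (simp add: t_def field_simps)
      finally show ?thesis .
    qed
    ultimately show ?thesis by blast
  qed
  then obtain w where w: "\<And>v N. norm (proj N (w v)) \<le> C * norm v"
    and rest: "\<And>v. norm (v - w v) \<le> norm v / 2"
    by metis
  have "norm (proj N v) \<le> (2 * C + 1) * norm v" for N v
  proof -
    \<comment> \<open>the error left after \<open>j\<close> approximations\<close>
    define e where "e j = ((\<lambda>v. v - w v) ^^ j) v" for j
    have e_Suc: "e (Suc j) = e j - w (e j)" for j by (simp add: e_def)
    have e_norm: "norm (e j) \<le> norm v * (1/2)^j" for j
    proof (induction j)
      case (Suc j)
      then show ?case using rest[of "e j"] by (simp add: e_Suc)
    qed (simp add: e_def)
    define y where "y j = w (e j)" for j
    define M where "M j = C * norm v * (1/2)^j" for j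
    have M: "M sums (2 * (C * norm v))"
    proof -
      have "(\<lambda>j. C * norm v * (1/2)^j) sums (C * norm v * (1 / (1 - 1/2)))"
        by (intro sums_mult geometric_sums) simp
      then show ?thesis unfolding M_def by (simp add: mult.commute[of _ 2])
    qed
    have P_y: "norm (proj N (y j)) \<le> M j" for N j
      using w[of N "e j"] mult_left_mono[OF e_norm[of j] C0] by (simp add: y_def M_def mult.assoc)
    have y_le: "norm (y j) \<le> M j" for j
      using P_y by (intro LIMSEQ_le_const2[OF tendsto_norm[OF proj_tendsto[of "y j"]]]) blast
    have "e \<longlonglongrightarrow> 0"
    proof (rule Lim_null_comparison)
      show "\<forall>\<^sub>F j in sequentially. norm (e j) \<le> norm v * (1/2)^j" using e_norm by simp
      show "(\<lambda>j. norm v * (1/2)^j) \<longlonglongrightarrow> 0"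
        by (intro tendsto_mult_right_zero LIMSEQ_power_zero) simp
    qed
    moreover have "(\<Sum>j<J. y j) = v - e J" for J
      by (induction J) (simp_all add: e_Suc y_def, simp add: e_def)
    ultimately have y_sums: "y sums v"
      unfolding sums_def using tendsto_diff[OF tendsto_const[of v], of e 0] by simp
    have M_summable: "summable M" and M_suminf: "suminf M = 2 * (C * norm v)"
      using M by (simp_all add: sums_summable sums_unique[symmetric])
    \<comment> \<open>uniformity in \<open>N\<close> justifies exchanging the limits in \<open>N\<close> and in the number of terms\<close>
    have unif: "uniform_limit UNIV (\<lambda>J N. \<Sum>j<J. proj N (y j)) (\<lambda>N. \<Sum>j. proj N (y j)) sequentially"
      by (rule Weierstrass_m_test[OF P_y M_summable])
    have limit: "(\<lambda>N. \<Sum>j. proj N (y j)) \<longlonglongrightarrow> v"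
    proof (rule swap_uniform_limit'[OF _ _ unif])
      show "\<forall>\<^sub>F J in sequentially. (\<lambda>N. \<Sum>j<J. proj N (y j)) \<longlonglongrightarrow> (\<Sum>j<J. y j)"
        by (intro always_eventually allI tendsto_sum proj_tendsto)
      show "(\<lambda>J. \<Sum>j<J. y j) \<longlonglongrightarrow> v" using y_sums by (simp add: sums_def)
    qed simp_all
    define b where "b n = (\<Sum>j. coef (y j) n)" for n
    have coef_summable: "summable (\<lambda>j. coef (y j) n)" for n
    proof (rule summable_comparison_test')
      show "summable (\<lambda>j. 2 / norm (x n) * M j)"
        by (rule summable_mult[OF M_summable])
      show "norm (coef (y j) n) \<le> 2 / norm (x n) * M j" for j
      proof -
        have "norm (coef (y j) n) * norm (x n) = norm (proj (Suc n) (y j) - proj n (y j))"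
          by (simp add: proj_def)
        also have "\<dots> \<le> norm (proj (Suc n) (y j)) + norm (proj n (y j))" by (rule norm_triangle_ineq4)
        also have "\<dots> \<le> M j + M j" by (intro add_mono P_y)
        finally show ?thesis using basis_nonzero[of n] by (simp add: field_simps)
      qed
    qed
    have P_b: "(\<Sum>n<N. b n *\<^sub>R x n) = (\<Sum>j. proj N (y j))" for N
    proof -
      have "(\<lambda>j. \<Sum>n<N. coef (y j) n *\<^sub>R x n) sums (\<Sum>n<N. b n *\<^sub>R x n)"
        unfolding b_def by (intro sums_sum sums_scaleR_left summable_sums coef_summable)
      then show ?thesis by (simp add: sums_iff proj_def)
    qed
    have "coef v = b"
      using limit by (intro coef_eqI) (simp add: sums_def P_b)
    then have "norm (proj N v) = norm (\<Sum>j. proj N (y j))" by (simp add: proj_def P_b)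
    also have "\<dots> \<le> (\<Sum>j. M j)"
      by (rule norm_suminf_le[OF P_y M_summable])
    also have "\<dots> = 2 * (C * norm v)" by (rule M_suminf)
    also have "\<dots> \<le> (2 * C + 1) * norm v" by (simp add: distrib_right)
    finally show ?thesis .
  qed
  then show ?thesis using C0 by (intro exI[of _ "2 * C + 1"]) auto
qed

definition basis_const :: real where
  "basis_const = (SOME K. K > 0 \<and> (\<forall>N v. norm (proj N v) \<le> K * norm v))"

lemma basis_const_pos: "basis_const > 0"
  and norm_proj_le: "norm (proj N v) \<le> basis_const * norm v"
  using someI_ex[OF proj_uniformly_bounded] unfolding basis_const_def[symmetric] by blast+

lemma norm_initial_sum_le:
  assumes "m \<le> n"
  shows "norm (\<Sum>j<m. l j *\<^sub>R x j) \<le> basis_const * norm (\<Sum>j<n. l j *\<^sub>R x j)"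
proof -
  have "{..<n} \<inter> {..<m} = {..<m}" using assms by auto
  then show ?thesis
    using norm_proj_le[of m "\<Sum>j<n. l j *\<^sub>R x j"] by (simp add: proj_sum_basis)
qed

lemma bounded_linear_coef: "bounded_linear (\<lambda>v. coef v n)"
proof (rule bounded_linear_intro[where K = "2 * basis_const / norm (x n)"])
  show "norm (coef v n) \<le> norm v * (2 * basis_const / norm (x n))" for v
  proof -
    have "norm (coef v n) * norm (x n) = norm (proj (Suc n) v - proj n v)"
      by (simp add: proj_def)
    also have "\<dots> \<le> norm (proj (Suc n) v) + norm (proj n v)" by (rule norm_triangle_ineq4)
    also have "\<dots> \<le> basis_const * norm v + basis_const * norm v"
      by (intro add_mono norm_proj_le)
    finally show ?thesis using basis_nonzero[of n] by (simp add: field_simps)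
  qed
qed (simp_all add: coef_add coef_scale)

end

section \<open>Consecutive blocks\<close>

lemma block_index:
  fixes p :: "nat \<Rightarrow> nat"
  assumes p: "strict_mono p" and "p 0 \<le> i"
  obtains j where "p j \<le> i" "i < p (Suc j)"
proof -
  have "i < p (Suc i)" using strict_mono_imp_increasing[OF p, of "Suc i"] by simp
  then have less: "i < p (Suc (LEAST j. i < p (Suc j)))" by (rule LeastI)
  have "p (LEAST j. i < p (Suc j)) \<le> i"
  proof (cases "LEAST j. i < p (Suc j)")
    case (Suc k)
    then have "\<not> i < p (Suc k)" by (intro not_less_Least) simp
    then show ?thesis using Suc by simp
  qed (use assms in simp)
  with less show ?thesis using that by blast
qed

lemma block_index_unique:
  fixes p :: "nat \<Rightarrow> nat"
  assumes p: "strict_mono p" and "p j \<le> i" "i < p (Suc j)" "p k \<le> i" "i < p (Suc k)"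
  shows "j = k"
proof -
  have "p j < p (Suc k)" "p k < p (Suc j)" using assms by linarith+
  then have "j < Suc k" "k < Suc j" using strict_mono_less[OF p] by blast+
  then show ?thesis by simp
qed

text \<open>All constructions below build blocks one after the other, each depending only on where the
  previous one stopped. This packages the dependent choice, and glues the coefficient sequences of
  the blocks into a single one.\<close>

lemma consecutive_blocks_choice:
  fixes P :: "nat \<Rightarrow> nat \<Rightarrow> nat \<Rightarrow> (nat \<Rightarrow> 'b) \<Rightarrow> bool"
  assumes ex: "\<And>j N. \<exists>n>N. \<exists>l. P j N n l"
    and cong: "\<And>j N n l l'. P j N n l \<Longrightarrow> (\<And>i. N \<le> i \<Longrightarrow> i < n \<Longrightarrow> l i = l' i) \<Longrightarrow> P j N n l'"
  obtains p l where "strict_mono p" "p 0 = 0" "\<And>j. P j (p j) (p (Suc j)) l"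
proof -
  define nx where "nx j N = (SOME n. n > N \<and> (\<exists>l. P j N n l))" for j N
  define L where "L j N = (SOME l. P j N (nx j N) l)" for j N
  have nx: "nx j N > N \<and> (\<exists>l. P j N (nx j N) l)" for j N
    unfolding nx_def by (rule someI_ex) (use ex[of N j] in simp)
  have L: "P j N (nx j N) (L j N)" for j N
    using someI_ex[OF conjunct2[OF nx[of N j]]] by (simp only: L_def)
  define p where "p = rec_nat 0 nx"
  have p_Suc: "p (Suc j) = nx j (p j)" for j by (simp add: p_def)
  have p: "strict_mono p"
    by (simp add: strict_mono_Suc_iff p_Suc nx(1))
  define J where "J i = (THE j. p j \<le> i \<and> i < p (Suc j))" for i
  define l where "l i = L (J i) (p (J i)) i" for i
  have "P j (p j) (p (Suc j)) l" for j
  proof (rule cong)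
    show "P j (p j) (p (Suc j)) (L j (p j))" using L[of j "p j"] by (simp add: p_Suc)
    fix i assume i: "p j \<le> i" "i < p (Suc j)"
    then have "J i = j"
      unfolding J_def using block_index_unique[OF p] by (intro the_equality) blast+
    then show "L j (p j) i = l i" by (simp add: l_def)
  qed
  then show ?thesis using that[of p l] p by (simp add: p_def)
qed

lemma consecutive_block_subsequence:
  fixes p :: "nat \<Rightarrow> nat"
  assumes p: "strict_mono p"
    and nz: "\<And>k. (\<Sum>j\<in>{p k..<p (Suc k)}. l j *\<^sub>R x j) \<noteq> 0"
  shows "block_subsequence x (\<lambda>k. \<Sum>j\<in>{p k..<p (Suc k)}. l j *\<^sub>R x j)"
proof -
  have "p k < p (Suc k)" for k using p by (simp add: strict_mono_Suc_iff)
  then have "p k \<le> p (Suc k) - 1 \<and> p (Suc k) - 1 < p (Suc k) \<and> {p k..p (Suc k) - 1} = {p k..<p (Suc k)}" for k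
    by (metis Suc_pred' Suc_leI Suc_le_mono atLeastLessThanSuc_atLeastAtMost gr_zeroI lessI not_less_zero)
  then show ?thesis
    unfolding block_subsequence_def using nz
    by (intro exI[of _ p] exI[of _ "\<lambda>k. p (Suc k) - 1"] exI[of _ l]) simp
qed

lemma sum_consecutive_blocks:
  fixes g :: "nat \<Rightarrow> 'a::comm_monoid_add" and p :: "nat \<Rightarrow> nat"
  assumes p: "strict_mono p"
  shows "(\<Sum>k<m. \<Sum>j\<in>{p k..<p (Suc k)}. g j) = (\<Sum>j\<in>{p 0..<p m}. g j)"
proof (induction m)
  case (Suc m)
  have "p 0 \<le> p m" "p m \<le> p (Suc m)" using p by (simp_all add: strict_mono_less_eq)
  then show ?case using Suc by (simp add: sum.atLeastLessThan_concat)
qed simp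

text \<open>Grunblum's criterion for basic sequences. It passes to blocks and subsequences with the same
  constant.\<close>

definition grunblum :: "real \<Rightarrow> (nat \<Rightarrow> 'a::real_normed_vector) \<Rightarrow> bool" where
  "grunblum K u \<longleftrightarrow> K > 0 \<and>
     (\<forall>a m n. m \<le> n \<longrightarrow> norm (\<Sum>k<m. a k *\<^sub>R u k) \<le> K * norm (\<Sum>k<n. a k *\<^sub>R u k))"

lemma grunblum_pos: "grunblum K u \<Longrightarrow> K > 0"
  by (simp add: grunblum_def)

lemma grunblumD:
  "grunblum K u \<Longrightarrow> m \<le> n \<Longrightarrow> norm (\<Sum>k<m. a k *\<^sub>R u k) \<le> K * norm (\<Sum>k<n. a k *\<^sub>R u k)"
  by (simp add: grunblum_def)

lemma (in schauder_basis) grunblum_consecutive_blocks: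
  assumes p: "strict_mono p" "p 0 = 0"
  shows "grunblum basis_const (\<lambda>k. \<Sum>j\<in>{p k..<p (Suc k)}. l j *\<^sub>R x j)"
  unfolding grunblum_def
proof (intro conjI allI impI)
  fix a :: "nat \<Rightarrow> real" and m n :: nat assume "m \<le> n"
  define J where "J i = (THE j. p j \<le> i \<and> i < p (Suc j))" for i
  have J: "J i = j" if "p j \<le> i" "i < p (Suc j)" for i j
    unfolding J_def using block_index_unique[OF p(1)] that by (intro the_equality) blast+
  have sum: "(\<Sum>k<m. a k *\<^sub>R (\<Sum>j\<in>{p k..<p (Suc k)}. l j *\<^sub>R x j)) = (\<Sum>i<p m. (a (J i) * l i) *\<^sub>R x i)" for m
  proof -
    have "(\<Sum>k<m. a k *\<^sub>R (\<Sum>j\<in>{p k..<p (Suc k)}. l j *\<^sub>R x j))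
        = (\<Sum>k<m. \<Sum>j\<in>{p k..<p (Suc k)}. (a (J j) * l j) *\<^sub>R x j)"
      unfolding scaleR_sum_right by (intro sum.cong refl) (auto simp: J)
    then show ?thesis using sum_consecutive_blocks[OF p(1)] p(2) by (simp add: atLeast0LessThan)
  qed
  have "p m \<le> p n" using \<open>m \<le> n\<close> p(1) by (simp add: strict_mono_less_eq)
  then show "norm (\<Sum>k<m. a k *\<^sub>R (\<Sum>j\<in>{p k..<p (Suc k)}. l j *\<^sub>R x j))
      \<le> basis_const * norm (\<Sum>k<n. a k *\<^sub>R (\<Sum>j\<in>{p k..<p (Suc k)}. l j *\<^sub>R x j))"
    unfolding sum by (rule norm_initial_sum_le)
qed (rule basis_const_pos)

lemma grunblum_window:
  assumes u: "grunblum K u" and "m \<le> n"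
  shows "norm (\<Sum>k\<in>{N..<m}. a k *\<^sub>R u k) \<le> K * norm (\<Sum>k\<in>{N..<n}. a k *\<^sub>R u k)"
proof -
  have sum: "(\<Sum>k<m. (if N \<le> k then a k else 0) *\<^sub>R u k) = (\<Sum>k\<in>{N..<m}. a k *\<^sub>R u k)" for m
    by (intro sum.mono_neutral_cong_right) auto
  have "norm (\<Sum>k<m. (if N \<le> k then a k else 0) *\<^sub>R u k)
      \<le> K * norm (\<Sum>k<n. (if N \<le> k then a k else 0) *\<^sub>R u k)"
    by (rule grunblumD[OF assms])
  then show ?thesis by (simp only: sum)
qed

lemma grunblum_coordinate:
  assumes u: "grunblum K u" and "i < n"
  shows "\<bar>a i\<bar> * norm (u i) \<le> 2 * K * norm (\<Sum>k<n. a k *\<^sub>R u k)"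
proof -
  have "a i *\<^sub>R u i = (\<Sum>k<Suc i. a k *\<^sub>R u k) - (\<Sum>k<i. a k *\<^sub>R u k)" by simp
  then have "\<bar>a i\<bar> * norm (u i) \<le> norm (\<Sum>k<Suc i. a k *\<^sub>R u k) + norm (\<Sum>k<i. a k *\<^sub>R u k)"
    by (metis norm_scaleR norm_triangle_ineq4)
  moreover have "norm (\<Sum>k<Suc i. a k *\<^sub>R u k) \<le> K * norm (\<Sum>k<n. a k *\<^sub>R u k)"
    "norm (\<Sum>k<i. a k *\<^sub>R u k) \<le> K * norm (\<Sum>k<n. a k *\<^sub>R u k)"
    using \<open>i < n\<close> by (intro grunblumD[OF u]; simp)+
  ultimately show ?thesis by linarith
qed

lemma sum_over_subsequence:
  fixes g :: "nat \<Rightarrow> 'a::comm_monoid_add"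
  assumes r: "strict_mono (r :: nat \<Rightarrow> nat)"
  shows "(\<Sum>k<r m. if k \<in> range r then g k else 0) = (\<Sum>i<m. g (r i))"
proof -
  have "(\<Sum>k<r m. if k \<in> range r then g k else 0) = (\<Sum>k\<in>r ` {..<m}. g k)"
    by (intro sum.mono_neutral_cong_right) (auto simp: strict_mono_less[OF r])
  also have "\<dots> = (\<Sum>i<m. g (r i))"
    using strict_mono_imp_inj_on[OF r] by (intro sum.reindex_cong[of r]) (auto simp: inj_on_def)
  finally show ?thesis .
qed

lemma grunblum_subsequence:
  assumes u: "grunblum K u" and r: "strict_mono r"
  shows "grunblum K (u \<circ> r)"
  unfolding grunblum_def
proof (intro conjI allI impI)
  show "K > 0" using u by (rule grunblum_pos)
  fix a :: "nat \<Rightarrow> real" and m n :: nat assume "m \<le> n"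
  define b where "b i = (if i \<in> range r then a (inv r i) else 0)" for i
  have sum: "(\<Sum>i<r m. b i *\<^sub>R u i) = (\<Sum>k<m. a k *\<^sub>R (u \<circ> r) k)" for m
  proof -
    have "(\<Sum>i<r m. b i *\<^sub>R u i) = (\<Sum>i<r m. if i \<in> range r then a (inv r i) *\<^sub>R u i else 0)"
      by (intro sum.cong refl) (simp add: b_def)
    then show ?thesis
      using strict_mono_imp_inj_on[OF r] by (simp add: sum_over_subsequence[OF r])
  qed
  have "r m \<le> r n" using \<open>m \<le> n\<close> r by (simp add: strict_mono_less_eq)
  then show "norm (\<Sum>k<m. a k *\<^sub>R (u \<circ> r) k) \<le> K * norm (\<Sum>k<n. a k *\<^sub>R (u \<circ> r) k)"
    unfolding sum[symmetric] by (rule grunblumD[OF u])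
qed

section \<open>Recognizing copies of the classical sequence spaces\<close>

lemma contains_isomorphic_subspaceI:
  fixes y :: "nat \<Rightarrow> 'a::banach"
  assumes zero: "(\<lambda>_. 0) \<in> E"
    and add: "\<And>a b. a \<in> E \<Longrightarrow> b \<in> E \<Longrightarrow> (\<lambda>n. a n + b n) \<in> E"
    and scale: "\<And>r a. a \<in> E \<Longrightarrow> (\<lambda>n. r * a n) \<in> E"
    and separates: "\<And>a. a \<in> E \<Longrightarrow> N a \<le> 0 \<Longrightarrow> a = (\<lambda>_. 0)"
    and conv: "\<And>a. a \<in> E \<Longrightarrow> summable (\<lambda>n. a n *\<^sub>R y n)"
    and upper: "\<And>a. a \<in> E \<Longrightarrow> norm (\<Sum>n. a n *\<^sub>R y n) \<le> C * N a"
    and lower: "\<And>a. a \<in> E \<Longrightarrow> N a \<le> D * norm (\<Sum>n. a n *\<^sub>R y n)"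
  shows "contains_isomorphic_subspace TYPE('a) E N"
proof -
  define T where "T a = (\<Sum>n. a n *\<^sub>R y n)" for a
  have T_add: "T (\<lambda>n. a n + b n) = T a + T b" if "a \<in> E" "b \<in> E" for a b
    unfolding T_def by (simp add: scaleR_left_distrib suminf_add conv that)
  have T_scale: "T (\<lambda>n. r * a n) = r *\<^sub>R T a" if "a \<in> E" for r a
    unfolding T_def by (simp add: suminf_scaleR_right[OF conv[OF that]] flip: scaleR_scaleR)
  have "inj_on T E"
  proof (rule inj_onI)
    fix a b assume ab: "a \<in> E" "b \<in> E" "T a = T b"
    have b': "(\<lambda>n. (-1) * b n) \<in> E" by (rule scale[OF ab(2)])
    have d: "(\<lambda>n. a n + (-1) * b n) \<in> E" by (rule add[OF ab(1) b'])
    have "T (\<lambda>n. a n + (-1) * b n) = T a + (-1) *\<^sub>R T b"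
      using T_add[OF ab(1) b'] T_scale[OF ab(2), of "-1"] by simp
    then have "T (\<lambda>n. a n + (-1) * b n) = 0" using ab by simp
    then have "N (\<lambda>n. a n + (-1) * b n) \<le> 0" using lower[OF d] by (simp add: T_def)
    then have "(\<lambda>n. a n + (-1) * b n) = (\<lambda>_. 0)" by (rule separates[OF d])
    then show "a = b" by (auto simp: fun_eq_iff dest: spec)
  qed
  then have "bij_betw T E (T ` E)" by (simp add: bij_betw_def)
  moreover have "subspace (T ` E)"
  proof (rule subspaceI)
    show "0 \<in> T ` E" using zero by (intro image_eqI[of _ _ "\<lambda>_. 0"]) (simp_all add: T_def)
    show "v + w \<in> T ` E" if "v \<in> T ` E" "w \<in> T ` E" for v w
      using that add by (auto simp flip: T_add)
    show "r *\<^sub>R v \<in> T ` E" if "v \<in> T ` E" for r v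
      using that scale by (auto simp flip: T_scale)
  qed
  ultimately show ?thesis
    unfolding contains_isomorphic_subspace_def isomorphism_onto_def
    using T_add T_scale upper lower unfolding T_def[symmetric] by blast
qed

lemma l1_space_add:
  assumes "a \<in> l1_space" "b \<in> l1_space"
  shows "(\<lambda>n. a n + b n) \<in> l1_space"
proof -
  have "summable (\<lambda>n. \<bar>a n\<bar> + \<bar>b n\<bar>)" using assms by (simp add: l1_space_def summable_add)
  then have "summable (\<lambda>n. \<bar>a n + b n\<bar>)" by (rule summable_comparison_test') simp
  then show ?thesis by (simp add: l1_space_def)
qed

lemma l1_space_scale: "a \<in> l1_space \<Longrightarrow> (\<lambda>n. r * a n) \<in> l1_space"
  by (simp add: l1_space_def abs_mult summable_mult)

lemma contains_l1I:
  fixes y :: "nat \<Rightarrow> 'a::banach"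
  assumes bound: "\<And>i. norm (y i) \<le> B" and c: "c > 0"
    and lower: "\<And>a m. c * (\<Sum>i<m. \<bar>a i\<bar>) \<le> norm (\<Sum>i<m. a i *\<^sub>R y i)"
  shows "contains_isomorphic_subspace TYPE('a) l1_space l1_norm"
proof (rule contains_isomorphic_subspaceI[where y = y and C = B and D = "1/c"])
  have le: "norm (a i *\<^sub>R y i) \<le> B * \<bar>a i\<bar>" for a i
    using mult_right_mono[OF bound[of i], of "\<bar>a i\<bar>"] by (simp add: mult.commute)
  show "(\<lambda>_. 0) \<in> l1_space" by (simp add: l1_space_def)
  show "(\<lambda>n. a n + b n) \<in> l1_space" if "a \<in> l1_space" "b \<in> l1_space" for a b
    using that by (rule l1_space_add)
  show "(\<lambda>n. r * a n) \<in> l1_space" if "a \<in> l1_space" for r a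
    using that by (rule l1_space_scale)
  show "a = (\<lambda>_. 0)" if a: "a \<in> l1_space" "l1_norm a \<le> 0" for a
  proof -
    have sm: "summable (\<lambda>n. \<bar>a n\<bar>)" using a(1) by (simp add: l1_space_def)
    have "(\<Sum>n. \<bar>a n\<bar>) = 0"
      using a(2) suminf_nonneg[OF sm] by (simp add: l1_norm_def)
    then have "\<forall>n. \<bar>a n\<bar> = 0" by (subst (asm) suminf_eq_zero_iff[OF sm]) simp_all
    then show ?thesis by auto
  qed
  fix a assume "a \<in> l1_space"
  then have a: "summable (\<lambda>n. \<bar>a n\<bar>)" by (simp add: l1_space_def)
  show conv: "summable (\<lambda>n. a n *\<^sub>R y n)"
    using summable_mult[OF a, of B] by (rule summable_comparison_test'[where N = 0]) (rule le)
  show "norm (\<Sum>n. a n *\<^sub>R y n) \<le> B * l1_norm a"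
    unfolding l1_norm_def suminf_mult[OF a, symmetric]
    by (rule norm_suminf_le) (rule le summable_mult[OF a])+
  have "c * (\<Sum>n. \<bar>a n\<bar>) \<le> norm (\<Sum>n. a n *\<^sub>R y n)"
    using tendsto_mult_left[OF summable_LIMSEQ[OF a], of c] tendsto_norm[OF summable_LIMSEQ[OF conv]]
    by (rule LIMSEQ_le) (use lower in blast)
  then show "l1_norm a \<le> 1 / c * norm (\<Sum>n. a n *\<^sub>R y n)"
    using c by (simp add: l1_norm_def field_simps)
qed

text \<open>A convex function on the cube attains its maximum at a vertex; the vector \<open>v\<close> carries the
  coordinates that the induction has already fixed.\<close>

lemma norm_sum_le_of_signs:
  fixes y :: "nat \<Rightarrow> 'a::real_normed_vector"
  assumes "\<And>\<theta>. (\<And>i. \<theta> i = 1 \<or> \<theta> i = - 1) \<Longrightarrow> norm (v + (\<Sum>i<m. \<theta> i *\<^sub>R y i)) \<le> M"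
    and "\<And>i. i < m \<Longrightarrow> \<bar>a i\<bar> \<le> 1"
  shows "norm (v + (\<Sum>i<m. a i *\<^sub>R y i)) \<le> M"
  using assms
proof (induction m arbitrary: v)
  case 0
  from 0(1)[of "\<lambda>_. 1"] show ?case by simp
next
  case (Suc m)
  define z where "z = v + (\<Sum>i<m. a i *\<^sub>R y i)"
  have "norm (z + s *\<^sub>R y m) \<le> M" if s: "s = 1 \<or> s = - 1" for s
  proof -
    have "norm ((v + s *\<^sub>R y m) + (\<Sum>i<m. a i *\<^sub>R y i)) \<le> M"
    proof (rule Suc.IH)
      fix \<theta> :: "nat \<Rightarrow> real" assume \<theta>: "\<And>i. \<theta> i = 1 \<or> \<theta> i = - 1"
      have "norm (v + (\<Sum>i<Suc m. (\<theta>(m := s)) i *\<^sub>R y i)) \<le> M"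
        using \<theta> s by (intro Suc.prems(1)) auto
      then show "norm ((v + s *\<^sub>R y m) + (\<Sum>i<m. \<theta> i *\<^sub>R y i)) \<le> M"
        by (simp add: add_ac)
    qed (use Suc.prems(2) in auto)
    then show ?thesis by (simp add: z_def add_ac)
  qed
  from this[of 1] this[of "-1"] have pm: "norm (z + y m) \<le> M" "norm (z - y m) \<le> M" by simp_all
  have "\<bar>a m\<bar> \<le> 1" using Suc.prems(2) by simp
  have "z + a m *\<^sub>R y m = ((1 + a m) / 2) *\<^sub>R (z + y m) + ((1 - a m) / 2) *\<^sub>R (z - y m)"
  proof -
    have "b *\<^sub>R (z + y m) + c *\<^sub>R (z - y m) = (b + c) *\<^sub>R z + (b - c) *\<^sub>R y m" for b c
      by (simp add: algebra_simps)
    moreover have "(1 + a m) / 2 + (1 - a m) / 2 = 1" "(1 + a m) / 2 - (1 - a m) / 2 = a m"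
      by (simp_all add: field_simps)
    ultimately show ?thesis by simp
  qed
  also have "norm \<dots> \<le> (1 + a m) / 2 * norm (z + y m) + (1 - a m) / 2 * norm (z - y m)"
  proof -
    have "0 \<le> (1 + a m) / 2" "0 \<le> (1 - a m) / 2" using \<open>\<bar>a m\<bar> \<le> 1\<close> by auto
    then have "norm (((1 + a m) / 2) *\<^sub>R (z + y m)) = (1 + a m) / 2 * norm (z + y m)"
      "norm (((1 - a m) / 2) *\<^sub>R (z - y m)) = (1 - a m) / 2 * norm (z - y m)"
      by (simp_all only: norm_scaleR abs_of_nonneg)
    then show ?thesis by (metis norm_triangle_ineq)
  qed
  also have "\<dots> \<le> (1 + a m) / 2 * M + (1 - a m) / 2 * M"
    using \<open>\<bar>a m\<bar> \<le> 1\<close> pm by (intro add_mono mult_left_mono) auto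
  also have "\<dots> = M" by (simp add: field_simps)
  finally show ?case by (simp add: z_def add_ac)
qed

lemma contains_c0I:
  fixes y :: "nat \<Rightarrow> 'a::banach"
  assumes signs: "\<And>\<theta> m. (\<And>i. \<theta> i = 1 \<or> \<theta> i = - 1) \<Longrightarrow> norm (\<Sum>i<m. \<theta> i *\<^sub>R y i) \<le> M"
    and K: "grunblum K y" and d: "d > 0" and below: "\<And>i. d \<le> norm (y i)"
  shows "contains_isomorphic_subspace TYPE('a) c0_space c0_norm"
proof -
  have unit: "norm (\<Sum>i<m. a i *\<^sub>R y i) \<le> M" if "\<And>i. i < m \<Longrightarrow> \<bar>a i\<bar> \<le> 1" for a m
  proof -
    have "norm (0 + (\<Sum>i<m. a i *\<^sub>R y i)) \<le> M"
      by (rule norm_sum_le_of_signs) (simp_all only: add_0_left signs that)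
    then show ?thesis by simp
  qed
  have sup: "norm (\<Sum>i<m. a i *\<^sub>R y i) \<le> M * b" if "b > 0" "\<And>i. i < m \<Longrightarrow> \<bar>a i\<bar> \<le> b" for a m b
  proof -
    have "(\<Sum>i<m. a i *\<^sub>R y i) = b *\<^sub>R (\<Sum>i<m. (a i / b) *\<^sub>R y i)"
      using that(1) by (simp add: scaleR_sum_right)
    then have "norm (\<Sum>i<m. a i *\<^sub>R y i) = b * norm (\<Sum>i<m. (a i / b) *\<^sub>R y i)"
      using that(1) by simp
    also have "\<dots> \<le> b * M"
      using that by (intro mult_left_mono unit) (auto simp: field_simps)
    finally show ?thesis by (simp add: mult.commute)
  qed
  have "norm (\<Sum>i<0. (0::real) *\<^sub>R y i) \<le> M" by (rule unit) simp
  then have M0: "M \<ge> 0" by simp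
  have bdd: "bdd_above (range (\<lambda>n. \<bar>a n\<bar>))" if "a \<in> c0_space" for a
  proof -
    have "a \<longlonglongrightarrow> 0" using that by (simp add: c0_space_def)
    then obtain B where "\<And>n. norm (a n) \<le> B"
      by (meson BseqE convergentI convergent_imp_Bseq)
    then show ?thesis by (intro bdd_aboveI2[of _ _ B]) simp
  qed
  have le_norm: "\<bar>a n\<bar> \<le> c0_norm a" if "a \<in> c0_space" for a n
    unfolding c0_norm_def using bdd[OF that] by (rule cSUP_upper2[of _ _ n]) auto
  show ?thesis
  proof (rule contains_isomorphic_subspaceI[where y = y and C = M and D = "2 * K / d"])
    show "(\<lambda>_. 0) \<in> c0_space" by (simp add: c0_space_def)
    show "(\<lambda>n. a n + b n) \<in> c0_space" if "a \<in> c0_space" "b \<in> c0_space" for a b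
      using that tendsto_add[of a 0 sequentially b 0] by (simp add: c0_space_def)
    show "(\<lambda>n. r * a n) \<in> c0_space" if "a \<in> c0_space" for r a
      using that tendsto_mult_right_zero[of a sequentially r] by (simp add: c0_space_def)
    show "a = (\<lambda>_. 0)" if a: "a \<in> c0_space" "c0_norm a \<le> 0" for a
    proof
      show "a n = 0" for n using le_norm[OF a(1), of n] a(2) by simp
    qed
    fix a assume a: "a \<in> c0_space"
    show conv: "summable (\<lambda>n. a n *\<^sub>R y n)"
      unfolding summable_Cauchy
    proof (intro allI impI)
      fix e :: real assume "e > 0"
      define b where "b = e / (M + 1)"
      have b: "b > 0" using \<open>e > 0\<close> M0 by (simp add: b_def)
      have "a \<longlonglongrightarrow> 0" using a by (simp add: c0_space_def)
      then obtain N where "\<And>n. n \<ge> N \<Longrightarrow> norm (a n - 0) < b"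
        using LIMSEQ_D[OF _ b] by blast
      then have N: "\<bar>a n\<bar> \<le> b" if "n \<ge> N" for n using that by (simp add: less_imp_le)
      have "norm (\<Sum>i\<in>{m..<n}. a i *\<^sub>R y i) < e" if "m \<ge> N" for m n
      proof -
        have "(\<Sum>i\<in>{m..<n}. a i *\<^sub>R y i) = (\<Sum>i<n. (if m \<le> i then a i else 0) *\<^sub>R y i)"
          by (intro sum.mono_neutral_cong_left) auto
        also have "norm \<dots> \<le> M * b"
        proof (rule sup[OF b])
          show "\<bar>if m \<le> i then a i else 0\<bar> \<le> b" for i
            using N[of i] that b by (cases "m \<le> i") auto
        qed
        also have "\<dots> < e" using M0 \<open>e > 0\<close> by (simp add: b_def field_simps)
        finally show ?thesis .
      qed
      then show "\<exists>N. \<forall>m\<ge>N. \<forall>n. norm (\<Sum>i\<in>{m..<n}. a i *\<^sub>R y i) < e" by blast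
    qed
    have "norm (\<Sum>i<m. a i *\<^sub>R y i) \<le> M * c0_norm a" for m
    proof (cases "c0_norm a > 0")
      case False
      then have "a i = 0" for i using le_norm[OF a, of i] by simp
      moreover have "c0_norm a \<ge> 0" using le_norm[OF a, of 0] by simp
      ultimately show ?thesis using M0 by simp
    next
      case True
      then show ?thesis by (rule sup) (rule le_norm[OF a])
    qed
    then show "norm (\<Sum>n. a n *\<^sub>R y n) \<le> M * c0_norm a"
      by (intro LIMSEQ_le_const2[OF tendsto_norm[OF summable_LIMSEQ[OF conv]]]) blast
    have coord: "\<bar>a i\<bar> \<le> 2 * K / d * norm (\<Sum>n. a n *\<^sub>R y n)" for i
    proof -
      have "d * \<bar>a i\<bar> \<le> 2 * K * norm (\<Sum>k<n. a k *\<^sub>R y k)" if "i < n" for n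
        using grunblum_coordinate[OF K that, of a] mult_right_mono[OF below[of i], of "\<bar>a i\<bar>"]
        by (simp add: mult.commute)
      then have "d * \<bar>a i\<bar> \<le> 2 * K * norm (\<Sum>n. a n *\<^sub>R y n)"
        by (intro LIMSEQ_le_const[OF tendsto_mult_left[OF tendsto_norm[OF summable_LIMSEQ[OF conv]]]])
           (auto intro!: exI[of _ "Suc i"])
      then show ?thesis using d by (simp add: field_simps)
    qed
    show "c0_norm a \<le> 2 * K / d * norm (\<Sum>n. a n *\<^sub>R y n)"
      unfolding c0_norm_def by (rule cSUP_least[OF UNIV_not_empty coord])
  qed
qed

section \<open>Random signs\<close>

lemma space_sign_measure: "\<omega> \<in> space sign_measure \<longleftrightarrow> (\<forall>n. \<omega> n = 1 \<or> \<omega> n = - 1)"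
  by (auto simp: sign_measure_def space_PiM space_uniform_count_measure PiE_iff)

lemma abs_sign: "\<omega> \<in> space sign_measure \<Longrightarrow> \<bar>\<omega> n\<bar> = 1"
  by (auto simp: space_sign_measure dest!: spec[of _ n])

lemma product_prob_space_signs: "product_prob_space (\<lambda>_::nat. uniform_count_measure {-1, 1::real})"
proof -
  interpret prob_space "uniform_count_measure {-1, 1::real}"
    by (rule prob_space_uniform_count_measure) auto
  show ?thesis by unfold_locales
qed

interpretation sign_measure: prob_space sign_measure
proof -
  interpret P: product_prob_space "\<lambda>_::nat. uniform_count_measure {-1, 1::real}" UNIV
    by (rule product_prob_space_signs)
  show "prob_space sign_measure"
    unfolding sign_measure_def by (rule P.prob_space_axioms)
qed

lemma measurable_sign_coordinate [measurable]: "(\<lambda>\<omega>. \<omega> n) \<in> borel_measurable sign_measure"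
proof -
  have "(\<lambda>\<omega>. \<omega> n) \<in> measurable sign_measure (uniform_count_measure {-1, 1::real})"
    unfolding sign_measure_def by (rule measurable_component_singleton) simp
  moreover have "id \<in> borel_measurable (uniform_count_measure {-1, 1::real})"
    by (simp add: measurable_def space_uniform_count_measure sets_uniform_count_measure)
  ultimately show ?thesis by (metis id_comp comp_id measurable_comp comp_apply id_apply measurable_cong)
qed

lemma measurable_sign_continuous:
  fixes g :: "(nat \<Rightarrow> real) \<Rightarrow> 'b::topological_space"
  assumes "continuous_on UNIV g"
  shows "g \<in> borel_measurable sign_measure"
proof -
  have "(\<lambda>\<omega>. \<omega>) \<in> borel_measurable sign_measure"
    by (rule measurable_coordinatewise_then_product) measurable
  then show ?thesis
    using measurable_compose[OF _ borel_measurable_continuous_onI[OF assms]] by blast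
qed

text \<open>Flipping a fixed set of coordinates preserves the measure. This replaces explicit independence
  arguments: it yields the orthogonality of the coordinates and Kwapien's symmetrization.\<close>

lemma distr_sign_flip:
  assumes \<eta>: "\<And>n::nat. \<eta> n = 1 \<or> \<eta> n = (- 1::real)"
  shows "(\<lambda>\<omega> n. \<eta> n * \<omega> n) \<in> measurable sign_measure sign_measure"
    and "distr sign_measure sign_measure (\<lambda>\<omega> n. \<eta> n * \<omega> n) = sign_measure"
proof -
  let ?U = "uniform_count_measure {-1, 1::real}"
  interpret P: product_prob_space "\<lambda>_::nat. ?U" UNIV
    by (rule product_prob_space_signs)
  have coord: "(\<lambda>\<omega>. \<omega> n) \<in> measurable sign_measure ?U" for n
    unfolding sign_measure_def by (rule measurable_component_singleton) simp
  have flip: "(\<lambda>t. \<eta> n * t) \<in> measurable ?U ?U" for n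
    using \<eta>[of n] by (auto simp: measurable_def space_uniform_count_measure sets_uniform_count_measure)
  show meas: "(\<lambda>\<omega> n. \<eta> n * \<omega> n) \<in> measurable sign_measure sign_measure"
  proof -
    have "\<eta> n * \<omega> n = - 1 \<or> \<eta> n * \<omega> n = 1" if "\<omega> \<in> space sign_measure" for \<omega> n
      using that \<eta>[of n] by (auto simp: space_sign_measure dest!: spec[of _ n])
    then have "(\<lambda>\<omega> n. \<eta> n * \<omega> n) \<in> measurable sign_measure (PiM UNIV (\<lambda>_. ?U))"
      using measurable_compose[OF coord flip]
      by (intro measurable_PiM_single') (auto simp: space_uniform_count_measure PiE_iff)
    then show ?thesis by (simp add: sign_measure_def)
  qed
  have "distr sign_measure sign_measure (\<lambda>\<omega> n. \<eta> n * \<omega> n) = PiM UNIV (\<lambda>_. ?U)"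
  proof (rule P.PiM_eq)
    show "sets (distr sign_measure sign_measure (\<lambda>\<omega> n. \<eta> n * \<omega> n)) = sets (PiM UNIV (\<lambda>_. ?U))"
      by (simp add: sign_measure_def)
    fix J and F :: "nat \<Rightarrow> real set"
    assume J: "finite J" "J \<subseteq> UNIV" and F: "\<And>j. j \<in> J \<Longrightarrow> F j \<in> sets ?U"
    define F' where "F' j = (\<lambda>t. \<eta> j * t) ` F j" for j
    have F'_sets: "F' j \<in> sets ?U" and F'_meas: "emeasure ?U (F' j) = emeasure ?U (F j)" if "j \<in> J" for j
    proof -
      have sub: "F j \<subseteq> {-1, 1}" using F[OF that] by (simp add: sets_uniform_count_measure)
      then have sub': "F' j \<subseteq> {-1, 1}" using \<eta>[of j] by (auto simp: F'_def)
      then show "F' j \<in> sets ?U" by (simp add: sets_uniform_count_measure)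
      have "\<eta> j \<noteq> 0" using \<eta>[of j] by auto
      then have "card (F' j) = card (F j)"
        unfolding F'_def by (intro card_image) (auto simp: inj_on_def)
      then show "emeasure ?U (F' j) = emeasure ?U (F j)"
        using sub sub' by (simp add: emeasure_uniform_count_measure)
    qed
    have emb: "prod_emb UNIV (\<lambda>_. ?U) J (Pi\<^sub>E J F) \<in> sets sign_measure"
      unfolding sign_measure_def using J F by (intro sets_PiM_I) auto
    have "(\<lambda>\<omega> n. \<eta> n * \<omega> n) -` prod_emb UNIV (\<lambda>_. ?U) J (Pi\<^sub>E J F) \<inter> space sign_measure
        = prod_emb UNIV (\<lambda>_. ?U) J (Pi\<^sub>E J F')"
    proof (intro set_eqI)
      fix \<omega>
      have sq: "\<eta> n * (\<eta> n * t) = t" for n t using \<eta>[of n] by auto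
      have iff: "\<eta> n * \<omega> n \<in> F n \<longleftrightarrow> \<omega> n \<in> F' n" for n
        unfolding F'_def by (metis (no_types, lifting) image_iff sq)
      show "\<omega> \<in> (\<lambda>\<omega> n. \<eta> n * \<omega> n) -` prod_emb UNIV (\<lambda>_. ?U) J (Pi\<^sub>E J F) \<inter> space sign_measure
        \<longleftrightarrow> \<omega> \<in> prod_emb UNIV (\<lambda>_. ?U) J (Pi\<^sub>E J F')"
        using measurable_space[OF meas, of \<omega>]
        by (auto simp: prod_emb_def PiE_iff sign_measure_def space_PiM space_uniform_count_measure iff)
    qed
    then have "emeasure (distr sign_measure sign_measure (\<lambda>\<omega> n. \<eta> n * \<omega> n)) (prod_emb UNIV (\<lambda>_. ?U) J (Pi\<^sub>E J F))
        = emeasure (PiM UNIV (\<lambda>_. ?U)) (prod_emb UNIV (\<lambda>_. ?U) J (Pi\<^sub>E J F'))"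
      using emeasure_distr[OF meas emb] by (simp add: sign_measure_def)
    also have "\<dots> = (\<Prod>j\<in>J. emeasure ?U (F' j))"
      using J F'_sets by (intro P.emeasure_PiM_emb) auto
    also have "\<dots> = (\<Prod>j\<in>J. emeasure ?U (F j))"
      by (intro prod.cong refl F'_meas)
    finally show "emeasure (distr sign_measure sign_measure (\<lambda>\<omega> n. \<eta> n * \<omega> n))
        (prod_emb UNIV (\<lambda>_. ?U) J (Pi\<^sub>E J F)) = (\<Prod>j\<in>J. emeasure ?U (F j))" .
  qed
  then show "distr sign_measure sign_measure (\<lambda>\<omega> n. \<eta> n * \<omega> n) = sign_measure"
    by (simp add: sign_measure_def)
qed

lemma integrable_sign_bounded:
  fixes g :: "(nat \<Rightarrow> real) \<Rightarrow> real"
  assumes "g \<in> borel_measurable sign_measure"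
    and "\<And>\<omega>. \<omega> \<in> space sign_measure \<Longrightarrow> \<bar>g \<omega>\<bar> \<le> B"
  shows "integrable sign_measure g"
  using assms by (intro sign_measure.integrable_const_bound[of _ B] AE_I2) auto

lemma integral_sign_product:
  "(\<integral>\<omega>. \<omega> s * \<omega> t \<partial>sign_measure) = (if s = t then 1 else 0)"
proof (cases "s = t")
  case True
  have "(\<integral>\<omega>. \<omega> s * \<omega> t \<partial>sign_measure) = (\<integral>\<omega>. 1 \<partial>sign_measure)"
    using True by (intro Bochner_Integration.integral_cong) (auto simp: space_sign_measure dest: spec[of _ t])
  then show ?thesis using True by (simp add: sign_measure.prob_space)
next
  case False
  define \<eta> where "\<eta> n = (if n = s then - 1 else 1 :: real)" for n
  have \<eta>: "\<eta> n = 1 \<or> \<eta> n = - 1" for n by (simp add: \<eta>_def)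
  have "(\<integral>\<omega>. \<omega> s * \<omega> t \<partial>sign_measure)
      = (\<integral>\<omega>. \<omega> s * \<omega> t \<partial>distr sign_measure sign_measure (\<lambda>\<omega> n. \<eta> n * \<omega> n))"
    by (simp only: distr_sign_flip(2)[OF \<eta>])
  also have "\<dots> = (\<integral>\<omega>. (\<eta> s * \<omega> s) * (\<eta> t * \<omega> t) \<partial>sign_measure)"
    by (intro integral_distr distr_sign_flip(1) \<eta>) measurable
  also have "\<dots> = - (\<integral>\<omega>. \<omega> s * \<omega> t \<partial>sign_measure)"
    using False by (simp add: \<eta>_def)
  finally show ?thesis using False by simp
qed

text \<open>The easy half of Khinchin's inequality: the first moment is at most the second, and the
  coordinates are orthonormal.\<close>

lemma integral_abs_sign_sum_le:
  "(\<integral>\<omega>. \<bar>\<Sum>k<n. b k * \<omega> k\<bar> \<partial>sign_measure) \<le> sqrt (\<Sum>k<n. (b k)\<^sup>2)"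
proof -
  define X where "X \<omega> = \<bar>\<Sum>k<n. b k * \<omega> k\<bar>" for \<omega> :: "nat \<Rightarrow> real"
  have meas: "X \<in> borel_measurable sign_measure" unfolding X_def by measurable
  have bound: "\<bar>X \<omega>\<bar> \<le> (\<Sum>k<n. \<bar>b k\<bar>)" if "\<omega> \<in> space sign_measure" for \<omega>
  proof -
    have one: "\<bar>\<omega> k\<bar> = 1" for k using that by (rule abs_sign)
    have "X \<omega> \<le> (\<Sum>k<n. \<bar>b k * \<omega> k\<bar>)" by (simp add: X_def sum_abs)
    then show ?thesis by (simp add: abs_mult one) (simp add: X_def)
  qed
  have X2_eq: "(X \<omega>)\<^sup>2 = (\<Sum>k<n. \<Sum>j<n. (b k * b j) * (\<omega> k * \<omega> j))" for \<omega>
    by (simp add: X_def power2_eq_square sum_product mult_ac)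
  have int1: "integrable sign_measure X" by (rule integrable_sign_bounded[OF meas bound])
  have int_prod: "integrable sign_measure (\<lambda>\<omega>. \<omega> k * \<omega> j)" for k j
    by (rule integrable_sign_bounded[where B = 1])
       (simp_all add: abs_mult abs_sign)
  have int2: "integrable sign_measure (\<lambda>\<omega>. (X \<omega>)\<^sup>2)"
    unfolding X2_eq by (intro Bochner_Integration.integrable_sum integrable_mult_right int_prod)
  have "(\<integral>\<omega>. (X \<omega>)\<^sup>2 \<partial>sign_measure) = (\<Sum>k<n. \<Sum>j<n. (b k * b j) * (\<integral>\<omega>. \<omega> k * \<omega> j \<partial>sign_measure))"
    unfolding X2_eq
    by (simp only: Bochner_Integration.integral_sum Bochner_Integration.integrable_sum
        integrable_mult_right int_prod integral_mult_right_zero)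
  also have "\<dots> = (\<Sum>k<n. \<Sum>j<n. if k = j then b k * b j else 0)"
    by (intro sum.cong refl) (simp add: integral_sign_product)
  also have "\<dots> = (\<Sum>k<n. (b k)\<^sup>2)"
    by (intro sum.cong refl) (simp add: power2_eq_square)
  finally have second: "(\<integral>\<omega>. (X \<omega>)\<^sup>2 \<partial>sign_measure) = (\<Sum>k<n. (b k)\<^sup>2)" .
  have "(\<integral>\<omega>. X \<omega> \<partial>sign_measure)\<^sup>2 \<le> (\<Sum>k<n. (b k)\<^sup>2)"
    using sign_measure.variance_eq[OF int1 int2] sign_measure.variance_positive[of X]
    by (simp add: second)
  then show ?thesis unfolding X_def by (rule real_le_rsqrt)
qed

section \<open>Bessel's inequality for functionals of the signs\<close>

text \<open>The choice \<open>b = c\<close> bounds the square sums of \<open>c\<close>.\<close>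

lemma square_summable_duality:
  fixes c :: "nat \<Rightarrow> real"
  assumes "\<And>b n. \<bar>\<Sum>k<n. b k * c k\<bar> \<le> C * sqrt (\<Sum>k<n. (b k)\<^sup>2)"
  shows "c \<longlonglongrightarrow> 0"
proof -
  have le: "(\<Sum>k<n. (c k)\<^sup>2) \<le> C\<^sup>2" for n
  proof -
    define s where "s = sqrt (\<Sum>k<n. (c k)\<^sup>2)"
    have s2: "s * s = (\<Sum>k<n. (c k)\<^sup>2)" and s0: "s \<ge> 0"
      by (simp_all add: s_def sum_nonneg)
    have "s * s \<le> C * s"
      using assms[of c n] unfolding s2 by (simp add: power2_eq_square s_def)
    show ?thesis
    proof (cases "s = 0")
      case False
      then have "s \<le> C" using \<open>s * s \<le> C * s\<close> s0 by simp
      then have "s * s \<le> C * C" using s0 by (intro mult_mono) auto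
      then show ?thesis by (simp add: s2 power2_eq_square)
    qed (use s2 in simp)
  qed
  have "summable (\<lambda>k. (c k)\<^sup>2)"
    by (rule summableI_nonneg_bounded[OF _ le]) simp
  then have "(\<lambda>k. (c k)\<^sup>2) \<longlonglongrightarrow> 0" by (rule summable_LIMSEQ_zero)
  then have "(\<lambda>k. sqrt ((c k)\<^sup>2)) \<longlonglongrightarrow> sqrt 0" by (rule tendsto_real_sqrt)
  then have "(\<lambda>k. \<bar>c k\<bar>) \<longlonglongrightarrow> 0" by simp
  then show ?thesis by (rule tendsto_rabs_zero_cancel)
qed

text \<open>On signs this is the identity; it turns the coordinates into bounded continuous functions on all
  of \<open>\<real>\<^sup>\<nat>\<close>, which form a vector space on which functionals can be constructed.\<close>

definition clip :: "real \<Rightarrow> real" where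
  "clip t = max (- 1) (min 1 t)"

lemma abs_clip_le: "\<bar>clip t\<bar> \<le> 1"
  and clip_sign: "t = 1 \<or> t = - 1 \<Longrightarrow> clip t = t"
  by (auto simp: clip_def)

definition test_function :: "((nat \<Rightarrow> real) \<Rightarrow> real) \<Rightarrow> bool" where
  "test_function \<phi> \<longleftrightarrow> continuous_on UNIV \<phi> \<and> (\<exists>B. \<forall>\<omega>. \<bar>\<phi> \<omega>\<bar> \<le> B)"

lemma test_function_add: "test_function \<phi> \<Longrightarrow> test_function \<psi> \<Longrightarrow> test_function (\<lambda>\<omega>. \<phi> \<omega> + \<psi> \<omega>)"
  unfolding test_function_def by (auto intro!: continuous_intros) (meson abs_triangle_ineq add_mono order_trans)

lemma test_function_mult:
  assumes "test_function \<phi>" "test_function \<psi>"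
  shows "test_function (\<lambda>\<omega>. \<phi> \<omega> * \<psi> \<omega>)"
proof -
  obtain A B where "\<And>\<omega>. \<bar>\<phi> \<omega>\<bar> \<le> A" "\<And>\<omega>. \<bar>\<psi> \<omega>\<bar> \<le> B"
    using assms unfolding test_function_def by blast
  then have "\<bar>\<phi> \<omega> * \<psi> \<omega>\<bar> \<le> A * B" for \<omega>
    unfolding abs_mult by (meson abs_ge_zero mult_mono order_trans)
  then show ?thesis
    using assms unfolding test_function_def by (auto intro!: continuous_intros)
qed

lemma test_function_const: "test_function (\<lambda>_. c)"
  unfolding test_function_def by auto

lemma test_function_scale: "test_function \<phi> \<Longrightarrow> test_function (\<lambda>\<omega>. c * \<phi> \<omega>)"
  by (rule test_function_mult[OF test_function_const])

lemma test_function_clip: "test_function (\<lambda>\<omega>. clip (\<omega> k))"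
  unfolding test_function_def
proof
  show "continuous_on UNIV (\<lambda>\<omega>. clip (\<omega> k))"
    unfolding clip_def by (intro continuous_intros continuous_on_product_coordinates)
qed (use abs_clip_le in blast)

lemma test_function_sum:
  "(\<And>i. i \<in> A \<Longrightarrow> test_function (\<phi> i)) \<Longrightarrow> test_function (\<lambda>\<omega>. \<Sum>i\<in>A. \<phi> i \<omega>)"
  by (induction A rule: infinite_finite_induct) (auto intro: test_function_const test_function_add)

lemma test_function_measurable: "test_function \<phi> \<Longrightarrow> \<phi> \<in> borel_measurable sign_measure"
  by (simp add: test_function_def measurable_sign_continuous)

lemma test_function_integrable:
  assumes "test_function \<phi>"
  shows "integrable sign_measure \<phi>"
proof -
  obtain B where "\<And>\<omega>. \<bar>\<phi> \<omega>\<bar> \<le> B" using assms unfolding test_function_def by blast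
  then show ?thesis using test_function_measurable[OF assms] by (rule integrable_sign_bounded[rotated])
qed

text \<open>Elements of \<open>L\<^sub>\<infinity>\<close> of the sign measure in disguise: linear functionals on test functions that are
  bounded by a multiple of the first absolute moment.\<close>

definition test_functional :: "real \<Rightarrow> (((nat \<Rightarrow> real) \<Rightarrow> real) \<Rightarrow> real) \<Rightarrow> bool" where
  "test_functional C \<Lambda> \<longleftrightarrow>
     (\<forall>\<phi> \<psi>. test_function \<phi> \<longrightarrow> test_function \<psi> \<longrightarrow> \<Lambda> (\<lambda>\<omega>. \<phi> \<omega> + \<psi> \<omega>) = \<Lambda> \<phi> + \<Lambda> \<psi>) \<and>
     (\<forall>c \<phi>. test_function \<phi> \<longrightarrow> \<Lambda> (\<lambda>\<omega>. c * \<phi> \<omega>) = c * \<Lambda> \<phi>) \<and>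
     (\<forall>\<phi>. test_function \<phi> \<longrightarrow> \<bar>\<Lambda> \<phi>\<bar> \<le> C * (\<integral>\<omega>. \<bar>\<phi> \<omega>\<bar> \<partial>sign_measure))"

lemma test_functionalD:
  assumes "test_functional C \<Lambda>"
  shows test_functional_add: "test_function \<phi> \<Longrightarrow> test_function \<psi> \<Longrightarrow> \<Lambda> (\<lambda>\<omega>. \<phi> \<omega> + \<psi> \<omega>) = \<Lambda> \<phi> + \<Lambda> \<psi>"
    and test_functional_scale: "test_function \<phi> \<Longrightarrow> \<Lambda> (\<lambda>\<omega>. c * \<phi> \<omega>) = c * \<Lambda> \<phi>"
    and test_functional_bound: "test_function \<phi> \<Longrightarrow> \<bar>\<Lambda> \<phi>\<bar> \<le> C * (\<integral>\<omega>. \<bar>\<phi> \<omega>\<bar> \<partial>sign_measure)"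
  using assms by (simp_all add: test_functional_def)

lemma test_functional_sum:
  assumes \<Lambda>: "test_functional C \<Lambda>" and "\<And>k. test_function (\<phi> k)"
  shows "\<Lambda> (\<lambda>\<omega>. \<Sum>k<n. b k * \<phi> k \<omega>) = (\<Sum>k<n::nat. b k * \<Lambda> (\<phi> k))"
proof (induction n)
  case 0
  show ?case using test_functional_scale[OF \<Lambda> test_function_const, of 0 0] by simp
next
  case (Suc n)
  then show ?case
    using assms(2) by (simp add: test_functional_add[OF \<Lambda>] test_functional_scale[OF \<Lambda>]
        test_function_sum test_function_scale)
qed

text \<open>Against \<open>\<psi>\<close>, the sums \<open>\<Sum> b\<^sub>k \<epsilon>\<^sub>k\<close> are bounded in mean by the \<open>\<ell>\<^sub>2\<close> norm of \<open>b\<close>, so the values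
  form a square summable sequence.\<close>

lemma test_functional_bessel:
  assumes \<Lambda>: "test_functional C \<Lambda>" and C: "C \<ge> 0" and \<psi>: "test_function \<psi>"
  shows "(\<lambda>k. \<Lambda> (\<lambda>\<omega>. \<psi> \<omega> * clip (\<omega> k))) \<longlonglongrightarrow> 0"
proof -
  obtain B where B: "\<And>\<omega>. \<bar>\<psi> \<omega>\<bar> \<le> B" using \<psi> unfolding test_function_def by blast
  then have B0: "B \<ge> 0" by (meson abs_ge_zero order_trans)
  have test: "test_function (\<lambda>\<omega>. \<psi> \<omega> * clip (\<omega> k))" for k
    by (intro test_function_mult \<psi> test_function_clip)
  show ?thesis
  proof (rule square_summable_duality[where C = "C * B"])
    fix b :: "nat \<Rightarrow> real" and n
    let ?S = "\<lambda>\<omega>. \<Sum>k<n. b k * (\<psi> \<omega> * clip (\<omega> k))"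
    have test_S: "test_function ?S"
      by (intro test_function_sum test_function_scale test)
    have "\<bar>\<Sum>k<n. b k * \<Lambda> (\<lambda>\<omega>. \<psi> \<omega> * clip (\<omega> k))\<bar> = \<bar>\<Lambda> ?S\<bar>"
      by (simp only: test_functional_sum[OF \<Lambda> test])
    also have "\<dots> \<le> C * (\<integral>\<omega>. \<bar>?S \<omega>\<bar> \<partial>sign_measure)"
      by (rule test_functional_bound[OF \<Lambda> test_S])
    also have "\<dots> \<le> C * (B * sqrt (\<Sum>k<n. (b k)\<^sup>2))"
    proof (intro mult_left_mono C)
      have "(\<integral>\<omega>. \<bar>?S \<omega>\<bar> \<partial>sign_measure) \<le> (\<integral>\<omega>. B * \<bar>\<Sum>k<n. b k * \<omega> k\<bar> \<partial>sign_measure)"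
      proof (intro integral_mono)
        show "integrable sign_measure (\<lambda>\<omega>. \<bar>?S \<omega>\<bar>)"
          by (intro integrable_abs test_function_integrable test_S)
        have "integrable sign_measure (\<lambda>\<omega>. \<omega> k)" for k
          by (rule integrable_sign_bounded[where B = 1])
             (simp_all add: abs_sign)
        then show "integrable sign_measure (\<lambda>\<omega>. B * \<bar>\<Sum>k<n. b k * \<omega> k\<bar>)"
          by (intro integrable_mult_right integrable_abs Bochner_Integration.integrable_sum)
        fix \<omega> assume "\<omega> \<in> space sign_measure"
        then have "clip (\<omega> k) = \<omega> k" for k by (intro clip_sign) (simp add: space_sign_measure)
        then have "?S \<omega> = \<psi> \<omega> * (\<Sum>k<n. b k * \<omega> k)"
          by (simp add: sum_distrib_left mult_ac)
        then show "\<bar>?S \<omega>\<bar> \<le> B * \<bar>\<Sum>k<n. b k * \<omega> k\<bar>"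
          using B by (simp add: abs_mult mult_right_mono)
      qed
      also have "\<dots> = B * (\<integral>\<omega>. \<bar>\<Sum>k<n. b k * \<omega> k\<bar> \<partial>sign_measure)" by simp
      also have "\<dots> \<le> B * sqrt (\<Sum>k<n. (b k)\<^sup>2)"
        by (intro mult_left_mono integral_abs_sign_sum_le B0)
      finally show "(\<integral>\<omega>. \<bar>?S \<omega>\<bar> \<partial>sign_measure) \<le> B * sqrt (\<Sum>k<n. (b k)\<^sup>2)" .
    qed
    finally show "\<bar>\<Sum>k<n. b k * \<Lambda> (\<lambda>\<omega>. \<psi> \<omega> * clip (\<omega> k))\<bar> \<le> C * B * sqrt (\<Sum>k<n. (b k)\<^sup>2)"
      by (simp add: mult.assoc)
  qed
qed

section \<open>Selecting a subsequence for all sign patterns\<close>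

text \<open>A property of finite patterns of signed indices that persists when a far index is added with
  either sign can be secured for all patterns along one subsequence: there are only finitely many
  patterns on the indices chosen so far, so a common next index exists. The filter \<open>F\<close> lets the
  next index be chosen along limits fixed in advance. Patterns list the
  latest index first.\<close>

lemma sign_tree:
  fixes Good :: "(nat \<times> real) list \<Rightarrow> bool"
  assumes nil: "Good []" and F: "F \<noteq> bot" "F \<le> sequentially"
    and step: "\<And>xs s. Good xs \<Longrightarrow> s = 1 \<or> s = - 1 \<Longrightarrow> eventually (\<lambda>k. Good ((k, s) # xs)) F"
  obtains r :: "nat \<Rightarrow> nat" where "strict_mono r"
    "\<And>\<theta> m. (\<And>i. \<theta> i = 1 \<or> \<theta> i = - 1) \<Longrightarrow> Good (rev (map (\<lambda>i. (r i, \<theta> i)) [0..<m]))"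
proof -
  define S where "S n = {ss::real list. set ss \<subseteq> {1, - 1} \<and> length ss = n}" for n
  define inv where "inv n ks \<longleftrightarrow> length ks = n \<and> (\<forall>ss\<in>S n. Good (zip ks ss))" for n and ks :: "nat list"
  have "\<exists>K. \<forall>n. inv n (K n) \<and> (\<exists>k. K (Suc n) = k # K n \<and> (\<forall>j\<in>set (K n). j < k))"
  proof (rule dependent_nat_choice)
    show "\<exists>ks. inv 0 ks" using nil by (auto simp: inv_def S_def)
    fix ks n assume ks: "inv n ks"
    have "eventually (\<lambda>k. \<forall>ss\<in>S n. \<forall>s\<in>{1, - 1}. Good ((k, s) # zip ks ss)) F"
      using ks step by (intro eventually_ball_finite ballI)
        (auto simp: inv_def S_def intro!: finite_lists_length_eq)
    moreover have "eventually (\<lambda>k. \<forall>j\<in>set ks. j < k) F"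
      by (intro eventually_ball_finite ballI filter_leD[OF F(2)] eventually_gt_at_top) simp
    ultimately have "eventually (\<lambda>k. (\<forall>ss\<in>S n. \<forall>s\<in>{1, - 1}. Good ((k, s) # zip ks ss)) \<and> (\<forall>j\<in>set ks. j < k)) F"
      by (rule eventually_conj)
    then obtain k where k: "\<And>ss s. ss \<in> S n \<Longrightarrow> s \<in> {1, - 1} \<Longrightarrow> Good ((k, s) # zip ks ss)" "\<forall>j\<in>set ks. j < k"
      using eventually_happens'[OF F(1)] by blast
    have "inv (Suc n) (k # ks)"
      unfolding inv_def
    proof (intro conjI ballI)
      show "length (k # ks) = Suc n" using ks by (simp add: inv_def)
      fix ss assume "ss \<in> S (Suc n)"
      then obtain s ss' where "ss = s # ss'" "ss' \<in> S n" "s \<in> {1, - 1}"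
        by (cases ss) (auto simp: S_def)
      then show "Good (zip (k # ks) ss)" using k(1) by simp
    qed
    then show "\<exists>ks'. inv (Suc n) ks' \<and> (\<exists>k. ks' = k # ks \<and> (\<forall>j\<in>set ks. j < k))"
      using k(2) by blast
  qed
  then obtain K where K: "\<And>n. inv n (K n)" "\<And>n. \<exists>k. K (Suc n) = k # K n \<and> (\<forall>j\<in>set (K n). j < k)"
    by blast
  define r where "r n = hd (K (Suc n))" for n
  have K_Suc: "K (Suc n) = r n # K n" and r_gt: "\<forall>j\<in>set (K n). j < r n" for n
    using K(2)[of n] by (auto simp: r_def)
  have K_eq: "K m = rev (map r [0..<m])" for m
  proof (induction m)
    case 0 show ?case using K(1)[of 0] by (simp add: inv_def)
  qed (simp add: K_Suc)
  have "strict_mono r"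
    unfolding strict_mono_Suc_iff using r_gt K_Suc by (metis list.set_intros(1))
  moreover have "Good (rev (map (\<lambda>i. (r i, \<theta> i)) [0..<m]))" if \<theta>: "\<And>i. \<theta> i = 1 \<or> \<theta> i = - 1" for \<theta> m
  proof -
    have "rev (map \<theta> [0..<m]) \<in> S m" using \<theta> by (auto simp: S_def)
    then have "Good (zip (K m) (rev (map \<theta> [0..<m])))" using K(1)[of m] by (simp add: inv_def)
    also have "zip (K m) (rev (map \<theta> [0..<m])) = rev (map (\<lambda>i. (r i, \<theta> i)) [0..<m])"
      unfolding K_eq by (simp add: zip_rev zip_map_map zip_same_conv_map)
    finally show ?thesis .
  qed
  ultimately show ?thesis using that by blast
qed

section \<open>Kwapien's theorem: bounded random sums span copies of c0\<close>

lemma test_functional_restriction: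
  assumes B: "B \<in> sets sign_measure"
  shows "test_functional 1 (\<lambda>\<phi>. \<integral>\<omega>. indicator B \<omega> * \<phi> \<omega> \<partial>sign_measure)"
proof -
  have int: "integrable sign_measure (\<lambda>\<omega>. indicator B \<omega> * \<phi> \<omega>)" if "test_function \<phi>" for \<phi>
    using integrable_mult_indicator[OF B test_function_integrable[OF that]] by simp
  have bound: "\<bar>\<integral>\<omega>. indicator B \<omega> * \<phi> \<omega> \<partial>sign_measure\<bar> \<le> (\<integral>\<omega>. \<bar>\<phi> \<omega>\<bar> \<partial>sign_measure)"
    if \<phi>: "test_function \<phi>" for \<phi>
  proof -
    have "\<bar>\<integral>\<omega>. indicator B \<omega> * \<phi> \<omega> \<partial>sign_measure\<bar> \<le> (\<integral>\<omega>. \<bar>indicator B \<omega> * \<phi> \<omega>\<bar> \<partial>sign_measure)"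
      by (rule integral_abs_bound)
    also have "\<dots> \<le> (\<integral>\<omega>. \<bar>\<phi> \<omega>\<bar> \<partial>sign_measure)"
      by (intro integral_mono integrable_abs int \<phi> test_function_integrable)
         (auto simp: abs_mult indicator_def)
    finally show ?thesis .
  qed
  show ?thesis
    unfolding test_functional_def using bound
    by (simp add: distrib_left int mult.left_commute)
qed

text \<open>Mixing: a far coordinate is asymptotically independent of every event. The indicator of
  \<open>\<omega> k = s\<close> is \<open>(1 + s \<omega>\<^sub>k) / 2\<close> and the second summand vanishes in the limit by Bessel.\<close>

lemma measure_sign_half:
  assumes B: "B \<in> sets sign_measure" and s: "s = 1 \<or> s = - 1"
  shows "(\<lambda>k. measure sign_measure (B \<inter> {\<omega> \<in> space sign_measure. \<omega> k = s})) \<longlonglongrightarrow> measure sign_measure B / 2"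
proof -
  define c where "c k = (\<integral>\<omega>. indicator B \<omega> * (1 * clip (\<omega> k)) \<partial>sign_measure)" for k
  have "c \<longlonglongrightarrow> 0"
    unfolding c_def by (rule test_functional_bessel[OF test_functional_restriction[OF B]])
      (simp_all add: test_function_const)
  have "measure sign_measure (B \<inter> {\<omega> \<in> space sign_measure. \<omega> k = s}) = measure sign_measure B / 2 + s / 2 * c k" for k
  proof -
    have int1: "integrable sign_measure (\<lambda>\<omega>. indicator B \<omega> :: real)"
      using B by (intro integrable_real_indicator) (simp_all add: sign_measure.emeasure_finite less_top[symmetric])
    have int2: "integrable sign_measure (\<lambda>\<omega>. indicator B \<omega> * clip (\<omega> k))"
      using integrable_mult_indicator[OF B test_function_integrable[OF test_function_clip]] by simp
    have meas: "B \<inter> {\<omega> \<in> space sign_measure. \<omega> k = s} \<in> sets sign_measure"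
      using B by measurable
    have "measure sign_measure (B \<inter> {\<omega> \<in> space sign_measure. \<omega> k = s})
        = (\<integral>\<omega>. indicator (B \<inter> {\<omega> \<in> space sign_measure. \<omega> k = s}) \<omega> \<partial>sign_measure)"
      using meas by simp
    also have "\<dots> = (\<integral>\<omega>. indicator B \<omega> / 2 + s / 2 * (indicator B \<omega> * clip (\<omega> k)) \<partial>sign_measure)"
    proof (rule Bochner_Integration.integral_cong[OF refl])
      fix \<omega> assume \<omega>: "\<omega> \<in> space sign_measure"
      then have "\<omega> k = 1 \<or> \<omega> k = - 1" by (simp add: space_sign_measure)
      then show "indicator (B \<inter> {\<omega> \<in> space sign_measure. \<omega> k = s}) \<omega>
          = indicator B \<omega> / 2 + s / 2 * (indicator B \<omega> * clip (\<omega> k))"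
        using s \<omega> by (auto simp: clip_def indicator_def)
    qed
    also have "\<dots> = measure sign_measure B / 2 + s / 2 * c k"
      using int1 int2 B by (simp add: c_def)
    finally show ?thesis .
  qed
  moreover have "(\<lambda>k. measure sign_measure B / 2 + s / 2 * c k) \<longlonglongrightarrow> measure sign_measure B / 2 + s / 2 * 0"
    by (intro tendsto_intros \<open>c \<longlonglongrightarrow> 0\<close>)
  ultimately show ?thesis by simp
qed

text \<open>By mixing, \<open>r\<close> can be chosen such that \<open>A\<close> fills more than half of every cylinder that
  prescribes finitely many of the coordinates \<open>r i\<close>. Flipping all coordinates outside the range of
  \<open>r\<close> preserves these cylinders and the measure, so \<open>A\<close> and its flipped copy meet in each of
  them.\<close>

lemma Kwapien_subsequence:
  assumes A: "A \<in> sets sign_measure" and half: "measure sign_measure A > 1 / 2"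
  obtains r :: "nat \<Rightarrow> nat" where "strict_mono r"
    "\<forall>\<theta> m. (\<forall>i. \<theta> i = 1 \<or> \<theta> i = - 1) \<longrightarrow>
       (\<exists>\<omega>\<in>A. (\<lambda>n. (if n \<in> range r then 1 else - 1) * \<omega> n) \<in> A \<and> (\<forall>i<m. \<omega> (r i) = \<theta> i))"
proof -
  define C where "C xs = {\<omega> \<in> space sign_measure. \<forall>(k, s)\<in>set xs. \<omega> k = s}" for xs :: "(nat \<times> real) list"
  have C_Cons: "C ((k, s) # xs) = C xs \<inter> {\<omega> \<in> space sign_measure. \<omega> k = s}" for k s xs
    by (auto simp: C_def)
  have C_sets: "C xs \<in> sets sign_measure" for xs
  proof (induction xs)
    case (Cons a xs)
    moreover have "{\<omega> \<in> space sign_measure. \<omega> k = s} \<in> sets sign_measure" for k s by measurable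
    ultimately show ?case by (cases a) (simp add: C_Cons)
  qed (simp add: C_def)
  \<comment> \<open>the share of \<open>A\<close> in the cylinder, kept strict to survive small perturbations\<close>
  define Good where "Good xs \<longleftrightarrow> measure sign_measure (C xs) / 2 < measure sign_measure (A \<inter> C xs)" for xs
  obtain r where r: "strict_mono r"
    and Good: "\<And>\<theta> m. (\<And>i. \<theta> i = 1 \<or> \<theta> i = - 1) \<Longrightarrow> Good (rev (map (\<lambda>i. (r i, \<theta> i)) [0..<m]))"
  proof (rule sign_tree[of Good sequentially])
    have "A \<inter> space sign_measure = A" using sets.sets_into_space[OF A] by auto
    then show "Good []" using half by (simp add: Good_def C_def sign_measure.prob_space)
    fix xs s assume xs: "Good xs" and s: "s = 1 \<or> s = (- 1 :: real)"
    have "(\<lambda>k. measure sign_measure (A \<inter> C ((k, s) # xs)) - measure sign_measure (C ((k, s) # xs)) / 2)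
        \<longlonglongrightarrow> measure sign_measure (A \<inter> C xs) / 2 - measure sign_measure (C xs) / 2 / 2"
      unfolding C_Cons Int_assoc[symmetric]
      by (intro tendsto_diff tendsto_divide tendsto_const measure_sign_half s sets.Int A C_sets) simp
    moreover have "0 < measure sign_measure (A \<inter> C xs) / 2 - measure sign_measure (C xs) / 2 / 2"
      using xs by (simp add: Good_def)
    ultimately have "eventually (\<lambda>k. 0 < measure sign_measure (A \<inter> C ((k, s) # xs)) - measure sign_measure (C ((k, s) # xs)) / 2) sequentially"
      by (rule order_tendstoD(1))
    then show "eventually (\<lambda>k. Good ((k, s) # xs)) sequentially"
      by (simp add: Good_def)
  qed simp_all
  define \<eta> where "\<eta> n = (if n \<in> range r then 1 else - 1 :: real)" for n
  have \<eta>: "\<eta> n = 1 \<or> \<eta> n = - 1" for n by (simp add: \<eta>_def)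
  define T where "T \<omega> = (\<lambda>n. \<eta> n * \<omega> n)" for \<omega> :: "nat \<Rightarrow> real"
  have T: "T \<in> measurable sign_measure sign_measure" "distr sign_measure sign_measure T = sign_measure"
    using distr_sign_flip[OF \<eta>] by (simp_all add: T_def[abs_def])
  show ?thesis
  proof (rule that[OF r], intro allI impI)
    fix \<theta> :: "nat \<Rightarrow> real" and m assume "\<forall>i. \<theta> i = 1 \<or> \<theta> i = - 1"
    then have \<theta>: "\<And>i. \<theta> i = 1 \<or> \<theta> i = - 1" by blast
    define D where "D = C (rev (map (\<lambda>i. (r i, \<theta> i)) [0..<m]))"
    have D_iff: "\<omega> \<in> D \<longleftrightarrow> \<omega> \<in> space sign_measure \<and> (\<forall>i<m. \<omega> (r i) = \<theta> i)" for \<omega>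
      by (auto simp: D_def C_def)
    have D_sets: "D \<in> sets sign_measure" by (simp add: D_def C_sets)
    have large: "measure sign_measure D / 2 < measure sign_measure (A \<inter> D)"
      using Good[where m = m, OF \<theta>] by (simp add: Good_def D_def)
    define A' where "A' = T -` (A \<inter> D) \<inter> space sign_measure"
    have A'_sets: "A' \<in> sets sign_measure"
      unfolding A'_def using T(1) A D_sets by (intro measurable_sets sets.Int)
    have A'_sub: "A' \<subseteq> D"
      by (auto simp: A'_def D_iff T_def \<eta>_def)
    have "measure sign_measure A' = measure (distr sign_measure sign_measure T) (A \<inter> D)"
      unfolding A'_def using A D_sets by (intro measure_distr[symmetric] T(1)) auto
    then have large': "measure sign_measure D / 2 < measure sign_measure A'"
      using large by (simp add: T(2))
    have "(A \<inter> D) \<inter> A' \<noteq> {}"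
    proof
      assume "(A \<inter> D) \<inter> A' = {}"
      then have "measure sign_measure ((A \<inter> D) \<union> A') = measure sign_measure (A \<inter> D) + measure sign_measure A'"
        using A D_sets A'_sets by (intro sign_measure.finite_measure_Union) auto
      moreover have "measure sign_measure ((A \<inter> D) \<union> A') \<le> measure sign_measure D"
        using A'_sub D_sets by (intro sign_measure.finite_measure_mono) auto
      ultimately show False using large large' by linarith
    qed
    then show "\<exists>\<omega>\<in>A. (\<lambda>n. (if n \<in> range r then 1 else - 1) * \<omega> n) \<in> A \<and> (\<forall>i<m. \<omega> (r i) = \<theta> i)"
      by (auto simp: A'_def D_iff T_def \<eta>_def)
  qed
qed

lemma measurable_sign_sum_norm:
  "(\<lambda>\<omega>. norm (\<Sum>k\<in>I. \<omega> k *\<^sub>R v k)) \<in> borel_measurable sign_measure"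
  by (intro measurable_sign_continuous continuous_intros continuous_on_product_coordinates)

text \<open>The average of \<open>\<omega>\<close> and its flipped copy equals \<open>\<theta>\<^sub>i\<close> at \<open>r i\<close> and vanishes elsewhere. So every
  signed sum along \<open>r\<close> is the mean of two random sums that are bounded by \<open>M\<close>.\<close>

lemma contains_c0_of_bounded_signs:
  fixes u :: "nat \<Rightarrow> 'a::banach"
  assumes K: "grunblum K u" and d: "d > 0" "\<And>k. d \<le> norm (u k)"
    and half: "measure sign_measure {\<omega> \<in> space sign_measure. \<forall>n. norm (\<Sum>k<n. \<omega> k *\<^sub>R u k) \<le> M} > 1 / 2"
  shows "contains_isomorphic_subspace TYPE('a) c0_space c0_norm"
proof -
  define A where "A = {\<omega> \<in> space sign_measure. \<forall>n. norm (\<Sum>k<n. \<omega> k *\<^sub>R u k) \<le> M}"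
  note measurable_sign_sum_norm [measurable]
  have A_sets: "A \<in> sets sign_measure" unfolding A_def by measurable
  obtain r :: "nat \<Rightarrow> nat" where r: "strict_mono r" and pair: "\<forall>\<theta> m. (\<forall>i. \<theta> i = 1 \<or> \<theta> i = - 1) \<longrightarrow>
       (\<exists>\<omega>\<in>A. (\<lambda>n. (if n \<in> range r then 1 else - 1) * \<omega> n) \<in> A \<and> (\<forall>i<m. \<omega> (r i) = \<theta> i))"
    by (rule Kwapien_subsequence[OF A_sets half[folded A_def]])
  show ?thesis
  proof (rule contains_c0I[where y = "u \<circ> r" and d = d and M = M])
    fix \<theta> :: "nat \<Rightarrow> real" and m assume "\<And>i. \<theta> i = 1 \<or> \<theta> i = - 1"
    then have "\<forall>i. \<theta> i = 1 \<or> \<theta> i = - 1" by blast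
    then obtain \<omega> where \<omega>: "\<omega> \<in> A" "(\<lambda>n. (if n \<in> range r then 1 else - 1) * \<omega> n) \<in> A" "\<forall>i<m. \<omega> (r i) = \<theta> i"
      using pair by blast
    let ?S = "\<Sum>k<r m. \<omega> k *\<^sub>R u k" and ?T = "\<Sum>k<r m. ((if k \<in> range r then 1 else - 1) * \<omega> k) *\<^sub>R u k"
    have "?S + ?T = (\<Sum>k<r m. if k \<in> range r then 2 *\<^sub>R (\<omega> k *\<^sub>R u k) else 0)"
      unfolding sum.distrib[symmetric] by (intro sum.cong refl) (simp add: scaleR_2 del: scaleR_scaleR)
    also have "\<dots> = (\<Sum>i<m. 2 *\<^sub>R (\<omega> (r i) *\<^sub>R u (r i)))"
      by (rule sum_over_subsequence[OF r])
    also have "\<dots> = 2 *\<^sub>R (\<Sum>i<m. \<theta> i *\<^sub>R (u \<circ> r) i)"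
      using \<omega>(3) by (simp add: scaleR_sum_right)
    finally have "2 * norm (\<Sum>i<m. \<theta> i *\<^sub>R (u \<circ> r) i) = norm (?S + ?T)" by simp
    also have "\<dots> \<le> norm ?S + norm ?T" by (rule norm_triangle_ineq)
    also have "\<dots> \<le> M + M" using \<omega>(1,2) unfolding A_def by (intro add_mono) blast+
    finally show "norm (\<Sum>i<m. \<theta> i *\<^sub>R (u \<circ> r) i) \<le> M" by simp
  qed (use grunblum_subsequence[OF K r] d in auto)
qed

section \<open>Blocks with property RUC\<close>

lemma Abel_summation:
  fixes v :: "nat \<Rightarrow> 'a::real_vector"
  assumes "m \<le> n"
  shows "(\<Sum>k\<in>{m..<n}. c k *\<^sub>R v k) = (\<Sum>k\<in>{m..<n}. (c k - c (Suc k)) *\<^sub>R (\<Sum>j<Suc k. v j))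
      + c n *\<^sub>R (\<Sum>j<n. v j) - c m *\<^sub>R (\<Sum>j<m. v j)"
  using assms
proof (induction n rule: dec_induct)
  case (step n)
  then show ?case by (simp add: algebra_simps)
qed simp

lemma norm_Abel_le:
  fixes v :: "nat \<Rightarrow> 'a::real_normed_vector"
  assumes "m \<le> n" and B: "\<And>k. norm (\<Sum>j<k. v j) \<le> B"
  shows "norm (\<Sum>k\<in>{m..<n}. c k *\<^sub>R v k) \<le> B * ((\<Sum>k\<in>{m..<n}. \<bar>c k - c (Suc k)\<bar>) + \<bar>c n\<bar> + \<bar>c m\<bar>)"
proof -
  have B': "norm (t *\<^sub>R (\<Sum>j<k. v j)) \<le> B * \<bar>t\<bar>" for t k
    using mult_left_mono[OF B[of k], of "\<bar>t\<bar>"] by (simp add: mult.commute)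
  have "norm (\<Sum>k\<in>{m..<n}. c k *\<^sub>R v k)
      \<le> norm (\<Sum>k\<in>{m..<n}. (c k - c (Suc k)) *\<^sub>R (\<Sum>j<Suc k. v j))
        + norm (c n *\<^sub>R (\<Sum>j<n. v j)) + norm (c m *\<^sub>R (\<Sum>j<m. v j))"
    by (subst Abel_summation[OF assms(1)])
       (intro order_trans[OF norm_triangle_ineq4] add_mono norm_triangle_ineq order_refl)
  also have "\<dots> \<le> (\<Sum>k\<in>{m..<n}. B * \<bar>c k - c (Suc k)\<bar>) + B * \<bar>c n\<bar> + B * \<bar>c m\<bar>"
    by (intro add_mono B' order_trans[OF norm_sum] sum_mono)
  finally show ?thesis by (simp add: sum_distrib_left distrib_left)
qed

lemma sum_abs_diff_decreasing:
  fixes c :: "nat \<Rightarrow> real"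
  assumes "m \<le> n" "\<And>k. c (Suc k) \<le> c k"
  shows "(\<Sum>k\<in>{m..<n}. \<bar>c k - c (Suc k)\<bar>) = c m - c n"
  using assms(1) by (induction n rule: dec_induct) (use assms(2) in simp_all)

lemma sum_abs_diff_increasing:
  fixes c :: "nat \<Rightarrow> real"
  assumes "m \<le> n" "\<And>k. c k \<le> c (Suc k)"
  shows "(\<Sum>k\<in>{m..<n}. \<bar>c k - c (Suc k)\<bar>) = c n - c m"
  using assms(1) by (induction n rule: dec_induct) (use assms(2) in simp_all)

text \<open>Otherwise the random sums exceed \<open>4\<^sup>j\<close> before some time \<open>p (j + 1)\<close>, for every \<open>j\<close>, with probability
  above one quarter. Damping by \<open>b = 2\<^sup>-\<^sup>j\<close> between \<open>p j\<close> and \<open>p (j + 1)\<close> makes \<open>\<Sum> b\<^sub>k u\<^sub>k\<close> converge by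
  Dirichlet's test, hence randomly unconditionally. But undoing the damping costs only a factor of
  order \<open>2\<^sup>j\<close>, so the damped random sums still exceed \<open>2\<^sup>j / 4\<close> with probability above one quarter
  for all \<open>j\<close>, and are unbounded with positive probability.\<close>

lemma RUC_signs_bounded:
  fixes u :: "nat \<Rightarrow> 'a::banach"
  assumes RUC: "RUC u" and B: "\<And>n. norm (\<Sum>k<n. u k) \<le> B"
  shows "\<exists>M. measure sign_measure {\<omega> \<in> space sign_measure. \<forall>n. norm (\<Sum>k<n. \<omega> k *\<^sub>R u k) \<le> M} > 1 / 2"
proof (rule ccontr)
  assume contra: "\<not> ?thesis"
  note measurable_sign_sum_norm [measurable]
  define D where "D M n = {\<omega> \<in> space sign_measure. \<exists>m\<le>n. norm (\<Sum>k<m. \<omega> k *\<^sub>R u k) > M}" for M n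
  have D_sets: "D M n \<in> sets sign_measure" for M n unfolding D_def by measurable
  have D_large: "\<exists>n>N. measure sign_measure (D M n) > 1 / 4" for M N
  proof -
    define A where "A = {\<omega> \<in> space sign_measure. \<forall>n. norm (\<Sum>k<n. \<omega> k *\<^sub>R u k) \<le> M}"
    have A_sets: "A \<in> sets sign_measure" unfolding A_def by measurable
    have "(\<Union>n. D M n) = space sign_measure - A"
      by (auto simp: D_def A_def) (meson not_le order_refl)+
    then have "measure sign_measure (\<Union>n. D M n) = 1 - measure sign_measure A"
      using sign_measure.prob_compl[OF A_sets] by simp
    moreover have "measure sign_measure A \<le> 1 / 2"
      using contra unfolding A_def by (meson not_le)
    ultimately have "measure sign_measure (\<Union>n. D M n) > 1 / 4" by simp
    moreover have "(\<lambda>n. measure sign_measure (D M n)) \<longlonglongrightarrow> measure sign_measure (\<Union>n. D M n)"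
    proof (rule sign_measure.finite_Lim_measure_incseq)
      show "range (D M) \<subseteq> sets sign_measure" using D_sets by blast
      show "incseq (D M)" unfolding incseq_def D_def by (blast intro: order_trans)
    qed
    ultimately have "eventually (\<lambda>n. measure sign_measure (D M n) > 1 / 4) sequentially"
      by (metis order_tendstoD(1))
    then have "eventually (\<lambda>n. n > N \<and> measure sign_measure (D M n) > 1 / 4) sequentially"
      by (intro eventually_conj eventually_gt_at_top)
    then show ?thesis by (auto simp: eventually_sequentially)
  qed
  obtain p b where p: "strict_mono p" "p 0 = 0"
    and pb: "\<And>j. measure sign_measure (D (4 ^ j) (p (Suc j))) > 1 / 4 \<and> (\<forall>i\<in>{p j..<p (Suc j)}. b i = (1 / 2 :: real) ^ j)"
  proof (rule consecutive_blocks_choice[where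
        P = "\<lambda>j N n b. measure sign_measure (D (4 ^ j) n) > 1 / 4 \<and> (\<forall>i\<in>{N..<n}. b i = (1 / 2 :: real) ^ j)"])
    show "\<exists>n>N. \<exists>b. measure sign_measure (D (4 ^ j) n) > 1 / 4 \<and> (\<forall>i\<in>{N..<n}. b i = (1 / 2 :: real) ^ j)" for j N
      using D_large[of N "4 ^ j"] by (elim exE conjE) (intro exI[of _ "\<lambda>_. (1/2)^j"] exI conjI, auto)
  qed auto
  have b_pos: "b k > 0" for k
    using block_index[OF p(1), of k] pb p(2) by (metis atLeastLessThan_iff le0 zero_less_divide_1_iff zero_less_numeral zero_less_power)
  have b_dec: "b (Suc k) \<le> b k" for k
  proof -
    obtain j where j: "p j \<le> k" "k < p (Suc j)" using block_index[OF p(1), of k] p(2) by auto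
    have bk: "b k = (1/2) ^ j" using pb j by simp
    show ?thesis
    proof (cases "Suc k < p (Suc j)")
      case True
      then show ?thesis using pb[of j] j bk by simp
    next
      case False
      then have "Suc k = p (Suc j)" using j by simp
      moreover have "p (Suc j) < p (Suc (Suc j))" using p(1) by (simp add: strict_mono_Suc_iff)
      ultimately have "b (Suc k) = (1/2) ^ Suc j" using pb[of "Suc j"] by simp
      then show ?thesis using bk b_pos[of "Suc k"] by simp
    qed
  qed
  have b_at: "b (p j) = (1/2) ^ j" for j
    using pb[of j] p(1) by (simp add: strict_mono_Suc_iff)
  have b_antimono: "b n \<le> b m" if "m \<le> n" for m n
    using that b_dec by (rule lift_Suc_antimono_le[rotated])
  have b_lim: "b \<longlonglongrightarrow> 0"
  proof (rule LIMSEQ_I)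
    fix e :: real assume "e > 0"
    then obtain j where "(1/2 :: real) ^ j < e" using real_arch_pow_inv[of e "1/2"] by auto
    then have "norm (b n - 0) < e" if "n \<ge> p j" for n
      using b_antimono[OF that] b_at[of j] b_pos[of n] by simp
    then show "\<exists>N. \<forall>n\<ge>N. norm (b n - 0) < e" by blast
  qed
  have B0: "B \<ge> 0" using B[of 0] by simp
  have "summable (\<lambda>k. b k *\<^sub>R u k)"
    unfolding summable_Cauchy
  proof (intro allI impI)
    fix e :: real assume e: "e > 0"
    have "(\<lambda>m. B * (2 * b m)) \<longlonglongrightarrow> B * (2 * 0)" by (intro tendsto_intros b_lim)
    then have "eventually (\<lambda>m. B * (2 * b m) < e) sequentially" using e by (intro order_tendstoD(2)) auto
    then obtain N where N: "\<And>m. m \<ge> N \<Longrightarrow> B * (2 * b m) < e" by (auto simp: eventually_sequentially)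
    have "norm (\<Sum>k\<in>{m..<n}. b k *\<^sub>R u k) < e" if m: "m \<ge> N" for m n
    proof (cases "m \<le> n")
      case True
      have "norm (\<Sum>k\<in>{m..<n}. b k *\<^sub>R u k) \<le> B * (b m - b n + \<bar>b n\<bar> + \<bar>b m\<bar>)"
        using norm_Abel_le[OF True B, where c = b] sum_abs_diff_decreasing[OF True, of b] b_dec by simp
      also have "\<dots> = B * (2 * b m)" using b_pos[of n] b_pos[of m] by simp
      finally show ?thesis using N[OF m] by simp
    qed (use e in simp)
    then show "\<exists>N. \<forall>m\<ge>N. \<forall>n. norm (\<Sum>k\<in>{m..<n}. b k *\<^sub>R u k) < e" by blast
  qed
  then have conv: "AE \<omega> in sign_measure. summable (\<lambda>k. \<omega> k *\<^sub>R b k *\<^sub>R u k)"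
    using RUC by (simp add: RUC_def randomly_unconditionally_convergent_def)
  define E where "E j = {\<omega> \<in> space sign_measure. \<exists>n. norm (\<Sum>k<n. \<omega> k *\<^sub>R (b k *\<^sub>R u k)) > 2 ^ j / 4}" for j
  have E_sets: "E j \<in> sets sign_measure" for j unfolding E_def by measurable
  have sub: "D (4 ^ j) (p (Suc j)) \<subseteq> E j" for j
  proof
    fix \<omega> assume "\<omega> \<in> D (4 ^ j) (p (Suc j))"
    then obtain m where \<omega>: "\<omega> \<in> space sign_measure" and m: "m \<le> p (Suc j)" "norm (\<Sum>k<m. \<omega> k *\<^sub>R u k) > 4 ^ j"
      by (auto simp: D_def)
    show "\<omega> \<in> E j"
    proof (rule ccontr)
      assume "\<omega> \<notin> E j"
      then have le: "norm (\<Sum>k<n. \<omega> k *\<^sub>R (b k *\<^sub>R u k)) \<le> 2 ^ j / 4" for n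
        using \<omega> by (auto simp: E_def not_less)
      define c where "c k = 1 / b k" for k
      have c_inc: "c k \<le> c (Suc k)" for k
        using b_dec[of k] b_pos[of k] b_pos[of "Suc k"] by (simp add: c_def frac_le)
      have c_pos: "c k > 0" for k using b_pos[of k] by (simp add: c_def)
      have c_le: "c m \<le> 2 * 2 ^ j"
        using b_antimono[OF m(1)] b_at[of "Suc j"] b_pos[of m]
        by (simp add: c_def field_simps power_one_over)
      have "(\<Sum>k<m. \<omega> k *\<^sub>R u k) = (\<Sum>k\<in>{0..<m}. c k *\<^sub>R \<omega> k *\<^sub>R b k *\<^sub>R u k)"
        using b_pos by (simp add: c_def atLeast0LessThan less_imp_neq[symmetric])
      also have "norm \<dots> \<le> 2 ^ j / 4 * ((\<Sum>k\<in>{0..<m}. \<bar>c k - c (Suc k)\<bar>) + \<bar>c m\<bar> + \<bar>c 0\<bar>)"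
        by (rule norm_Abel_le[OF le0 le])
      also have "\<dots> = 2 ^ j / 4 * (2 * c m)"
        using sum_abs_diff_increasing[of 0 m c] c_inc c_pos[of m] c_pos[of 0] by simp
      also have "\<dots> \<le> 2 ^ j / 4 * (2 * (2 * 2 ^ j))"
        using c_le by (intro mult_left_mono) auto
      also have "\<dots> = (2 * 2) ^ j" by (subst power_mult_distrib) simp
      finally show False using m(2) by simp
    qed
  qed
  have "measure sign_measure (E j) \<ge> 1 / 4" for j
    using pb[of j] sign_measure.finite_measure_mono[OF sub[of j] E_sets] by linarith
  moreover have "(\<lambda>j. measure sign_measure (E j)) \<longlonglongrightarrow> measure sign_measure (\<Inter>j. E j)"
  proof (rule sign_measure.finite_Lim_measure_decseq)
    show "range E \<subseteq> sets sign_measure" using E_sets by blast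
    show "decseq E"
    proof (rule decseq_SucI)
      have "(2::real) ^ j / 4 \<le> 2 ^ Suc j / 4" for j by simp
      then show "E (Suc j) \<le> E j" for j
        unfolding E_def by (intro Collect_mono impI) (meson le_less_trans)
    qed
  qed
  ultimately have "measure sign_measure (\<Inter>j. E j) \<ge> 1 / 4"
    by (intro LIMSEQ_le_const) auto
  moreover have "AE \<omega> in sign_measure. \<omega> \<notin> (\<Inter>j. E j)"
    using conv
  proof eventually_elim
    fix \<omega> assume "summable (\<lambda>k. \<omega> k *\<^sub>R b k *\<^sub>R u k)"
    then have "Bseq (\<lambda>n. \<Sum>k<n. \<omega> k *\<^sub>R b k *\<^sub>R u k)"
      unfolding summable_iff_convergent by (rule convergent_imp_Bseq)
    then obtain R where R: "\<forall>n. norm (\<Sum>k<n. \<omega> k *\<^sub>R b k *\<^sub>R u k) \<le> R"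
      unfolding Bseq_def by blast
    obtain j where "4 * R < 2 ^ j" using real_arch_pow[of 2 "4 * R"] by auto
    then have "R \<le> 2 ^ j / 4" by simp
    then have "\<not> norm (\<Sum>k<n. \<omega> k *\<^sub>R b k *\<^sub>R u k) > 2 ^ j / 4" for n
      using R by (meson not_less order_trans)
    then have "\<omega> \<notin> E j" unfolding E_def by blast
    then show "\<omega> \<notin> (\<Inter>j. E j)" by blast
  qed
  then have "measure sign_measure (\<Inter>j. E j) = 0"
  proof -
    have "(\<Inter>j. E j) \<in> sets sign_measure" using E_sets by auto
    then show ?thesis
      using \<open>AE \<omega> in sign_measure. \<omega> \<notin> (\<Inter>j. E j)\<close> sign_measure.prob_eq_0 by blast
  qed
  ultimately show False by simp
qed

context schauder_basis
begin

text \<open>The blocks must be adjacent, so that their sums are partial sums of the original series and stay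
  bounded.\<close>

theorem contains_c0_of_RUC_blocks:
  assumes RUC: "\<And>u. block_subsequence x u \<Longrightarrow> RUC u" and not: "\<not> boundedly_complete x"
  shows "contains_isomorphic_subspace TYPE('a) c0_space c0_norm"
proof -
  obtain a where bdd: "bounded (range (\<lambda>N. \<Sum>n<N. a n *\<^sub>R x n))" and div: "\<not> summable (\<lambda>n. a n *\<^sub>R x n)"
    using not unfolding boundedly_complete_def by blast
  obtain B where B: "\<And>N. norm (\<Sum>n<N. a n *\<^sub>R x n) \<le> B"
    using bdd by (auto simp: bounded_iff)
  obtain d where d: "d > 0" and far: "\<And>N. \<exists>m\<ge>N. \<exists>n. d \<le> norm (\<Sum>k\<in>{m..<n}. a k *\<^sub>R x k)"
    using div unfolding summable_Cauchy by (auto simp: not_less)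
  \<comment> \<open>one of the two blocks that start at \<open>N\<close> and end at \<open>m\<close> or at \<open>n\<close> is large\<close>
  have far': "\<exists>n>N. d / 2 \<le> norm (\<Sum>k\<in>{N..<n}. a k *\<^sub>R x k)" for N
  proof -
    obtain m n where mn: "m \<ge> Suc N" "d \<le> norm (\<Sum>k\<in>{m..<n}. a k *\<^sub>R x k)" using far by blast
    then have "m < n" using d by (cases "m < n") auto
    then have "(\<Sum>k\<in>{N..<m}. a k *\<^sub>R x k) + (\<Sum>k\<in>{m..<n}. a k *\<^sub>R x k) = (\<Sum>k\<in>{N..<n}. a k *\<^sub>R x k)"
      using mn(1) by (intro sum.atLeastLessThan_concat) auto
    then have "(\<Sum>k\<in>{m..<n}. a k *\<^sub>R x k) = (\<Sum>k\<in>{N..<n}. a k *\<^sub>R x k) - (\<Sum>k\<in>{N..<m}. a k *\<^sub>R x k)"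
      by (simp add: algebra_simps)
    then have "d \<le> norm (\<Sum>k\<in>{N..<n}. a k *\<^sub>R x k) + norm (\<Sum>k\<in>{N..<m}. a k *\<^sub>R x k)"
      using mn(2) norm_triangle_ineq4 order_trans by metis
    then consider "d / 2 \<le> norm (\<Sum>k\<in>{N..<n}. a k *\<^sub>R x k)" | "d / 2 \<le> norm (\<Sum>k\<in>{N..<m}. a k *\<^sub>R x k)"
      by linarith
    then show ?thesis
    proof cases
      case 1 then show ?thesis using mn(1) \<open>m < n\<close> by (intro exI[of _ n]) auto
    next
      case 2 then show ?thesis using mn(1) by (intro exI[of _ m]) auto
    qed
  qed
  obtain p l where p: "strict_mono p" "p 0 = 0"
    and pl: "\<And>j. d / 2 \<le> norm (\<Sum>k\<in>{p j..<p (Suc j)}. a k *\<^sub>R x k)"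
    by (rule consecutive_blocks_choice[where P = "\<lambda>j N n (l::nat \<Rightarrow> unit). d / 2 \<le> norm (\<Sum>k\<in>{N..<n}. a k *\<^sub>R x k)"])
       (use far' in auto)
  define u where "u k = (\<Sum>j\<in>{p k..<p (Suc k)}. a j *\<^sub>R x j)" for k
  have u_large: "d / 2 \<le> norm (u k)" for k using pl by (simp add: u_def)
  then have "u k \<noteq> 0" for k using d by (metis half_gt_zero norm_zero not_le)
  then have "block_subsequence x u"
    unfolding u_def[abs_def] by (intro consecutive_block_subsequence p(1)) blast
  then have "RUC u" by (rule RUC)
  have "norm (\<Sum>k<n. u k) \<le> B" for n
    using sum_consecutive_blocks[OF p(1), where m = n and g = "\<lambda>j. a j *\<^sub>R x j"] B[of "p n"] p(2)
    by (simp add: u_def atLeast0LessThan)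
  then obtain M where M: "measure sign_measure {\<omega> \<in> space sign_measure. \<forall>n. norm (\<Sum>k<n. \<omega> k *\<^sub>R u k) \<le> M} > 1 / 2"
    using RUC_signs_bounded[OF \<open>RUC u\<close>] by blast
  have "grunblum basis_const u"
    unfolding u_def[abs_def] by (rule grunblum_consecutive_blocks[OF p])
  then show ?thesis
    using d u_large M by (intro contains_c0_of_bounded_signs[of basis_const u "d / 2" M]) auto
qed

end

section \<open>Averages of sequences with property RUD\<close>

text \<open>Inside a block the partial sums are controlled by the whole block, so convergence along the
  block ends is enough.\<close>

lemma grunblum_blocks_summable:
  fixes u :: "nat \<Rightarrow> 'a::banach"
  assumes K: "grunblum K u" and p: "strict_mono p" "p 0 = 0"
    and small: "eventually (\<lambda>j. norm (\<Sum>k\<in>{p j..<p (Suc j)}. c k *\<^sub>R u k) \<le> (1 / 2) ^ j) sequentially"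
  shows "summable (\<lambda>k. c k *\<^sub>R u k)"
proof -
  define Z where "Z j = (\<Sum>k\<in>{p j..<p (Suc j)}. c k *\<^sub>R u k)" for j
  have "summable Z"
    by (rule summable_comparison_test_ev[OF _ summable_geometric[of "1 / 2 :: real"]])
       (use small in \<open>simp_all add: Z_def\<close>)
  then have "(\<lambda>m. \<Sum>j<m. Z j) \<longlonglongrightarrow> suminf Z" by (rule summable_LIMSEQ)
  moreover have "(\<Sum>j<m. Z j) = (\<Sum>k<p m. c k *\<^sub>R u k)" for m
    using sum_consecutive_blocks[OF p(1), where m = m and g = "\<lambda>k. c k *\<^sub>R u k"] p(2)
    by (simp add: Z_def atLeast0LessThan)
  ultimately have ends: "(\<lambda>m. \<Sum>k<p m. c k *\<^sub>R u k) \<longlonglongrightarrow> suminf Z" by simp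
  have "(\<lambda>j. norm ((\<Sum>k<p j. c k *\<^sub>R u k) - suminf Z) + K * norm (Z j)) \<longlonglongrightarrow> 0 + K * 0"
    by (intro tendsto_add tendsto_mult_left)
       (use ends \<open>summable Z\<close> in \<open>simp_all add: LIM_zero_iff tendsto_norm_zero_iff summable_LIMSEQ_zero\<close>)
  then have err: "(\<lambda>j. norm ((\<Sum>k<p j. c k *\<^sub>R u k) - suminf Z) + K * norm (Z j)) \<longlonglongrightarrow> 0" by simp
  have "(\<lambda>n. \<Sum>k<n. c k *\<^sub>R u k) \<longlonglongrightarrow> suminf Z"
  proof (rule LIMSEQ_I)
    fix e :: real assume "e > 0"
    then have "eventually (\<lambda>j. norm ((\<Sum>k<p j. c k *\<^sub>R u k) - suminf Z) + K * norm (Z j) < e) sequentially"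
      by (intro order_tendstoD(2)[OF err])
    then obtain j0 where j0: "\<And>j. j \<ge> j0 \<Longrightarrow> norm ((\<Sum>k<p j. c k *\<^sub>R u k) - suminf Z) + K * norm (Z j) < e"
      by (auto simp: eventually_sequentially)
    have "norm ((\<Sum>k<n. c k *\<^sub>R u k) - suminf Z) < e" if n: "n \<ge> p j0" for n
    proof -
      have "p 0 \<le> n" using p(2) by simp
      then obtain j where j: "p j \<le> n" "n < p (Suc j)" by (rule block_index[OF p(1)])
      have "p j0 < p (Suc j)" using n j(2) by simp
      then have "j0 \<le> j" by (simp add: strict_mono_less[OF p(1)])
      have "(\<Sum>k<n. c k *\<^sub>R u k) = (\<Sum>k<p j. c k *\<^sub>R u k) + (\<Sum>k\<in>{p j..<n}. c k *\<^sub>R u k)"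
        using sum.atLeastLessThan_concat[of 0 "p j" n "\<lambda>k. c k *\<^sub>R u k"] j(1)
        by (simp add: atLeast0LessThan)
      then have "norm ((\<Sum>k<n. c k *\<^sub>R u k) - suminf Z)
          = norm (((\<Sum>k<p j. c k *\<^sub>R u k) - suminf Z) + (\<Sum>k\<in>{p j..<n}. c k *\<^sub>R u k))"
        by (simp add: algebra_simps)
      also have "\<dots> \<le> norm ((\<Sum>k<p j. c k *\<^sub>R u k) - suminf Z) + norm (\<Sum>k\<in>{p j..<n}. c k *\<^sub>R u k)"
        by (rule norm_triangle_ineq)
      also have "norm (\<Sum>k\<in>{p j..<n}. c k *\<^sub>R u k) \<le> K * norm (Z j)"
        unfolding Z_def using j(2) by (intro grunblum_window[OF K]) simp
      finally show ?thesis using j0[OF \<open>j0 \<le> j\<close>] by linarith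
    qed
    then show "\<exists>N. \<forall>n\<ge>N. norm ((\<Sum>k<n. c k *\<^sub>R u k) - suminf Z) < e" by blast
  qed
  then show ?thesis by (auto simp: summable_def sums_def)
qed

lemma integrable_sign_sum_norm:
  "integrable sign_measure (\<lambda>\<omega>. norm (\<Sum>k\<in>I. \<omega> k *\<^sub>R v k))"
proof (rule integrable_sign_bounded[OF measurable_sign_sum_norm])
  fix \<omega> assume \<omega>: "\<omega> \<in> space sign_measure"
  have "norm (\<Sum>k\<in>I. \<omega> k *\<^sub>R v k) \<le> (\<Sum>k\<in>I. norm (\<omega> k *\<^sub>R v k))" by (rule norm_sum)
  then show "\<bar>norm (\<Sum>k\<in>I. \<omega> k *\<^sub>R v k)\<bar> \<le> (\<Sum>k\<in>I. norm (v k))"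
    by (simp add: abs_sign[OF \<omega>])
qed

text \<open>If no such estimate holds on any tail, there are consecutive blocks of coefficients with sum \<open>1\<close>
  and averages at most \<open>4\<^sup>-\<^sup>j\<close>. By Markov and Borel-Cantelli the random blocks are almost surely
  eventually below \<open>2\<^sup>-\<^sup>j\<close>, so the signed series converges almost surely. By RUD the
  unsigned series converges as well, and \<open>f\<close> maps it to the divergent series of coefficients.\<close>

lemma RUD_average_lower_bound:
  fixes u :: "nat \<Rightarrow> 'a::banach" and f :: "'a \<Rightarrow> real"
  assumes RUD: "RUD u" and K: "grunblum K u" and f: "bounded_linear f" "\<And>k. f (u k) = 1"
  shows "\<exists>N c. c > 0 \<and> (\<forall>n a. (\<forall>k. 0 \<le> a k) \<longrightarrow>
    c * (\<Sum>k\<in>{N..<n}. a k) \<le> (\<integral>\<omega>. norm (\<Sum>k\<in>{N..<n}. \<omega> k *\<^sub>R (a k *\<^sub>R u k)) \<partial>sign_measure))"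
proof (rule ccontr)
  assume contra: "\<not> ?thesis"
  define Ex where "Ex N n a = (\<integral>\<omega>. norm (\<Sum>k\<in>{N..<n}. \<omega> k *\<^sub>R (a k *\<^sub>R u k)) \<partial>sign_measure)"
    for N n and a :: "nat \<Rightarrow> real"
  have ex: "\<exists>n>N. \<exists>a. (\<Sum>k\<in>{N..<n}. a k) = 1 \<and> Ex N n a \<le> (1 / 4) ^ j" for N j
  proof -
    have pos: "(1 / 4 :: real) ^ j > 0" by simp
    then obtain n a where a: "\<forall>k. 0 \<le> a k" "Ex N n a < (1 / 4) ^ j * (\<Sum>k\<in>{N..<n}. a k)"
      using contra unfolding Ex_def by (meson not_le)
    define s where "s = (\<Sum>k\<in>{N..<n}. a k)"
    have "Ex N n a \<ge> 0" unfolding Ex_def by (rule integral_nonneg_AE) simp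
    then have "0 < (1 / 4) ^ j * s" using a(2) by (simp add: s_def)
    then have s: "s > 0" using pos by (simp add: zero_less_mult_iff)
    then have "n > N" by (cases "n > N") (auto simp: s_def)
    moreover have "(\<Sum>k\<in>{N..<n}. a k / s) = 1"
      using s by (simp add: s_def flip: sum_divide_distrib)
    moreover have "Ex N n (\<lambda>k. a k / s) = Ex N n a / s"
    proof -
      have "norm (\<Sum>k\<in>{N..<n}. \<omega> k *\<^sub>R ((a k / s) *\<^sub>R u k)) = norm (\<Sum>k\<in>{N..<n}. \<omega> k *\<^sub>R (a k *\<^sub>R u k)) / s" for \<omega>
      proof -
        have "(\<Sum>k\<in>{N..<n}. \<omega> k *\<^sub>R ((a k / s) *\<^sub>R u k)) = (1 / s) *\<^sub>R (\<Sum>k\<in>{N..<n}. \<omega> k *\<^sub>R (a k *\<^sub>R u k))"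
          by (simp add: scaleR_sum_right)
        then show ?thesis using s by simp
      qed
      then show ?thesis by (simp add: Ex_def)
    qed
    moreover have "Ex N n a / s \<le> (1 / 4) ^ j"
      using a(2) s by (simp add: s_def[symmetric] divide_le_eq)
    ultimately show ?thesis by (intro exI[of _ n] conjI exI[of _ "\<lambda>k. a k / s"]) simp_all
  qed
  obtain p a where p: "strict_mono p" "p 0 = 0"
    and pa: "\<And>j. (\<Sum>k\<in>{p j..<p (Suc j)}. a k) = 1 \<and> Ex (p j) (p (Suc j)) a \<le> (1 / 4) ^ j"
  proof (rule consecutive_blocks_choice[where P = "\<lambda>j N n a. (\<Sum>k\<in>{N..<n}. a k) = 1 \<and> Ex N n a \<le> (1 / 4) ^ j"])
    fix j N n and a a' :: "nat \<Rightarrow> real"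
    assume "(\<Sum>k\<in>{N..<n}. a k) = 1 \<and> Ex N n a \<le> (1 / 4) ^ j" and eq: "\<And>i. N \<le> i \<Longrightarrow> i < n \<Longrightarrow> a i = a' i"
    moreover have "(\<Sum>k\<in>{N..<n}. a k) = (\<Sum>k\<in>{N..<n}. a' k)" using eq by (intro sum.cong) auto
    moreover have "(\<Sum>k\<in>{N..<n}. \<omega> k *\<^sub>R (a k *\<^sub>R u k)) = (\<Sum>k\<in>{N..<n}. \<omega> k *\<^sub>R (a' k *\<^sub>R u k))" for \<omega>
      using eq by (intro sum.cong) auto
    ultimately show "(\<Sum>k\<in>{N..<n}. a' k) = 1 \<and> Ex N n a' \<le> (1 / 4) ^ j" by (simp add: Ex_def)
  next
    fix p a assume "strict_mono p" "p 0 = 0"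
      "\<And>j. (\<Sum>k\<in>{p j..<p (Suc j)}. a k) = 1 \<and> Ex (p j) (p (Suc j)) a \<le> (1 / 4) ^ j"
    then show thesis by (rule that)
  qed (rule ex)
  define Z where "Z j \<omega> = norm (\<Sum>k\<in>{p j..<p (Suc j)}. \<omega> k *\<^sub>R (a k *\<^sub>R u k))" for j \<omega>
  have Z_meas [measurable]: "Z j \<in> borel_measurable sign_measure" for j
    unfolding Z_def by (rule measurable_sign_sum_norm)
  have Z_int: "integrable sign_measure (Z j)" for j
    unfolding Z_def by (rule integrable_sign_sum_norm)
  have Z_nonneg: "0 \<le> Z j \<omega>" for j \<omega> by (simp add: Z_def)
  define L where "L j = {\<omega> \<in> space sign_measure. Z j \<omega> \<ge> (1 / 2) ^ j}" for j
  have L_sets: "L j \<in> sets sign_measure" for j unfolding L_def by measurable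
  have L_le: "measure sign_measure (L j) \<le> (1 / 2) ^ j" for j
  proof -
    have "measure sign_measure (L j) \<le> (\<integral>\<omega>. Z j \<omega> \<partial>sign_measure) / (1 / 2) ^ j"
      unfolding L_def by (rule integral_Markov_inequality_measure[where A = "{}"])
        (simp_all add: Z_int Z_nonneg)
    also have "\<dots> \<le> (1 / 4) ^ j / (1 / 2) ^ j"
      using pa[of j] by (intro divide_right_mono) (simp_all add: Z_def[abs_def] Ex_def)
    also have "\<dots> = (1 / 2) ^ j" by (simp flip: power_divide)
    finally show ?thesis .
  qed
  have "AE \<omega> in sign_measure. eventually (\<lambda>j. \<omega> \<in> space sign_measure - L j) sequentially"
  proof (rule borel_cantelli_AE1)
    show "summable (\<lambda>j. measure sign_measure (L j))"
      by (rule summable_comparison_test'[OF summable_geometric[of "1 / 2 :: real"], of 0]) (use L_le in auto)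
  qed (use L_sets in \<open>auto simp: sign_measure.emeasure_finite less_top[symmetric]\<close>)
  then have "AE \<omega> in sign_measure. summable (\<lambda>k. \<omega> k *\<^sub>R a k *\<^sub>R u k)"
  proof eventually_elim
    fix \<omega> assume "eventually (\<lambda>j. \<omega> \<in> space sign_measure - L j) sequentially"
    then have "eventually (\<lambda>j. norm (\<Sum>k\<in>{p j..<p (Suc j)}. (\<omega> k * a k) *\<^sub>R u k) \<le> (1 / 2) ^ j) sequentially"
      by eventually_elim (auto simp: L_def Z_def)
    then have "summable (\<lambda>k. (\<omega> k * a k) *\<^sub>R u k)" by (rule grunblum_blocks_summable[OF K p])
    then show "summable (\<lambda>k. \<omega> k *\<^sub>R a k *\<^sub>R u k)" by simp
  qed
  then have "summable (\<lambda>k. a k *\<^sub>R u k)"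
    using RUD unfolding RUD_def randomly_unconditionally_convergent_def by blast
  then have "summable (\<lambda>k. f (a k *\<^sub>R u k))" by (rule bounded_linear.summable[OF f(1)])
  moreover have "f (a k *\<^sub>R u k) = a k" for k
    using linear_scale[OF bounded_linear.linear[OF f(1)], of "a k" "u k"] f(2) by simp
  ultimately have "summable a" by simp
  then have "\<exists>m. \<forall>k\<ge>m. \<forall>n. norm (sum a {k..<n}) < 1"
    unfolding summable_Cauchy by simp
  then obtain m where m: "\<And>k n. k \<ge> m \<Longrightarrow> norm (sum a {k..<n}) < 1" by blast
  have "p m \<ge> m" by (rule strict_mono_imp_increasing[OF p(1)])
  then show False using m[of "p m" "p (Suc m)"] pa[of m] by simp
qed

section \<open>A functional that detects the averages\<close>

definition tensor :: "((nat \<Rightarrow> real) \<Rightarrow> real) \<Rightarrow> 'a::real_normed_vector \<Rightarrow> (nat \<Rightarrow> real) \<Rightarrow>\<^sub>C 'a" where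
  "tensor \<phi> v = Bcontfun (\<lambda>\<omega>. \<phi> \<omega> *\<^sub>R v)"

lemma apply_tensor: "test_function \<phi> \<Longrightarrow> apply_bcontfun (tensor \<phi> v) \<omega> = \<phi> \<omega> *\<^sub>R v"
proof -
  assume \<phi>: "test_function \<phi>"
  then obtain B where "\<And>\<omega>. \<bar>\<phi> \<omega>\<bar> \<le> B" unfolding test_function_def by blast
  then have "(\<lambda>\<omega>. \<phi> \<omega> *\<^sub>R v) \<in> bcontfun"
    using \<phi> unfolding test_function_def
    by (intro bcontfun_normI[where b = "B * norm v"]) (auto intro!: continuous_intros mult_right_mono)
  then show ?thesis by (simp add: tensor_def Bcontfun_inverse)
qed

definition mean_norm :: "((nat \<Rightarrow> real) \<Rightarrow>\<^sub>C 'a::real_normed_vector) \<Rightarrow> real" where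
  "mean_norm \<Phi> = (\<integral>\<omega>. norm (apply_bcontfun \<Phi> \<omega>) \<partial>sign_measure)"

lemma integrable_norm_bcontfun: "integrable sign_measure (\<lambda>\<omega>. norm (apply_bcontfun \<Phi> \<omega>))"
proof (rule integrable_sign_bounded)
  show "(\<lambda>\<omega>. norm (apply_bcontfun \<Phi> \<omega>)) \<in> borel_measurable sign_measure"
    by (intro measurable_sign_continuous continuous_on_norm continuous_on_apply_bcontfun)
  show "\<bar>norm (apply_bcontfun \<Phi> \<omega>)\<bar> \<le> norm \<Phi>" for \<omega>
    using norm_bounded[of \<Phi> \<omega>] by simp
qed

lemma sublinear_mean_norm: "sublinear mean_norm"
  unfolding sublinear_def
proof (intro conjI allI impI)
  fix \<Phi> \<Psi> :: "(nat \<Rightarrow> real) \<Rightarrow>\<^sub>C 'a"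
  have "mean_norm (\<Phi> + \<Psi>) \<le> (\<integral>\<omega>. norm (apply_bcontfun \<Phi> \<omega>) + norm (apply_bcontfun \<Psi> \<omega>) \<partial>sign_measure)"
    unfolding mean_norm_def
    by (intro integral_mono integrable_norm_bcontfun Bochner_Integration.integrable_add)
       (simp add: norm_triangle_ineq)
  then show "mean_norm (\<Phi> + \<Psi>) \<le> mean_norm \<Phi> + mean_norm \<Psi>"
    by (simp add: mean_norm_def integrable_norm_bcontfun)
next
  fix c :: real and \<Phi> :: "(nat \<Rightarrow> real) \<Rightarrow>\<^sub>C 'a" assume "0 \<le> c"
  then show "mean_norm (c *\<^sub>R \<Phi>) = c * mean_norm \<Phi>" by (simp add: mean_norm_def)
qed

text \<open>The Mazur-Orlicz theorem for \<open>E \<parallel>\<cdot>\<parallel>\<close> and the cone generated by the functions \<open>\<epsilon>\<^sub>k u\<^sub>k\<close>, \<open>k \<ge> N\<close>, with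
  prescribed lower bound \<open>c\<close>; the hypothesis says exactly that these constraints are compatible.
  The functional \<open>G\<close> on \<open>X\<close>-valued functions is recorded as the bilinear map
  \<open>\<Gamma> \<phi> v = G (\<phi> \<otimes> v)\<close>.\<close>

lemma exists_random_functional:
  fixes u :: "nat \<Rightarrow> 'a::real_normed_vector"
  assumes lower: "\<And>n a. (\<And>k. 0 \<le> a k) \<Longrightarrow>
    c * (\<Sum>k\<in>{N..<n}. a k) \<le> (\<integral>\<omega>. norm (\<Sum>k\<in>{N..<n}. \<omega> k *\<^sub>R (a k *\<^sub>R u k)) \<partial>sign_measure)"
  shows "\<exists>\<Gamma> :: ((nat \<Rightarrow> real) \<Rightarrow> real) \<Rightarrow> 'a \<Rightarrow> real.
    (\<forall>v. test_functional (norm v) (\<lambda>\<phi>. \<Gamma> \<phi> v)) \<and> (\<forall>\<phi>. test_function \<phi> \<longrightarrow> linear (\<Gamma> \<phi>)) \<and>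
    (\<forall>k\<ge>N. c \<le> \<Gamma> (\<lambda>\<omega>. clip (\<omega> k)) (u k))"
proof -
  define t where "t k = tensor (\<lambda>\<omega>. clip (\<omega> k)) (u k)" for k
  define C where "C = {((\<Sum>k\<in>{N..<n}. a k *\<^sub>R t k), c * (\<Sum>k\<in>{N..<n}. a k)) | n a.
    (\<forall>k. 0 \<le> a k) \<and> (\<forall>k\<ge>n. a k = (0 :: real))}"
  have C_I: "((\<Sum>k\<in>{N..<n}. a k *\<^sub>R t k), c * (\<Sum>k\<in>{N..<n}. a k)) \<in> C"
    if "\<And>k. 0 \<le> a k" "\<And>k. k \<ge> n \<Longrightarrow> a k = 0" for n and a :: "nat \<Rightarrow> real"
    unfolding C_def using that by blast
  have C_cone: "convex_cone C"
    unfolding convex_cone_iff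
  proof (intro conjI ballI allI impI)
    show "0 \<in> C" using C_I[of "\<lambda>_. 0" 0] by (simp add: zero_prod_def)
    fix y z assume "y \<in> C" "z \<in> C"
    then obtain n a m b where
      a: "\<forall>k. 0 \<le> a k" "\<forall>k\<ge>n. a k = 0" "y = ((\<Sum>k\<in>{N..<n}. a k *\<^sub>R t k), c * (\<Sum>k\<in>{N..<n}. a k))" and
      b: "\<forall>k. 0 \<le> b k" "\<forall>k\<ge>m. b k = 0" "z = ((\<Sum>k\<in>{N..<m}. b k *\<^sub>R t k), c * (\<Sum>k\<in>{N..<m}. b k))"
      unfolding C_def by blast
    define l where "l = max n m"
    have ya: "y = ((\<Sum>k\<in>{N..<l}. a k *\<^sub>R t k), c * (\<Sum>k\<in>{N..<l}. a k))"
      unfolding a(3) using a(2)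
      by (intro arg_cong2[where f = Pair] arg_cong2[where f = "(*)"] refl sum.mono_neutral_left) (auto simp: l_def)
    have zb: "z = ((\<Sum>k\<in>{N..<l}. b k *\<^sub>R t k), c * (\<Sum>k\<in>{N..<l}. b k))"
      unfolding b(3) using b(2)
      by (intro arg_cong2[where f = Pair] arg_cong2[where f = "(*)"] refl sum.mono_neutral_left) (auto simp: l_def)
    have "y + z = ((\<Sum>k\<in>{N..<l}. (a k + b k) *\<^sub>R t k), c * (\<Sum>k\<in>{N..<l}. (a k + b k)))"
      unfolding ya zb by (simp add: sum.distrib scaleR_left_distrib distrib_left)
    also have "\<dots> \<in> C" using a b by (intro C_I) (simp_all add: l_def)
    finally show "y + z \<in> C" .
  next
    fix y and s :: real assume "y \<in> C" "0 \<le> s"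
    then obtain n a where
      a: "\<forall>k. 0 \<le> a k" "\<forall>k\<ge>n. a k = 0" "y = ((\<Sum>k\<in>{N..<n}. a k *\<^sub>R t k), c * (\<Sum>k\<in>{N..<n}. a k))"
      unfolding C_def by blast
    have "s *\<^sub>R y = ((\<Sum>k\<in>{N..<n}. (s * a k) *\<^sub>R t k), c * (\<Sum>k\<in>{N..<n}. s * a k))"
      unfolding a(3) by (simp add: scaleR_sum_right sum_distrib_left mult_ac)
    also have "\<dots> \<in> C" using a \<open>0 \<le> s\<close> by (intro C_I) simp_all
    finally show "s *\<^sub>R y \<in> C" .
  qed
  have below: "b \<le> mean_norm \<Phi>" if mem: "(\<Phi>, b) \<in> C" for \<Phi> b
  proof -
    obtain n a where a: "\<forall>k. 0 \<le> a k"
      and eq: "(\<Phi>, b) = ((\<Sum>k\<in>{N..<n}. a k *\<^sub>R t k), c * (\<Sum>k\<in>{N..<n}. a k))"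
      using mem unfolding C_def by (elim CollectE exE conjE) (rule that)
    have \<Phi>: "\<Phi> = (\<Sum>k\<in>{N..<n}. a k *\<^sub>R t k)" and b: "b = c * (\<Sum>k\<in>{N..<n}. a k)"
      using eq by simp_all
    have apply_sum: "apply_bcontfun (\<Sum>k\<in>I. a k *\<^sub>R t k) \<omega> = (\<Sum>k\<in>I. clip (\<omega> k) *\<^sub>R (a k *\<^sub>R u k))"
      for I and \<omega> :: "nat \<Rightarrow> real"
      by (induction I rule: infinite_finite_induct) (simp_all add: t_def apply_tensor test_function_clip mult.commute)
    have "mean_norm \<Phi> = (\<integral>\<omega>. norm (\<Sum>k\<in>{N..<n}. \<omega> k *\<^sub>R (a k *\<^sub>R u k)) \<partial>sign_measure)"
      unfolding mean_norm_def \<Phi> apply_sum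
      by (rule Bochner_Integration.integral_cong[OF refl]) (simp add: clip_sign space_sign_measure)
    then show ?thesis using lower[of a n] a by (simp add: b)
  qed
  obtain G where G: "linear G" "\<And>\<Phi>. G \<Phi> \<le> mean_norm \<Phi>" "\<forall>(\<Phi>, b)\<in>C. b \<le> G \<Phi>"
    using Mazur_Orlicz[OF sublinear_mean_norm C_cone below] by auto
  have abs_G: "\<bar>G \<Phi>\<bar> \<le> mean_norm \<Phi>" for \<Phi>
  proof -
    have "mean_norm (- \<Phi>) = mean_norm \<Phi>" by (simp add: mean_norm_def)
    then show ?thesis using G(2)[of \<Phi>] G(2)[of "- \<Phi>"] linear_neg[OF G(1), of \<Phi>] by simp
  qed
  show ?thesis
  proof (intro exI[of _ "\<lambda>\<phi> v. G (tensor \<phi> v)"] conjI allI impI)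
    show "test_functional (norm v) (\<lambda>\<phi>. G (tensor \<phi> v))" for v
      unfolding test_functional_def
    proof (intro conjI allI impI)
      fix \<phi> \<psi> :: "(nat \<Rightarrow> real) \<Rightarrow> real" assume \<phi>: "test_function \<phi>" and \<psi>: "test_function \<psi>"
      have "tensor (\<lambda>\<omega>. \<phi> \<omega> + \<psi> \<omega>) v = tensor \<phi> v + tensor \<psi> v"
        by (rule bcontfun_eqI) (simp add: apply_tensor \<phi> \<psi> test_function_add scaleR_left_distrib)
      then show "G (tensor (\<lambda>\<omega>. \<phi> \<omega> + \<psi> \<omega>) v) = G (tensor \<phi> v) + G (tensor \<psi> v)"
        by (simp add: linear_add[OF G(1)])
    next
      fix s and \<phi> :: "(nat \<Rightarrow> real) \<Rightarrow> real" assume \<phi>: "test_function \<phi>"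
      have "tensor (\<lambda>\<omega>. s * \<phi> \<omega>) v = s *\<^sub>R tensor \<phi> v"
        by (rule bcontfun_eqI) (simp add: apply_tensor \<phi> test_function_scale)
      then show "G (tensor (\<lambda>\<omega>. s * \<phi> \<omega>) v) = s * G (tensor \<phi> v)"
        by (simp add: linear_scale[OF G(1)])
    next
      fix \<phi> :: "(nat \<Rightarrow> real) \<Rightarrow> real" assume \<phi>: "test_function \<phi>"
      show "\<bar>G (tensor \<phi> v)\<bar> \<le> norm v * (\<integral>\<omega>. \<bar>\<phi> \<omega>\<bar> \<partial>sign_measure)"
        using abs_G[of "tensor \<phi> v"] by (simp add: mean_norm_def apply_tensor \<phi> mult.commute)
    qed
    show "linear (\<lambda>v. G (tensor \<phi> v))" if \<phi>: "test_function \<phi>" for \<phi>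
    proof (rule linearI)
      have "tensor \<phi> (v + w) = tensor \<phi> v + tensor \<phi> w" for v w :: 'a
        by (rule bcontfun_eqI) (simp add: apply_tensor \<phi> scaleR_right_distrib)
      then show "G (tensor \<phi> (v + w)) = G (tensor \<phi> v) + G (tensor \<phi> w)" for v w
        by (simp add: linear_add[OF G(1)])
      have "tensor \<phi> (s *\<^sub>R v) = s *\<^sub>R tensor \<phi> v" for s and v :: 'a
        by (rule bcontfun_eqI) (simp add: apply_tensor \<phi>)
      then show "G (tensor \<phi> (s *\<^sub>R v)) = s *\<^sub>R G (tensor \<phi> v)" for s v
        by (simp add: linear_scale[OF G(1)])
    qed
    show "c \<le> G (tensor (\<lambda>\<omega>. clip (\<omega> k)) (u k))" if "k \<ge> N" for k
    proof -
      define a where "a i = (if i = k then 1 else 0 :: real)" for i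
      have "((\<Sum>i\<in>{N..<Suc k}. a i *\<^sub>R t i), c * (\<Sum>i\<in>{N..<Suc k}. a i)) \<in> C"
        by (rule C_I) (simp_all add: a_def)
      moreover have "(\<Sum>i\<in>{N..<Suc k}. a i *\<^sub>R t i) = (\<Sum>i\<in>{N..<Suc k}. if i = k then t i else 0)"
        by (intro sum.cong) (simp_all add: a_def)
      ultimately have "(t k, c) \<in> C" using that by (simp add: a_def)
      then show ?thesis using G(3) by (auto simp: t_def)
    qed
  qed
qed

section \<open>Riesz products and copies of l1\<close>

text \<open>Tychonoff's theorem provides one filter along which uncountably many bounded sequences converge
  simultaneously, which takes the place of a diagonal subsequence.\<close>

lemma common_limit_filter:
  fixes h :: "nat \<Rightarrow> 'i \<Rightarrow> real"
  assumes bound: "\<And>k i. \<bar>h k i\<bar> \<le> B i"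
  shows "\<exists>F. F \<noteq> bot \<and> F \<le> sequentially \<and> (\<forall>i. \<exists>l. ((\<lambda>k. h k i) \<longlongrightarrow> l) F)"
proof -
  define K where "K = Pi\<^sub>E UNIV (\<lambda>i. {- B i..B i})"
  have "compactin (product_topology (\<lambda>_. euclidean) UNIV) K"
    unfolding K_def compactin_PiE by (simp add: compactin_euclidean_iff)
  then have "compact K"
    by (simp add: euclidean_product_topology compactin_euclidean_iff)
  moreover have "eventually (\<lambda>z. z \<in> K) (filtermap h sequentially)"
    using bound by (auto simp: eventually_filtermap K_def PiE_iff abs_le_iff minus_le_iff intro!: always_eventually)
  moreover have "filtermap h sequentially \<noteq> bot" by (simp add: filtermap_bot_iff)
  ultimately obtain y where y: "inf (nhds y) (filtermap h sequentially) \<noteq> bot"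
    unfolding compact_filter by blast
  define F where "F = inf sequentially (filtercomap h (nhds y))"
  show ?thesis
  proof (intro exI[of _ F] conjI allI)
    show "F \<noteq> bot"
    proof
      assume "F = bot"
      then have "eventually (\<lambda>_. False) F" by simp
      then obtain Q R where Q: "eventually Q sequentially" and R: "eventually R (filtercomap h (nhds y))"
        and QR: "\<And>k. Q k \<Longrightarrow> R k \<Longrightarrow> False"
        unfolding F_def eventually_inf by blast
      obtain S where S: "eventually S (nhds y)" and SR: "\<And>k. S (h k) \<Longrightarrow> R k"
        using R unfolding eventually_filtercomap by blast
      have "eventually (\<lambda>z. \<not> S z) (filtermap h sequentially)"
        unfolding eventually_filtermap using Q by eventually_elim (use QR SR in blast)
      then have "eventually (\<lambda>_. False) (inf (nhds y) (filtermap h sequentially))"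
        unfolding eventually_inf using S by blast
      then show False using y by (simp add: trivial_limit_def)
    qed
    show "F \<le> sequentially" by (simp add: F_def)
    have lim: "(h \<longlongrightarrow> y) F"
      unfolding F_def by (rule filterlim_mono[OF filterlim_filtercomap order_refl]) simp
    show "\<exists>l. ((\<lambda>k. h k i) \<longlongrightarrow> l) F" for i
    proof
      show "((\<lambda>k. h k i) \<longlongrightarrow> y i) F"
        by (rule continuous_on_tendsto_compose[OF continuous_on_product_coordinates lim]) simp_all
    qed
  qed
qed

lemma test_functional_limit:
  assumes \<Lambda>: "\<And>k. test_functional C (\<Lambda> k)" and F: "F \<noteq> bot"
    and lim: "\<And>\<phi>. test_function \<phi> \<Longrightarrow> ((\<lambda>k. \<Lambda> k \<phi>) \<longlongrightarrow> L \<phi>) F"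
  shows "test_functional C L"
  unfolding test_functional_def
proof (intro conjI allI impI)
  fix \<phi> \<psi> :: "(nat \<Rightarrow> real) \<Rightarrow> real" assume \<phi>: "test_function \<phi>" and \<psi>: "test_function \<psi>"
  have "((\<lambda>k. \<Lambda> k (\<lambda>\<omega>. \<phi> \<omega> + \<psi> \<omega>)) \<longlongrightarrow> L \<phi> + L \<psi>) F"
    using tendsto_add[OF lim[OF \<phi>] lim[OF \<psi>]] by (simp only: test_functional_add[OF \<Lambda> \<phi> \<psi>])
  then show "L (\<lambda>\<omega>. \<phi> \<omega> + \<psi> \<omega>) = L \<phi> + L \<psi>"
    by (rule tendsto_unique[OF F lim[OF test_function_add[OF \<phi> \<psi>]]])
next
  fix c and \<phi> :: "(nat \<Rightarrow> real) \<Rightarrow> real" assume \<phi>: "test_function \<phi>"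
  have "((\<lambda>k. \<Lambda> k (\<lambda>\<omega>. c * \<phi> \<omega>)) \<longlongrightarrow> c * L \<phi>) F"
    using tendsto_mult_left[OF lim[OF \<phi>], of c] by (simp only: test_functional_scale[OF \<Lambda> \<phi>])
  then show "L (\<lambda>\<omega>. c * \<phi> \<omega>) = c * L \<phi>"
    by (rule tendsto_unique[OF F lim[OF test_function_scale[OF \<phi>]]])
next
  fix \<phi> :: "(nat \<Rightarrow> real) \<Rightarrow> real" assume \<phi>: "test_function \<phi>"
  show "\<bar>L \<phi>\<bar> \<le> C * (\<integral>\<omega>. \<bar>\<phi> \<omega>\<bar> \<partial>sign_measure)"
    using tendsto_rabs[OF lim[OF \<phi>]]
    by (rule tendsto_upperbound) (simp_all add: F test_functional_bound[OF \<Lambda> \<phi>])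
qed

lemma test_functional_mono:
  assumes "test_functional C \<Lambda>" "C \<le> D"
  shows "test_functional D \<Lambda>"
  unfolding test_functional_def
proof (intro conjI allI impI)
  fix \<phi> :: "(nat \<Rightarrow> real) \<Rightarrow> real" assume \<phi>: "test_function \<phi>"
  have "0 \<le> (\<integral>\<omega>. \<bar>\<phi> \<omega>\<bar> \<partial>sign_measure)" by (rule integral_nonneg_AE) simp
  then have "C * (\<integral>\<omega>. \<bar>\<phi> \<omega>\<bar> \<partial>sign_measure) \<le> D * (\<integral>\<omega>. \<bar>\<phi> \<omega>\<bar> \<partial>sign_measure)"
    by (intro mult_right_mono assms)
  then show "\<bar>\<Lambda> \<phi>\<bar> \<le> D * (\<integral>\<omega>. \<bar>\<phi> \<omega>\<bar> \<partial>sign_measure)"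
    using test_functional_bound[OF assms(1) \<phi>] by linarith
qed (simp_all add: test_functional_add[OF assms(1)] test_functional_scale[OF assms(1)])

lemma test_functional_mult_clip:
  assumes \<Lambda>: "test_functional C \<Lambda>" and C: "C \<ge> 0"
  shows "test_functional C (\<lambda>\<phi>. \<Lambda> (\<lambda>\<omega>. \<phi> \<omega> * clip (\<omega> k)))"
  unfolding test_functional_def
proof (intro conjI allI impI)
  fix \<phi> \<psi> :: "(nat \<Rightarrow> real) \<Rightarrow> real" assume "test_function \<phi>" "test_function \<psi>"
  then show "\<Lambda> (\<lambda>\<omega>. (\<phi> \<omega> + \<psi> \<omega>) * clip (\<omega> k)) = \<Lambda> (\<lambda>\<omega>. \<phi> \<omega> * clip (\<omega> k)) + \<Lambda> (\<lambda>\<omega>. \<psi> \<omega> * clip (\<omega> k))"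
    unfolding distrib_right by (intro test_functional_add[OF \<Lambda>] test_function_mult test_function_clip)
next
  fix c and \<phi> :: "(nat \<Rightarrow> real) \<Rightarrow> real" assume "test_function \<phi>"
  then show "\<Lambda> (\<lambda>\<omega>. (c * \<phi> \<omega>) * clip (\<omega> k)) = c * \<Lambda> (\<lambda>\<omega>. \<phi> \<omega> * clip (\<omega> k))"
    unfolding mult.assoc by (intro test_functional_scale[OF \<Lambda>] test_function_mult test_function_clip)
next
  fix \<phi> :: "(nat \<Rightarrow> real) \<Rightarrow> real" assume \<phi>: "test_function \<phi>"
  have test: "test_function (\<lambda>\<omega>. \<phi> \<omega> * clip (\<omega> k))" by (intro test_function_mult \<phi> test_function_clip)
  have "\<bar>\<Lambda> (\<lambda>\<omega>. \<phi> \<omega> * clip (\<omega> k))\<bar> \<le> C * (\<integral>\<omega>. \<bar>\<phi> \<omega> * clip (\<omega> k)\<bar> \<partial>sign_measure)"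
    by (rule test_functional_bound[OF \<Lambda> test])
  also have "\<dots> \<le> C * (\<integral>\<omega>. \<bar>\<phi> \<omega>\<bar> \<partial>sign_measure)"
  proof (intro mult_left_mono C integral_mono integrable_abs test_function_integrable test \<phi>)
    show "\<bar>\<phi> \<omega> * clip (\<omega> k)\<bar> \<le> \<bar>\<phi> \<omega>\<bar>" for \<omega>
      using mult_left_mono[OF abs_clip_le[of "\<omega> k"], of "\<bar>\<phi> \<omega>\<bar>"] by (simp add: abs_mult)
  qed
  finally show "\<bar>\<Lambda> (\<lambda>\<omega>. \<phi> \<omega> * clip (\<omega> k))\<bar> \<le> C * (\<integral>\<omega>. \<bar>\<phi> \<omega>\<bar> \<partial>sign_measure)" .
qed

text \<open>The product of the factors \<open>1 + s \<epsilon>\<^sub>k\<close>, in the additive form in which functionals are applied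
  to it.\<close>

fun riesz_product :: "(nat \<times> real) list \<Rightarrow> (nat \<Rightarrow> real) \<Rightarrow> real" where
  "riesz_product [] = (\<lambda>_. 1)"
| "riesz_product ((k, s) # xs) = (\<lambda>\<omega>. riesz_product xs \<omega> + s * (riesz_product xs \<omega> * clip (\<omega> k)))"

lemma test_function_riesz: "test_function (riesz_product xs)"
  by (induction xs rule: riesz_product.induct)
     (auto intro!: test_function_const test_function_add test_function_scale test_function_mult test_function_clip)

lemma riesz_product_nonneg: "(\<And>k s. (k, s) \<in> set xs \<Longrightarrow> \<bar>s\<bar> \<le> 1) \<Longrightarrow> 0 \<le> riesz_product xs \<omega>"
proof (induction xs rule: riesz_product.induct)
  case (2 k s xs)
  have "\<bar>s\<bar> \<le> 1" by (rule "2.prems"[of k]) simp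
  then have "\<bar>s * clip (\<omega> k)\<bar> \<le> 1 * 1"
    unfolding abs_mult using abs_clip_le by (intro mult_mono) auto
  then have "0 \<le> 1 + s * clip (\<omega> k)" by simp
  moreover have "0 \<le> riesz_product xs \<omega>"
    using "2.prems" by (intro "2.IH") auto
  ultimately have "0 \<le> riesz_product xs \<omega> * (1 + s * clip (\<omega> k))" by (rule mult_nonneg_nonneg[rotated])
  then show ?case by (simp add: algebra_simps)
qed simp

text \<open>A further factor with a far index changes the value of a functional arbitrarily little.\<close>

lemma test_functional_riesz_tendsto:
  assumes \<Lambda>: "test_functional C \<Lambda>" and C: "C \<ge> 0" and F: "F \<le> sequentially"
  shows "((\<lambda>k. \<Lambda> (riesz_product ((k, s) # xs))) \<longlongrightarrow> \<Lambda> (riesz_product xs)) F"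
proof -
  have step: "\<Lambda> (riesz_product ((k, s) # xs)) = \<Lambda> (riesz_product xs) + s * \<Lambda> (\<lambda>\<omega>. riesz_product xs \<omega> * clip (\<omega> k))" for k
    by (simp add: test_functional_add[OF \<Lambda>] test_functional_scale[OF \<Lambda>] test_function_scale
        test_function_mult test_function_clip test_function_riesz)
  have "(\<lambda>k. \<Lambda> (riesz_product xs) + s * \<Lambda> (\<lambda>\<omega>. riesz_product xs \<omega> * clip (\<omega> k)))
      \<longlonglongrightarrow> \<Lambda> (riesz_product xs) + s * 0"
    by (intro tendsto_intros test_functional_bessel[OF \<Lambda> C test_function_riesz])
  then show ?thesis
    unfolding step using F by (auto intro: filterlim_mono)
qed

text \<open>Along a suitable filter, \<open>\<Gamma> \<phi> (u k)\<close> and \<open>\<Gamma> (\<phi> \<epsilon>\<^sub>k) (u k)\<close> have limits \<open>avg \<phi>\<close> and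
  \<open>cor \<phi>\<close>, which are again test functionals. If \<open>R\<close> is the current Riesz product, a new factor
  \<open>1 + s \<epsilon>\<^sub>k\<close> gives the value at \<open>u k\<close>
  \<open>\<Gamma> R (u k) + s \<Gamma> (R \<epsilon>\<^sub>k) (u k)\<close>, close to \<open>avg R + s cor R\<close>. Since later factors alter
  \<open>avg\<close>, \<open>cor\<close>, the mean and all values at earlier vectors only slightly, \<open>avg R\<close> stays near the
  level \<open>\<rho> = avg 1\<close> and \<open>cor R\<close> stays near \<open>cor 1 \<ge> c\<close>. So the functional \<open>\<Gamma> R\<close> lies above \<open>\<rho>\<close>
  at the vectors with sign \<open>1\<close> and below it at those with sign \<open>-1\<close>, by a fixed margin.\<close>

theorem l1_subsequence_of_random_functional:
  fixes u :: "nat \<Rightarrow> 'a::real_normed_vector"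
    and \<Gamma> :: "((nat \<Rightarrow> real) \<Rightarrow> real) \<Rightarrow> 'a \<Rightarrow> real"
  assumes \<Gamma>: "\<And>v. test_functional (norm v) (\<lambda>\<phi>. \<Gamma> \<phi> v)"
    and lin: "\<And>\<phi>. test_function \<phi> \<Longrightarrow> linear (\<Gamma> \<phi>)"
    and lower: "\<And>k. k \<ge> N \<Longrightarrow> c \<le> \<Gamma> (\<lambda>\<omega>. clip (\<omega> k)) (u k)"
    and c: "c > 0" and M: "\<And>k. norm (u k) \<le> M"
  shows "\<exists>r. strict_mono (r :: nat \<Rightarrow> nat) \<and>
    (\<forall>a m. c / 16 * (\<Sum>i<m. \<bar>a i\<bar>) \<le> norm (\<Sum>i<m. a i *\<^sub>R u (r i)))"
proof -
  have M0: "M \<ge> 0" using M[of 0] norm_ge_zero[of "u 0"] by linarith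
  have \<Gamma>M: "test_functional M (\<lambda>\<phi>. \<Gamma> \<phi> (u k))" for k
    by (rule test_functional_mono[OF \<Gamma> M])
  have \<Gamma>clip: "test_functional M (\<lambda>\<phi>. \<Gamma> (\<lambda>\<omega>. \<phi> \<omega> * clip (\<omega> k)) (u k))" for k
    by (rule test_functional_mult_clip[OF \<Gamma>M M0])
  \<comment> \<open>both families of sequences in one, told apart by the boolean\<close>
  define h where "h k i = (case i of (\<phi>, b) \<Rightarrow> if test_function \<phi> then
      (if b then \<Gamma> (\<lambda>\<omega>. \<phi> \<omega> * clip (\<omega> k)) (u k) else \<Gamma> \<phi> (u k)) else 0)" for k and i :: "_ \<times> bool"
  have "\<exists>F. F \<noteq> bot \<and> F \<le> sequentially \<and> (\<forall>i. \<exists>l. ((\<lambda>k. h k i) \<longlongrightarrow> l) F)"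
  proof (rule common_limit_filter)
    fix k and i :: "((nat \<Rightarrow> real) \<Rightarrow> real) \<times> bool"
    show "\<bar>h k i\<bar> \<le> (case i of (\<phi>, _) \<Rightarrow> if test_function \<phi> then M * (\<integral>\<omega>. \<bar>\<phi> \<omega>\<bar> \<partial>sign_measure) else 0)"
      unfolding h_def using test_functional_bound[OF \<Gamma>M] test_functional_bound[OF \<Gamma>clip]
      by (cases i) auto
  qed
  then obtain F where F: "F \<noteq> bot" "F \<le> sequentially" and "\<forall>i. \<exists>l. ((\<lambda>k. h k i) \<longlongrightarrow> l) F"
    by blast
  then obtain l where l: "\<And>i. ((\<lambda>k. h k i) \<longlongrightarrow> l i) F" by metis
  define avg where "avg \<phi> = l (\<phi>, False)" for \<phi>
  define cor where "cor \<phi> = l (\<phi>, True)" for \<phi>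
  have avg_lim: "((\<lambda>k. \<Gamma> \<phi> (u k)) \<longlongrightarrow> avg \<phi>) F" if "test_function \<phi>" for \<phi>
    using l[of "(\<phi>, False)"] that by (simp add: h_def avg_def)
  have cor_lim: "((\<lambda>k. \<Gamma> (\<lambda>\<omega>. \<phi> \<omega> * clip (\<omega> k)) (u k)) \<longlongrightarrow> cor \<phi>) F" if "test_function \<phi>" for \<phi>
    using l[of "(\<phi>, True)"] that by (simp add: h_def cor_def)
  have avg: "test_functional M avg"
    by (rule test_functional_limit[OF \<Gamma>M F(1) avg_lim])
  have cor: "test_functional M cor"
    by (rule test_functional_limit[OF \<Gamma>clip F(1) cor_lim])
  have mean: "test_functional 1 (\<lambda>\<phi>. \<integral>\<omega>. \<phi> \<omega> \<partial>sign_measure)"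
    using test_functional_restriction[of "space sign_measure"]
    by (simp add: indicator_def cong: Bochner_Integration.integral_cong)
  define \<rho> where "\<rho> = avg (\<lambda>_. 1)"
  have cor_1: "c \<le> cor (\<lambda>_. 1)"
  proof (rule tendsto_lowerbound[OF cor_lim[OF test_function_const] _ F(1)])
    have "eventually (\<lambda>k. k \<ge> N) F" by (rule filter_leD[OF F(2) eventually_ge_at_top])
    then show "eventually (\<lambda>k. c \<le> \<Gamma> (\<lambda>\<omega>. 1 * clip (\<omega> k)) (u k)) F"
      by eventually_elim (simp add: lower)
  qed
  define Good where "Good xs \<longleftrightarrow> (\<forall>(k, s)\<in>set xs. s = 1 \<or> s = - 1) \<and>
    cor (riesz_product xs) > c / 2 \<and> \<bar>avg (riesz_product xs) - \<rho>\<bar> < c / 8 \<and>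
    (\<integral>\<omega>. riesz_product xs \<omega> \<partial>sign_measure) < 2 \<and>
    (\<forall>(k, s)\<in>set xs. s * (\<Gamma> (riesz_product xs) (u k) - \<rho>) > c / 8)" for xs
  obtain r where r: "strict_mono r"
    and Good: "\<And>\<theta> m. (\<And>i. \<theta> i = 1 \<or> \<theta> i = - 1) \<Longrightarrow> Good (rev (map (\<lambda>i. (r i, \<theta> i)) [0..<m]))"
  proof (rule sign_tree[of Good F])
    show "Good []" using cor_1 c by (simp add: Good_def \<rho>_def sign_measure.prob_space)
    fix xs s assume xs: "Good xs" and s: "s = 1 \<or> s = (- 1 :: real)"
    let ?R = "\<lambda>k. riesz_product ((k, s) # xs)"
    have "eventually (\<lambda>k. cor (?R k) > c / 2) F"
      using xs by (intro order_tendstoD(1)[OF test_functional_riesz_tendsto[OF cor M0 F(2)]]) (simp add: Good_def)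
    moreover have "eventually (\<lambda>k. \<bar>avg (?R k) - \<rho>\<bar> < c / 8) F"
      using xs by (intro order_tendstoD(2)[OF tendsto_rabs[OF tendsto_diff[OF
        test_functional_riesz_tendsto[OF avg M0 F(2)] tendsto_const]]]) (simp add: Good_def)
    moreover have "eventually (\<lambda>k. (\<integral>\<omega>. ?R k \<omega> \<partial>sign_measure) < 2) F"
      using xs by (intro order_tendstoD(2)[OF test_functional_riesz_tendsto[OF mean zero_le_one F(2)]]) (simp add: Good_def)
    moreover have "eventually (\<lambda>k. \<forall>(j, t)\<in>set xs. t * (\<Gamma> (?R k) (u j) - \<rho>) > c / 8) F"
    proof (intro eventually_ball_finite ballI finite_set, clarify)
      fix j t assume "(j, t) \<in> set xs"
      then have "t * (\<Gamma> (riesz_product xs) (u j) - \<rho>) > c / 8" using xs by (auto simp: Good_def)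
      moreover have "((\<lambda>k. t * (\<Gamma> (?R k) (u j) - \<rho>)) \<longlongrightarrow> t * (\<Gamma> (riesz_product xs) (u j) - \<rho>)) F"
        by (intro tendsto_mult_left tendsto_diff tendsto_const test_functional_riesz_tendsto[OF \<Gamma>M M0 F(2)])
      ultimately show "eventually (\<lambda>k. t * (\<Gamma> (?R k) (u j) - \<rho>) > c / 8) F"
        by (rule order_tendstoD(1)[rotated])
    qed
    moreover have "eventually (\<lambda>k. s * (\<Gamma> (?R k) (u k) - \<rho>) > c / 8) F"
    proof -
      have step: "s * (\<Gamma> (?R k) (u k) - \<rho>)
          = s * (\<Gamma> (riesz_product xs) (u k) - \<rho>) + \<Gamma> (\<lambda>\<omega>. riesz_product xs \<omega> * clip (\<omega> k)) (u k)" for k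
      proof -
        have "\<Gamma> (?R k) (u k) = \<Gamma> (riesz_product xs) (u k) + s * \<Gamma> (\<lambda>\<omega>. riesz_product xs \<omega> * clip (\<omega> k)) (u k)"
          by (simp add: test_functional_add[OF \<Gamma>M] test_functional_scale[OF \<Gamma>M] test_function_scale
              test_function_mult test_function_clip test_function_riesz)
        then show ?thesis using s by (auto simp: algebra_simps)
      qed
      have "((\<lambda>k. s * (\<Gamma> (?R k) (u k) - \<rho>)) \<longlongrightarrow> s * (avg (riesz_product xs) - \<rho>) + cor (riesz_product xs)) F"
        unfolding step
        by (intro tendsto_add tendsto_mult_left tendsto_diff tendsto_const avg_lim cor_lim test_function_riesz)
      moreover have "s * (avg (riesz_product xs) - \<rho>) + cor (riesz_product xs) > c / 8"
      proof -
        have "\<bar>avg (riesz_product xs) - \<rho>\<bar> < c / 8" "cor (riesz_product xs) > c / 2"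
          using xs by (simp_all add: Good_def)
        then show ?thesis using s c by (auto simp: abs_if split: if_splits)
      qed
      ultimately show ?thesis by (rule order_tendstoD(1))
    qed
    ultimately show "eventually (\<lambda>k. Good ((k, s) # xs)) F"
      by eventually_elim (use xs s in \<open>auto simp: Good_def simp del: riesz_product.simps\<close>)
  qed (use F in simp_all)
  \<comment> \<open>here the common level \<open>\<rho>\<close> contributes with the right sign; otherwise it does so for \<open>- a\<close>\<close>
  have pos: "c / 16 * (\<Sum>i<m. \<bar>a i\<bar>) \<le> norm (\<Sum>i<m. a i *\<^sub>R u (r i))" if \<rho>: "\<rho> * (\<Sum>i<m. a i) \<ge> 0" for a m
  proof -
    define \<theta> where "\<theta> i = (if a i \<ge> 0 then 1 else - 1 :: real)" for i
    have \<theta>: "\<theta> i = 1 \<or> \<theta> i = - 1" for i by (simp add: \<theta>_def)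
    define xs where "xs = rev (map (\<lambda>i. (r i, \<theta> i)) [0..<m])"
    define R where "R = riesz_product xs"
    have test: "test_function R" unfolding R_def by (rule test_function_riesz)
    have G: "Good xs" unfolding xs_def by (rule Good[OF \<theta>])
    have "0 \<le> R \<omega>" for \<omega>
      unfolding R_def using G by (intro riesz_product_nonneg) (auto simp: Good_def)
    then have mean_R: "(\<integral>\<omega>. \<bar>R \<omega>\<bar> \<partial>sign_measure) \<le> 2"
      using G by (simp add: Good_def R_def)
    have each: "c / 8 * \<bar>a i\<bar> \<le> a i * (\<Gamma> R (u (r i)) - \<rho>)" if "i < m" for i
    proof -
      have "(r i, \<theta> i) \<in> set xs" using that by (auto simp: xs_def)
      then have "c / 8 \<le> \<theta> i * (\<Gamma> R (u (r i)) - \<rho>)"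
        using G by (auto simp: Good_def R_def less_imp_le)
      then have "c / 8 * \<bar>a i\<bar> \<le> \<theta> i * (\<Gamma> R (u (r i)) - \<rho>) * \<bar>a i\<bar>"
        by (intro mult_right_mono) simp_all
      also have "\<dots> = a i * (\<Gamma> R (u (r i)) - \<rho>)" by (simp add: \<theta>_def)
      finally show ?thesis .
    qed
    have "c / 8 * (\<Sum>i<m. \<bar>a i\<bar>) \<le> (\<Sum>i<m. a i * (\<Gamma> R (u (r i)) - \<rho>))"
      unfolding sum_distrib_left by (intro sum_mono each) simp
    also have "\<dots> = (\<Sum>i<m. a i * \<Gamma> R (u (r i))) - \<rho> * (\<Sum>i<m. a i)"
      by (simp add: right_diff_distrib sum_subtractf sum_distrib_left mult.commute)
    also have "\<dots> \<le> (\<Sum>i<m. a i * \<Gamma> R (u (r i)))" using \<rho> by simp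
    also have "\<dots> = \<Gamma> R (\<Sum>i<m. a i *\<^sub>R u (r i))"
      by (simp add: linear_sum[OF lin[OF test]] linear_scale[OF lin[OF test]])
    also have "\<dots> \<le> norm (\<Sum>i<m. a i *\<^sub>R u (r i)) * (\<integral>\<omega>. \<bar>R \<omega>\<bar> \<partial>sign_measure)"
      by (rule order_trans[OF abs_ge_self test_functional_bound[OF \<Gamma> test]])
    also have "\<dots> \<le> norm (\<Sum>i<m. a i *\<^sub>R u (r i)) * 2"
      by (intro mult_left_mono mean_R) simp
    finally show ?thesis by simp
  qed
  show ?thesis
  proof (intro exI[of _ r] conjI allI r)
    fix a :: "nat \<Rightarrow> real" and m
    show "c / 16 * (\<Sum>i<m. \<bar>a i\<bar>) \<le> norm (\<Sum>i<m. a i *\<^sub>R u (r i))"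
    proof (cases "\<rho> * (\<Sum>i<m. a i) \<ge> 0")
      case False
      then have "\<rho> * (\<Sum>i<m. - a i) \<ge> 0" by (simp add: sum_negf)
      from pos[OF this] show ?thesis by (simp add: sum_negf)
    qed (rule pos)
  qed
qed

context schauder_basis
begin

definition biorthogonal :: "nat \<Rightarrow> 'a \<Rightarrow>\<^sub>L real" where
  "biorthogonal n = Blinfun (\<lambda>v. coef v n)"

lemma biorthogonal_apply: "blinfun_apply (biorthogonal n) v = coef v n"
  by (simp add: biorthogonal_def bounded_linear_Blinfun_apply bounded_linear_coef)

lemma shrinking_if_expansions:
  assumes conv: "\<And>g. (\<lambda>n. blinfun_apply g (x n) *\<^sub>R biorthogonal n) sums g"
  shows "shrinking x"
  unfolding shrinking_def
proof (intro exI[of _ biorthogonal] conjI allI)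
  show "blinfun_apply (biorthogonal m) (x n) = (if m = n then 1 else 0)" for m n
    by (simp add: biorthogonal_apply coef_basis)
  show "schauder_basis_of UNIV biorthogonal"
    unfolding schauder_basis_of_def
  proof (intro conjI ballI ex1I)
    fix g :: "'a \<Rightarrow>\<^sub>L real"
    show "(\<lambda>n. blinfun_apply g (x n) *\<^sub>R biorthogonal n) sums g" by (rule conv)
    fix a assume "(\<lambda>n. a n *\<^sub>R biorthogonal n) sums g"
    then have eval: "(\<lambda>n. blinfun_apply (a n *\<^sub>R biorthogonal n) (x m)) sums blinfun_apply g (x m)" for m
      by (rule bounded_linear.sums[OF blinfun.bounded_linear_left])
    show "a = (\<lambda>n. blinfun_apply g (x n))"
    proof
      fix m
      have "(\<lambda>n. blinfun_apply (a n *\<^sub>R biorthogonal n) (x m)) = (\<lambda>n. if n = m then a n else 0)"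
        by (auto simp: blinfun.scaleR_left biorthogonal_apply coef_basis)
      then have "(\<lambda>n. if n = m then a n else 0) sums blinfun_apply g (x m)" using eval[of m] by simp
      moreover have "(\<lambda>n. if n = m then a n else 0) sums a m" by (rule sums_single)
      ultimately show "a m = blinfun_apply g (x m)" by (rule sums_unique2[symmetric])
    qed
  qed simp
qed

text \<open>If the coordinate expansion of \<open>g\<close> does not converge to \<open>g\<close> in norm, then \<open>g\<close> is not small on some
  tail vector \<open>v - proj N v\<close> with \<open>N\<close> arbitrarily large; cutting off that vector far out and normalizing
  gives a finite block on which \<open>g\<close> is \<open>1\<close>.\<close>

lemma blocks_of_not_shrinking:
  assumes "\<not> shrinking x"
  shows "\<exists>(g :: 'a \<Rightarrow>\<^sub>L real) M. \<forall>N. \<exists>n>N. \<exists>l.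
    blinfun_apply g (\<Sum>j\<in>{N..<n}. l j *\<^sub>R x j) = 1 \<and> norm (\<Sum>j\<in>{N..<n}. l j *\<^sub>R x j) \<le> M"
proof -
  obtain g where "\<not> (\<lambda>n. blinfun_apply g (x n) *\<^sub>R biorthogonal n) sums g"
    using assms shrinking_if_expansions by blast
  then obtain e where e: "e > 0"
    and far: "\<And>N. \<exists>n\<ge>N. e \<le> norm ((\<Sum>i<n. blinfun_apply g (x i) *\<^sub>R biorthogonal i) - g)"
    unfolding sums_def LIMSEQ_iff by (metis not_less)
  define K where "K = basis_const"
  have K: "K > 0" unfolding K_def by (rule basis_const_pos)
  define M where "M = K * (1 + K) * (2 / e)"
  show ?thesis
  proof (intro exI[of _ g] exI[of _ M] allI)
    fix N0
    obtain N where N: "N \<ge> N0" "e \<le> norm ((\<Sum>i<N. blinfun_apply g (x i) *\<^sub>R biorthogonal i) - g)"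
      using far by blast
    define D where "D = (\<Sum>i<N. blinfun_apply g (x i) *\<^sub>R biorthogonal i) - g"
    have D_apply: "blinfun_apply D v = - blinfun_apply g (v - proj N v)" for v
      by (simp add: D_def blinfun.diff_left blinfun.diff_right blinfun.sum_left blinfun.sum_right
          blinfun.scaleR_left blinfun.scaleR_right biorthogonal_apply proj_def mult.commute)
    have "\<exists>v. \<bar>blinfun_apply D v\<bar> > e / 2 * norm v"
    proof (rule ccontr)
      assume "\<not> ?thesis"
      then have "norm D \<le> e / 2" using e by (intro norm_blinfun_bound) (auto simp: not_less)
      then show False using N(2) e by (simp add: D_def)
    qed
    then obtain v where v: "\<bar>blinfun_apply g (v - proj N v)\<bar> > e / 2 * norm v"
      by (auto simp: D_apply)
    define w where "w = v - proj N v"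
    have w_norm: "norm w \<le> (1 + K) * norm v"
      using norm_triangle_ineq4[of v "proj N v"] norm_proj_le[of N v]
      by (simp add: w_def K_def distrib_right)
    have coef_w: "coef w j = 0" if "j < N" for j
    proof -
      have "coef (proj N v) j = coef v j"
        unfolding proj_def using that by (subst coef_sum_basis) simp_all
      then show ?thesis using linear_diff[OF linear_coef, of v "proj N v" j] by (simp add: w_def)
    qed
    have "(\<lambda>n. \<bar>blinfun_apply g (proj n w)\<bar>) \<longlonglongrightarrow> \<bar>blinfun_apply g w\<bar>"
      by (intro tendsto_rabs blinfun.tendsto tendsto_const proj_tendsto)
    then have "eventually (\<lambda>n. \<bar>blinfun_apply g (proj n w)\<bar> > e / 2 * norm v) sequentially"
      by (rule order_tendstoD(1)) (use v in \<open>simp add: w_def\<close>)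
    then have "eventually (\<lambda>n. n > N \<and> \<bar>blinfun_apply g (proj n w)\<bar> > e / 2 * norm v) sequentially"
      by (intro eventually_conj eventually_gt_at_top)
    then obtain n where n: "n > N" "\<bar>blinfun_apply g (proj n w)\<bar> > e / 2 * norm v"
      using eventually_happens'[OF sequentially_bot] by blast
    define z where "z = proj n w"
    define t where "t = blinfun_apply g z"
    have t: "\<bar>t\<bar> > e / 2 * norm v" using n(2) by (simp add: t_def z_def)
    then have "t \<noteq> 0" using e by (metis abs_zero mult_nonneg_nonneg norm_ge_zero not_less half_gt_zero less_imp_le)
    have z_sum: "z = (\<Sum>j\<in>{N0..<n}. coef w j *\<^sub>R x j)"
      unfolding z_def proj_def using coef_w N(1)
      by (intro sum.mono_neutral_right) auto
    have sum_eq: "(\<Sum>j\<in>{N0..<n}. (coef w j / t) *\<^sub>R x j) = (1 / t) *\<^sub>R z"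
      unfolding z_sum by (simp add: scaleR_sum_right)
    have "norm z \<le> K * norm w" unfolding z_def K_def by (rule norm_proj_le)
    also have "\<dots> \<le> K * ((1 + K) * norm v)" using K w_norm by (intro mult_left_mono) auto
    also have "\<dots> \<le> K * ((1 + K) * (2 / e * \<bar>t\<bar>))"
      using K e t by (intro mult_left_mono) (auto simp: field_simps)
    finally have z_norm: "norm z \<le> M * \<bar>t\<bar>" by (simp add: M_def mult_ac)
    have "blinfun_apply g ((1 / t) *\<^sub>R z) = 1"
      using \<open>t \<noteq> 0\<close> by (simp add: blinfun.scaleR_right t_def[symmetric])
    moreover have "norm ((1 / t) *\<^sub>R z) \<le> M"
      using z_norm \<open>t \<noteq> 0\<close> by (simp add: divide_le_eq)
    ultimately show "\<exists>n>N0. \<exists>l. blinfun_apply g (\<Sum>j\<in>{N0..<n}. l j *\<^sub>R x j) = 1 \<and> norm (\<Sum>j\<in>{N0..<n}. l j *\<^sub>R x j) \<le> M"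
      using n(1) N(1) sum_eq by (intro exI[of _ n] conjI exI[of _ "\<lambda>j. coef w j / t"]) auto
  qed
qed

theorem contains_l1_of_RUD_blocks:
  assumes RUD: "\<And>u. block_subsequence x u \<Longrightarrow> RUD u" and not: "\<not> shrinking x"
  shows "contains_isomorphic_subspace TYPE('a) l1_space l1_norm"
proof -
  obtain g :: "'a \<Rightarrow>\<^sub>L real" and M where blocks:
    "\<And>N. \<exists>n>N. \<exists>l. blinfun_apply g (\<Sum>j\<in>{N..<n}. l j *\<^sub>R x j) = 1 \<and> norm (\<Sum>j\<in>{N..<n}. l j *\<^sub>R x j) \<le> M"
    using blocks_of_not_shrinking[OF not] by blast
  define P where "P N n l \<longleftrightarrow> blinfun_apply g (\<Sum>i\<in>{N..<n}. l i *\<^sub>R x i) = 1 \<and>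
    norm (\<Sum>i\<in>{N..<n}. l i *\<^sub>R x i) \<le> M" for N n and l :: "nat \<Rightarrow> real"
  obtain p l where p: "strict_mono p" "p 0 = 0" and pl: "\<And>j. P (p j) (p (Suc j)) l"
  proof (rule consecutive_blocks_choice[where P = "\<lambda>_. P"])
    fix N n and a a' :: "nat \<Rightarrow> real"
    assume "P N n a" and eq: "\<And>i. N \<le> i \<Longrightarrow> i < n \<Longrightarrow> a i = a' i"
    moreover have "(\<Sum>i\<in>{N..<n}. a i *\<^sub>R x i) = (\<Sum>i\<in>{N..<n}. a' i *\<^sub>R x i)"
      using eq by (intro sum.cong) auto
    ultimately show "P N n a'" by (simp add: P_def)
  next
    fix p l assume "strict_mono p" "p 0 = 0" "\<And>j. P (p j) (p (Suc j)) l"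
    then show thesis by (rule that)
  qed (use blocks in \<open>simp add: P_def\<close>)
  define u where "u k = (\<Sum>i\<in>{p k..<p (Suc k)}. l i *\<^sub>R x i)" for k
  have g_u: "blinfun_apply g (u k) = 1" and u_norm: "norm (u k) \<le> M" for k
    using pl[of k] by (simp_all add: u_def P_def)
  have "u k \<noteq> 0" for k using g_u[of k] by (metis blinfun.zero_right zero_neq_one)
  then have "block_subsequence x u"
    unfolding u_def[abs_def] by (intro consecutive_block_subsequence p(1)) blast
  then have "RUD u" by (rule RUD)
  moreover have "grunblum basis_const u"
    unfolding u_def[abs_def] by (rule grunblum_consecutive_blocks[OF p])
  ultimately obtain N c where c: "c > 0" and lower: "\<forall>n a. (\<forall>k. 0 \<le> a k) \<longrightarrow>
    c * (\<Sum>k\<in>{N..<n}. a k) \<le> (\<integral>\<omega>. norm (\<Sum>k\<in>{N..<n}. \<omega> k *\<^sub>R (a k *\<^sub>R u k)) \<partial>sign_measure)"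
    using RUD_average_lower_bound[where u = u, OF _ _ blinfun.bounded_linear_right[of g] g_u] by blast
  have lower': "c * (\<Sum>k\<in>{N..<n}. a k) \<le> (\<integral>\<omega>. norm (\<Sum>k\<in>{N..<n}. \<omega> k *\<^sub>R (a k *\<^sub>R u k)) \<partial>sign_measure)"
    if "\<And>k. 0 \<le> a k" for n a
    using lower that by simp
  obtain \<Gamma> :: "((nat \<Rightarrow> real) \<Rightarrow> real) \<Rightarrow> 'a \<Rightarrow> real"
    where \<Gamma>: "\<And>v. test_functional (norm v) (\<lambda>\<phi>. \<Gamma> \<phi> v)" "\<And>\<phi>. test_function \<phi> \<Longrightarrow> linear (\<Gamma> \<phi>)"
      "\<And>k. k \<ge> N \<Longrightarrow> c \<le> \<Gamma> (\<lambda>\<omega>. clip (\<omega> k)) (u k)"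
    using exists_random_functional[OF lower'] by auto
  obtain r :: "nat \<Rightarrow> nat" where r: "strict_mono r" "\<And>a m. c / 16 * (\<Sum>i<m. \<bar>a i\<bar>) \<le> norm (\<Sum>i<m. a i *\<^sub>R u (r i))"
    using l1_subsequence_of_random_functional[where u = u and N = N, OF \<Gamma> c u_norm] by blast
  show ?thesis
    by (rule contains_l1I[where y = "\<lambda>i. u (r i)" and B = M and c = "c / 16"], rule u_norm, use c in simp, rule r(2))
qed

end

section \<open>Subspaces that exclude shrinking or bounded completeness\<close>

lemma rational_combinations_dense:
  fixes f :: "nat \<Rightarrow> 'b::real_normed_vector"
  assumes "(\<lambda>n. a n *\<^sub>R f n) sums y" and e: "e > 0"
  shows "\<exists>qs :: rat list. norm (y - (\<Sum>i<length qs. real_of_rat (qs ! i) *\<^sub>R f i)) < e"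
proof -
  obtain N where N: "norm ((\<Sum>i<N. a i *\<^sub>R f i) - y) < e / 2"
    using assms LIMSEQ_D[of "\<lambda>n. \<Sum>i<n. a i *\<^sub>R f i" y "e / 2"] unfolding sums_def by auto
  define d where "d i = e / (2 * (real N + 1) * (norm (f i) + 1))" for i
  have d: "d i > 0" for i
    unfolding d_def using e by (intro divide_pos_pos mult_pos_pos add_nonneg_pos) simp_all
  have "\<exists>q. \<bar>a i - real_of_rat q\<bar> < d i" for i
  proof -
    obtain q where "a i < real_of_rat q" "real_of_rat q < a i + d i"
      using of_rat_dense[of "a i" "a i + d i"] d[of i] by auto
    then show ?thesis by (intro exI[of _ q]) auto
  qed
  then obtain q where q: "\<And>i. \<bar>a i - real_of_rat (q i)\<bar> < d i" by metis
  define qs where "qs = map q [0..<N]"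
  have qs: "(\<Sum>i<length qs. real_of_rat (qs ! i) *\<^sub>R f i) = (\<Sum>i<N. real_of_rat (q i) *\<^sub>R f i)"
    by (simp add: qs_def)
  have "norm ((\<Sum>i<N. a i *\<^sub>R f i) - (\<Sum>i<N. real_of_rat (q i) *\<^sub>R f i))
      = norm (\<Sum>i<N. (a i - real_of_rat (q i)) *\<^sub>R f i)"
    by (simp add: sum_subtractf scaleR_left_diff_distrib)
  also have "\<dots> \<le> (\<Sum>i<N. norm ((a i - real_of_rat (q i)) *\<^sub>R f i))" by (rule norm_sum)
  also have "\<dots> \<le> (\<Sum>i<N. e / (2 * (real N + 1)))"
  proof (rule sum_mono)
    fix i
    have "norm ((a i - real_of_rat (q i)) *\<^sub>R f i) \<le> d i * (norm (f i) + 1)"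
      unfolding norm_scaleR using q[of i] by (intro mult_mono) simp_all
    also have "\<dots> = e / (2 * (real N + 1))"
    proof -
      have "norm (f i) + 1 \<noteq> 0" using norm_ge_zero[of "f i"] by linarith
      then show ?thesis by (simp add: d_def)
    qed
    finally show "norm ((a i - real_of_rat (q i)) *\<^sub>R f i) \<le> e / (2 * (real N + 1))" .
  qed
  also have "\<dots> \<le> e / 2" using e by (simp add: field_simps)
  finally have "norm ((\<Sum>i<N. a i *\<^sub>R f i) - (\<Sum>i<N. real_of_rat (q i) *\<^sub>R f i)) \<le> e / 2" .
  then have "norm (y - (\<Sum>i<N. real_of_rat (q i) *\<^sub>R f i)) < e"
    using N norm_triangle_ineq[of "y - (\<Sum>i<N. a i *\<^sub>R f i)" "(\<Sum>i<N. a i *\<^sub>R f i) - (\<Sum>i<N. real_of_rat (q i) *\<^sub>R f i)"]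
    by (simp add: norm_minus_commute)
  then show ?thesis by (intro exI[of _ qs]) (simp add: qs)
qed

text \<open>On the copy of \<open>\<ell>\<^sub>1\<close> the functional \<open>T a \<mapsto> \<Sum> \<theta>\<^sub>n a\<^sub>n\<close> is bounded, and it is extended to \<open>X\<close> by
  taking its graph as the cone of constraints.\<close>

lemma functional_with_prescribed_signs:
  fixes T :: "(nat \<Rightarrow> real) \<Rightarrow> 'a::banach"
  assumes add: "\<And>a b. a \<in> l1_space \<Longrightarrow> b \<in> l1_space \<Longrightarrow> T (\<lambda>n. a n + b n) = T a + T b"
    and scale: "\<And>r a. a \<in> l1_space \<Longrightarrow> T (\<lambda>n. r * a n) = r *\<^sub>R T a"
    and lower: "\<And>a. a \<in> l1_space \<Longrightarrow> l1_norm a \<le> C * norm (T a)"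
    and \<theta>: "\<And>n. \<theta> n = 1 \<or> \<theta> n = - 1"
  shows "\<exists>g :: 'a \<Rightarrow>\<^sub>L real. \<forall>n. blinfun_apply g (T (\<lambda>k. if k = n then 1 else 0)) = \<theta> n"
proof -
  have l1_unit: "(\<lambda>k. if k = n then s else 0) \<in> l1_space" for n and s :: real
    unfolding l1_space_def mem_Collect_eq by (rule summable_finite[of "{n}"]) auto
  have \<theta>_abs: "\<bar>\<theta> n * t\<bar> = \<bar>t\<bar>" for n t using \<theta>[of n] by (auto simp: abs_mult)
  have \<theta>_sum: "summable (\<lambda>n. \<theta> n * a n)" if "a \<in> l1_space" for a
    by (rule summable_rabs_cancel) (use that in \<open>simp add: \<theta>_abs l1_space_def\<close>)
  define p where "p v = max C 0 * norm v" for v :: 'a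
  define W where "W = (\<lambda>a. (T a, \<Sum>n. \<theta> n * a n)) ` l1_space"
  have "sublinear p"
    unfolding sublinear_def
  proof (intro conjI allI impI)
    show "p (v + w) \<le> p v + p w" for v w
      unfolding p_def distrib_left[symmetric] by (intro mult_left_mono norm_triangle_ineq) simp
  qed (simp add: p_def)
  moreover have "convex_cone W"
    unfolding convex_cone_iff
  proof (intro conjI ballI allI impI)
    have zero: "(\<lambda>_. 0) \<in> l1_space" by (simp add: l1_space_def)
    have "T (\<lambda>_. 0) = 0" using scale[OF zero, of 0] by simp
    then show "0 \<in> W" unfolding W_def using zero by (intro image_eqI[of _ _ "\<lambda>_. 0"]) (simp_all add: zero_prod_def)
    fix y z assume "y \<in> W" "z \<in> W"
    then obtain a b where ab: "a \<in> l1_space" "b \<in> l1_space" "y = (T a, \<Sum>n. \<theta> n * a n)" "z = (T b, \<Sum>n. \<theta> n * b n)"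
      unfolding W_def by blast
    then have "y + z = (T (\<lambda>n. a n + b n), \<Sum>n. \<theta> n * (a n + b n))"
      by (simp add: add distrib_left suminf_add \<theta>_sum)
    then show "y + z \<in> W" unfolding W_def using l1_space_add[OF ab(1,2)] by (intro image_eqI[of _ _ "\<lambda>n. a n + b n"]) simp_all
  next
    fix y and r :: real assume "y \<in> W"
    then obtain a where a: "a \<in> l1_space" "y = (T a, \<Sum>n. \<theta> n * a n)" unfolding W_def by blast
    then have "r *\<^sub>R y = (T (\<lambda>n. r * a n), \<Sum>n. \<theta> n * (r * a n))"
      using suminf_mult[OF \<theta>_sum[OF a(1)], of r] by (simp add: scale mult.left_commute)
    then show "r *\<^sub>R y \<in> W" unfolding W_def using l1_space_scale[OF a(1)] by (intro image_eqI[of _ _ "\<lambda>n. r * a n"]) simp_all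
  qed
  moreover have "b \<le> p v" if vb: "(v, b) \<in> W" for v b
  proof -
    obtain a where a: "a \<in> l1_space" "v = T a" "b = (\<Sum>n. \<theta> n * a n)" using vb unfolding W_def by blast
    have abs_sum: "summable (\<lambda>n. \<bar>a n\<bar>)" using a(1) by (simp add: l1_space_def)
    have "b \<le> (\<Sum>n. \<bar>a n\<bar>)"
      unfolding a(3) by (intro suminf_le \<theta>_sum a(1) abs_sum) (metis \<theta>_abs abs_ge_self)
    also have "\<dots> \<le> C * norm v" using lower[OF a(1)] by (simp add: l1_norm_def a(2))
    also have "\<dots> \<le> p v" unfolding p_def by (intro mult_right_mono) simp_all
    finally show ?thesis .
  qed
  ultimately obtain G where G: "linear G" "\<And>v. G v \<le> p v" "\<forall>(v, b)\<in>W. b \<le> G v"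
    using Mazur_Orlicz[of p W] by auto
  have G_abs: "norm (G v) \<le> norm v * max C 0" for v
    using G(2)[of v] G(2)[of "- v"] linear_neg[OF G(1), of v] by (simp add: p_def mult.commute abs_le_iff)
  have G_bl: "bounded_linear G"
    by (rule bounded_linear_intro[OF linear_add[OF G(1)] linear_scale[OF G(1)] G_abs])
  have unit: "s * \<theta> n \<le> s * G (T (\<lambda>k. if k = n then 1 else 0))" for s n
  proof -
    have "(\<Sum>k. \<theta> k * (if k = n then s else 0)) = \<theta> n * s"
      using suminf_finite[of "{n}" "\<lambda>k. \<theta> k * (if k = n then s else 0)"] by simp
    moreover have "(T (\<lambda>k. if k = n then s else 0), \<Sum>k. \<theta> k * (if k = n then s else 0)) \<in> W"
      unfolding W_def using l1_unit by (rule imageI)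
    ultimately have "\<theta> n * s \<le> G (T (\<lambda>k. if k = n then s else 0))" using G(3) by auto
    moreover have "(\<lambda>k. if k = n then s else 0) = (\<lambda>k. s * (if k = n then 1 else 0))" by auto
    ultimately show ?thesis
      by (simp only: scale[OF l1_unit] linear_scale[OF G(1)] real_scaleR_def mult.commute)
  qed
  show ?thesis
  proof (intro exI allI)
    show "blinfun_apply (Blinfun G) (T (\<lambda>k. if k = n then 1 else 0)) = \<theta> n" for n
      using unit[of 1 n] unit[of "-1" n] by (simp add: bounded_linear_Blinfun_apply[OF G_bl])
  qed
qed

text \<open>The functionals \<open>g A\<close> that are \<open>1\<close> at the unit vectors with index in \<open>A\<close> and \<open>-1\<close> at the others are
  \<open>2 / B\<close>-separated, so rational approximations to within \<open>1 / B\<close> are pairwise different. A basis of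
  the dual would leave only countably many of them for uncountably many sets \<open>A\<close>.\<close>

theorem not_shrinking_if_contains_l1:
  fixes x :: "nat \<Rightarrow> 'a::banach"
  assumes "contains_isomorphic_subspace TYPE('a) l1_space l1_norm"
  shows "\<not> shrinking x"
proof
  assume "shrinking x"
  then obtain f :: "nat \<Rightarrow> ('a \<Rightarrow>\<^sub>L real)" where f: "schauder_basis_of UNIV f"
    unfolding shrinking_def by blast
  obtain T :: "(nat \<Rightarrow> real) \<Rightarrow> 'a" and C D where
    T: "\<forall>a\<in>l1_space. \<forall>b\<in>l1_space. T (\<lambda>n. a n + b n) = T a + T b"
      "\<forall>r. \<forall>a\<in>l1_space. T (\<lambda>n. r * a n) = r *\<^sub>R T a"
      "\<forall>a\<in>l1_space. norm (T a) \<le> C * l1_norm a" "\<forall>a\<in>l1_space. l1_norm a \<le> D * norm (T a)"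
    using assms unfolding contains_isomorphic_subspace_def isomorphism_onto_def by blast
  define y where "y n = T (\<lambda>k. if k = n then 1 else 0)" for n
  define B where "B = max C 1"
  have B: "B > 0" by (simp add: B_def)
  have y_norm: "norm (y n) \<le> B" for n
  proof -
    have "(\<lambda>k. if k = n then 1 else 0 :: real) \<in> l1_space"
      unfolding l1_space_def by (auto intro!: summable_finite[of "{n}"])
    moreover have "l1_norm (\<lambda>k. if k = n then 1 else 0) = 1"
      using suminf_finite[of "{n}" "\<lambda>k. \<bar>if k = n then 1 else 0 :: real\<bar>"] by (simp add: l1_norm_def)
    ultimately have "norm (y n) \<le> C" using T(3) unfolding y_def by force
    then show ?thesis by (simp add: B_def)
  qed
  have "\<exists>g :: 'a \<Rightarrow>\<^sub>L real. \<forall>n. blinfun_apply g (y n) = (if n \<in> A then 1 else - 1)" for A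
    unfolding y_def by (rule functional_with_prescribed_signs[where C = D]) (use T in auto)
  then obtain g :: "nat set \<Rightarrow> ('a \<Rightarrow>\<^sub>L real)" where g: "\<And>A n. blinfun_apply (g A) (y n) = (if n \<in> A then 1 else - 1)"
    by metis
  define comb where "comb qs = (\<Sum>i<length qs. real_of_rat (qs ! i) *\<^sub>R f i)" for qs
  have "\<exists>qs. norm (g A - comb qs) < 1 / B" for A
  proof -
    obtain a where "(\<lambda>n. a n *\<^sub>R f n) sums g A" using f unfolding schauder_basis_of_def by blast
    then show ?thesis unfolding comb_def using B by (intro rational_combinations_dense) simp_all
  qed
  then obtain q where q: "\<And>A. norm (g A - comb (q A)) < 1 / B" by metis
  have "inj q"
  proof (rule injI, rule ccontr)
    fix A A' assume eq: "q A = q A'" and "A \<noteq> A'"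
    then obtain n where n: "n \<in> A \<longleftrightarrow> n \<notin> A'" by blast
    have "norm (g A - g A') \<le> norm (g A - comb (q A)) + norm (g A' - comb (q A'))"
      using norm_triangle_ineq4[of "g A - comb (q A)" "g A' - comb (q A')"] eq by simp
    then have close: "norm (g A - g A') < 2 / B" using q[of A] q[of A'] by simp
    have "2 = \<bar>blinfun_apply (g A - g A') (y n)\<bar>"
      using n by (auto simp: blinfun.diff_left g)
    also have "\<dots> \<le> norm (g A - g A') * norm (y n)"
      using norm_blinfun[of "g A - g A'" "y n"] by simp
    also have "\<dots> \<le> norm (g A - g A') * B" by (intro mult_left_mono y_norm) simp
    also have "\<dots> < 2" using close B by (simp add: field_simps)
    finally show False by simp
  qed
  then have "inj (to_nat \<circ> q)" by (intro inj_compose) simp_all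
  then have "surj (inv (to_nat \<circ> q))" by (rule inj_imp_surj_inv)
  then show False using Cantors_theorem[of "UNIV :: nat set"] by auto
qed

lemma coefficients_tendsto_zero:
  fixes c :: "nat \<Rightarrow> real"
  assumes "\<And>\<theta> m. (\<And>i. \<theta> i = 1 \<or> \<theta> i = - 1) \<Longrightarrow> (\<Sum>i<m. \<theta> i * c i) \<le> B"
  shows "c \<longlonglongrightarrow> 0"
proof -
  have "(\<Sum>i<m. \<bar>c i\<bar>) \<le> B" for m
  proof -
    have "(\<Sum>i<m. \<bar>c i\<bar>) = (\<Sum>i<m. (if c i \<ge> 0 then 1 else - 1) * c i)"
      by (intro sum.cong) auto
    also have "\<dots> \<le> B" by (rule assms) auto
    finally show ?thesis .
  qed
  then have "summable (\<lambda>i. \<bar>c i\<bar>)" by (intro summableI_nonneg_bounded[where x = B]) simp_all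
  then show ?thesis using summable_LIMSEQ_zero tendsto_rabs_zero_cancel by blast
qed

text \<open>The images \<open>y n\<close> of the unit vectors are coordinatewise null, because their signed sums are
  bounded. So far-out \<open>y k\<close> are nearly supported behind any given \<open>N\<close>, and the \<open>i\<close>-th block
  approximates such a \<open>y (k i)\<close> within \<open>2\<^sup>-\<^sup>i\<close>. The blocks then inherit bounded sums from
  the \<open>y (k i)\<close>, and bounded completeness would make both tend to zero.\<close>

theorem (in schauder_basis) not_boundedly_complete_if_contains_c0:
  assumes "contains_isomorphic_subspace TYPE('a) c0_space c0_norm"
  shows "\<not> boundedly_complete x"
proof
  assume bc: "boundedly_complete x"
  obtain T :: "(nat \<Rightarrow> real) \<Rightarrow> 'a" and C D where
    T_add: "\<forall>a\<in>c0_space. \<forall>b\<in>c0_space. T (\<lambda>n. a n + b n) = T a + T b"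
    and T_scale: "\<forall>r. \<forall>a\<in>c0_space. T (\<lambda>n. r * a n) = r *\<^sub>R T a"
    and upper: "\<forall>a\<in>c0_space. norm (T a) \<le> C * c0_norm a"
    and lower: "\<forall>a\<in>c0_space. c0_norm a \<le> D * norm (T a)"
    using assms unfolding contains_isomorphic_subspace_def isomorphism_onto_def by blast
  define e where "e n = (\<lambda>k. if k = n then 1 else 0 :: real)" for n :: nat
  define y where "y n = T (e n)" for n
  have finite_c0: "a \<in> c0_space" if fin: "finite {n. a n \<noteq> 0}" for a :: "nat \<Rightarrow> real"
  proof -
    obtain N where N: "\<And>n. a n \<noteq> 0 \<Longrightarrow> n < N"
      using finite_nat_bounded[OF fin] by (auto simp: subset_iff)
    then have "eventually (\<lambda>n. a n = 0) sequentially"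
      unfolding eventually_sequentially by (intro exI[of _ N]) (metis not_less)
    then have "a \<longlonglongrightarrow> 0" by (rule tendsto_eventually)
    then show ?thesis by (simp add: c0_space_def)
  qed
  have e_c0: "e n \<in> c0_space" for n
    by (rule finite_c0) (simp add: e_def)
  have T_sum: "T (\<lambda>k. if k \<in> A then a k else 0) = (\<Sum>k\<in>A. a k *\<^sub>R y k)" if "finite A" for A a
    using that
  proof (induction A rule: finite_induct)
    case empty
    have "T (\<lambda>n. 0 * e 0 n) = 0 *\<^sub>R T (e 0)" using T_scale e_c0 by blast
    then show ?case by simp
  next
    case (insert i A)
    have "(\<lambda>k. if k \<in> A then a k else 0) \<in> c0_space"
      by (rule finite_c0, rule finite_subset[OF _ insert(1)]) auto
    moreover have "(\<lambda>n. a i * e i n) \<in> c0_space"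
      by (rule finite_c0) (simp add: e_def)
    moreover have "(\<lambda>k. if k \<in> insert i A then a k else 0) = (\<lambda>k. (if k \<in> A then a k else 0) + a i * e i k)"
      using insert(2) by (auto simp: e_def)
    ultimately show ?case
      using insert T_add T_scale e_c0 by (simp add: y_def)
  qed
  define B where "B = max C 0"
  have sum_le: "norm (\<Sum>k\<in>A. a k *\<^sub>R y k) \<le> B" if A: "finite A" and a: "\<And>k. \<bar>a k\<bar> \<le> 1" for A a
  proof -
    have mem: "(\<lambda>k. if k \<in> A then a k else 0) \<in> c0_space"
      by (rule finite_c0, rule finite_subset[OF _ A]) auto
    have le1: "c0_norm (\<lambda>k. if k \<in> A then a k else 0) \<le> 1"
      unfolding c0_norm_def by (rule cSUP_least) (use a in auto)
    have "norm (\<Sum>k\<in>A. a k *\<^sub>R y k) \<le> C * c0_norm (\<lambda>k. if k \<in> A then a k else 0)"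
      using upper mem unfolding T_sum[OF A, symmetric] by blast
    also have "\<dots> \<le> B * c0_norm (\<lambda>k. if k \<in> A then a k else 0)"
    proof (rule mult_right_mono)
      have "bdd_above (range (\<lambda>n. \<bar>if n \<in> A then a n else 0\<bar>))"
        by (intro bdd_aboveI2[where M = 1]) (use a in auto)
      then show "0 \<le> c0_norm (\<lambda>k. if k \<in> A then a k else 0)"
        unfolding c0_norm_def by (rule cSUP_upper2[of _ _ 0]) auto
    qed (simp add: B_def)
    also have "\<dots> \<le> B * 1" by (intro mult_left_mono le1) (simp add: B_def)
    finally show ?thesis by simp
  qed
  have y_lower: "1 \<le> D * norm (y n)" for n
  proof -
    have "bdd_above (range (\<lambda>k. \<bar>e n k\<bar>))" by (intro bdd_aboveI2[where M = 1]) (simp add: e_def)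
    then have "1 \<le> c0_norm (e n)"
      unfolding c0_norm_def by (rule cSUP_upper2[of _ _ n]) (simp_all add: e_def)
    also have "\<dots> \<le> D * norm (y n)" using lower e_c0 by (simp add: y_def)
    finally show ?thesis .
  qed
  have coef_null: "(\<lambda>n. coef (y n) j) \<longlonglongrightarrow> 0" for j
  proof -
    obtain L where L: "\<And>v. norm (coef v j) \<le> norm v * L" "L \<ge> 0"
      using bounded_linear.nonneg_bounded[OF bounded_linear_coef[of j]] by blast
    show ?thesis
    proof (rule coefficients_tendsto_zero[where B = "B * L"])
      fix \<theta> :: "nat \<Rightarrow> real" and m assume \<theta>: "\<And>i. \<theta> i = 1 \<or> \<theta> i = - 1"
      have \<theta>1: "\<bar>\<theta> k\<bar> \<le> 1" for k using \<theta>[of k] by auto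
      have "(\<Sum>i<m. \<theta> i * coef (y i) j) = coef (\<Sum>i<m. \<theta> i *\<^sub>R y i) j"
        by (simp add: linear_sum[OF linear_coef] linear_scale[OF linear_coef])
      also have "\<dots> \<le> norm (\<Sum>i<m. \<theta> i *\<^sub>R y i) * L"
        using L(1)[of "\<Sum>i<m. \<theta> i *\<^sub>R y i"] by (simp add: abs_le_iff)
      also have "\<dots> \<le> B * L" by (intro mult_right_mono sum_le \<theta>1 L(2)) simp
      finally show "(\<Sum>i<m. \<theta> i * coef (y i) j) \<le> B * L" .
    qed
  qed
  have proj_null: "(\<lambda>n. proj N (y n)) \<longlonglongrightarrow> 0" for N
  proof -
    have "(\<lambda>n. \<Sum>j<N. coef (y n) j *\<^sub>R x j) \<longlonglongrightarrow> (\<Sum>j<N. 0 *\<^sub>R x j)"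
      by (intro tendsto_intros coef_null)
    then show ?thesis by (simp add: proj_def)
  qed
  \<comment> \<open>requiring \<open>k\<close> to lie in the block keeps the chosen indices distinct\<close>
  have ex: "\<exists>n>N. \<exists>l. \<exists>k\<in>{N..<n}. norm (y k - (\<Sum>j\<in>{N..<n}. l j *\<^sub>R x j)) \<le> (1 / 2) ^ i" for i N
  proof -
    define d where "d = (1 / 2 :: real) ^ i / 2"
    have d: "d > 0" by (simp add: d_def)
    have "eventually (\<lambda>k. norm (proj N (y k)) < d) sequentially"
      using order_tendstoD(2)[OF tendsto_norm[OF proj_null[of N]], of d] d by simp
    then have "eventually (\<lambda>k. k \<ge> N \<and> norm (proj N (y k)) < d) sequentially"
      by (intro eventually_conj eventually_ge_at_top)
    then obtain k where k: "k \<ge> N" "norm (proj N (y k)) < d"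
      using eventually_happens'[OF sequentially_bot] by blast
    have "eventually (\<lambda>n. norm (proj n (y k) - y k) < d) sequentially"
      using tendstoD[OF proj_tendsto[of "y k"] d] by (simp add: dist_norm)
    then have "eventually (\<lambda>n. n > k \<and> norm (proj n (y k) - y k) < d) sequentially"
      by (intro eventually_conj eventually_gt_at_top)
    then obtain n where n: "n > k" "norm (proj n (y k) - y k) < d"
      using eventually_happens'[OF sequentially_bot] by blast
    have "proj n (y k) = proj N (y k) + (\<Sum>j\<in>{N..<n}. coef (y k) j *\<^sub>R x j)"
      using sum.atLeastLessThan_concat[of 0 N n "\<lambda>j. coef (y k) j *\<^sub>R x j"] k n
      by (simp add: proj_def atLeast0LessThan)
    then have eq: "y k - (\<Sum>j\<in>{N..<n}. coef (y k) j *\<^sub>R x j) = proj N (y k) - (proj n (y k) - y k)"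
      by (simp add: algebra_simps)
    then have "norm (y k - (\<Sum>j\<in>{N..<n}. coef (y k) j *\<^sub>R x j)) \<le> d + d"
      unfolding eq using norm_triangle_ineq4[of "proj N (y k)" "proj n (y k) - y k"] k n by linarith
    then show ?thesis
      using k n by (intro exI[of _ n] conjI exI[of _ "coef (y k)"] bexI[of _ k]) (simp_all add: d_def)
  qed
  obtain p l where p: "strict_mono p" "p 0 = 0"
    and pl: "\<And>i. \<exists>k\<in>{p i..<p (Suc i)}. norm (y k - (\<Sum>j\<in>{p i..<p (Suc i)}. l j *\<^sub>R x j)) \<le> (1 / 2) ^ i"
  proof (rule consecutive_blocks_choice[where P = "\<lambda>i N n l. \<exists>k\<in>{N..<n}. norm (y k - (\<Sum>j\<in>{N..<n}. l j *\<^sub>R x j)) \<le> (1 / 2) ^ i"])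
    fix i N n :: nat and a a' :: "nat \<Rightarrow> real"
    assume "\<exists>k\<in>{N..<n}. norm (y k - (\<Sum>j\<in>{N..<n}. a j *\<^sub>R x j)) \<le> (1 / 2) ^ i"
      and eq: "\<And>i. N \<le> i \<Longrightarrow> i < n \<Longrightarrow> a i = a' i"
    moreover have "(\<Sum>j\<in>{N..<n}. a j *\<^sub>R x j) = (\<Sum>j\<in>{N..<n}. a' j *\<^sub>R x j)"
      using eq by (intro sum.cong) auto
    ultimately show "\<exists>k\<in>{N..<n}. norm (y k - (\<Sum>j\<in>{N..<n}. a' j *\<^sub>R x j)) \<le> (1 / 2) ^ i" by simp
  next
    fix p l assume "strict_mono p" "p 0 = 0"
      "\<And>i. \<exists>k\<in>{p i..<p (Suc i)}. norm (y k - (\<Sum>j\<in>{p i..<p (Suc i)}. l j *\<^sub>R x j)) \<le> (1 / 2) ^ i"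
    then show thesis by (rule that)
  qed (rule ex)
  obtain k where k: "\<And>i. k i \<in> {p i..<p (Suc i)}"
    and close: "\<And>i. norm (y (k i) - (\<Sum>j\<in>{p i..<p (Suc i)}. l j *\<^sub>R x j)) \<le> (1 / 2) ^ i"
    using pl by metis
  define b where "b i = (\<Sum>j\<in>{p i..<p (Suc i)}. l j *\<^sub>R x j)" for i
  have inj_k: "inj k"
  proof (rule injI)
    fix i j assume "k i = k j"
    then show "i = j"
      using block_index_unique[OF p(1), of i "k i" j] k[of i] k[of j] by simp
  qed
  have sum_y: "norm (\<Sum>i<m. y (k i)) \<le> B" for m
  proof -
    have "(\<Sum>i<m. y (k i)) = (\<Sum>n\<in>k ` {..<m}. 1 *\<^sub>R y n)"
      by (subst sum.reindex) (use inj_k in \<open>auto simp: inj_on_def\<close>)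
    also have "norm \<dots> \<le> B" by (rule sum_le) auto
    finally show ?thesis .
  qed
  have sum_err: "norm (\<Sum>i<m. b i - y (k i)) \<le> 2" for m
  proof -
    have "norm (\<Sum>i<m. b i - y (k i)) \<le> (\<Sum>i<m. (1 / 2) ^ i)"
      using close by (intro sum_norm_le) (simp add: b_def norm_minus_commute)
    also have "\<dots> \<le> (\<Sum>i. (1 / 2) ^ i)" by (intro sum_le_suminf summable_geometric) simp_all
    also have "\<dots> = 2" by (subst suminf_geometric) simp_all
    finally show ?thesis .
  qed
  have blocks_le: "norm (\<Sum>j<p m. l j *\<^sub>R x j) \<le> B + 2" for m
  proof -
    have "(\<Sum>j<p m. l j *\<^sub>R x j) = (\<Sum>i<m. b i)"
      using sum_consecutive_blocks[OF p(1), where m = m and g = "\<lambda>j. l j *\<^sub>R x j"] p(2)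
      by (simp add: b_def atLeast0LessThan)
    also have "\<dots> = (\<Sum>i<m. y (k i)) + (\<Sum>i<m. b i - y (k i))"
      by (simp add: sum_subtractf)
    also have "norm \<dots> \<le> B + 2"
      by (intro order_trans[OF norm_triangle_ineq] add_mono sum_y sum_err)
    finally show ?thesis .
  qed
  have "norm (\<Sum>j<n. l j *\<^sub>R x j) \<le> basis_const * (B + 2)" for n
  proof -
    have "n \<le> p n" by (rule strict_mono_imp_increasing[OF p(1)])
    then have "norm (\<Sum>j<n. l j *\<^sub>R x j) \<le> basis_const * norm (\<Sum>j<p n. l j *\<^sub>R x j)"
      by (rule norm_initial_sum_le)
    also have "\<dots> \<le> basis_const * (B + 2)"
      using basis_const_pos by (intro mult_left_mono blocks_le) simp
    finally show ?thesis .
  qed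
  then have "bounded (range (\<lambda>N. \<Sum>n<N. l n *\<^sub>R x n))"
    unfolding bounded_iff by blast
  then have summable: "summable (\<lambda>n. l n *\<^sub>R x n)"
    using bc unfolding boundedly_complete_def by blast
  have "b \<longlonglongrightarrow> 0"
  proof (rule LIMSEQ_I)
    fix r :: real assume "r > 0"
    then obtain N where N: "\<And>m n. m \<ge> N \<Longrightarrow> norm (\<Sum>j\<in>{m..<n}. l j *\<^sub>R x j) < r"
      using summable unfolding summable_Cauchy by blast
    have "norm (b i - 0) < r" if "i \<ge> N" for i
      using N[of "p i" "p (Suc i)"] strict_mono_imp_increasing[OF p(1), of i] that by (simp add: b_def)
    then show "\<exists>N. \<forall>i\<ge>N. norm (b i - 0) < r" by blast
  qed
  moreover have "(\<lambda>i. y (k i) - b i) \<longlonglongrightarrow> 0"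
  proof (rule Lim_null_comparison)
    show "eventually (\<lambda>i. norm (y (k i) - b i) \<le> (1 / 2) ^ i) sequentially"
      using close by (simp add: b_def)
  qed (rule LIMSEQ_power_zero, simp)
  ultimately have "(\<lambda>i. b i + (y (k i) - b i)) \<longlonglongrightarrow> 0 + 0" by (intro tendsto_add)
  then have "(\<lambda>i. D * norm (y (k i))) \<longlonglongrightarrow> D * 0"
    by (intro tendsto_mult_left) (simp add: tendsto_norm_zero)
  then have "1 \<le> D * 0"
    by (rule LIMSEQ_le_const) (use y_lower in blast)
  then show False by simp
qed

section \<open>Shrinking and boundedly complete bases\<close>

theorem theorem2p12:
  fixes x :: "nat \<Rightarrow> 'a::banach"
  assumes "schauder_basis_of UNIV x"
  shows "((\<forall>u. block_subsequence x u \<longrightarrow> RUD u) \<longrightarrow>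
            (shrinking x \<longleftrightarrow> \<not> contains_isomorphic_subspace TYPE('a) l1_space l1_norm)) \<and>
         ((\<forall>u. block_subsequence x u \<longrightarrow> RUC u) \<longrightarrow>
            (boundedly_complete x \<longleftrightarrow> \<not> contains_isomorphic_subspace TYPE('a) c0_space c0_norm))"
proof -
  interpret schauder_basis x by standard (rule assms)
  show ?thesis
    using contains_l1_of_RUD_blocks not_shrinking_if_contains_l1
      contains_c0_of_RUC_blocks not_boundedly_complete_if_contains_c0 by blast
qed

end
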